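(* Let $(M,\kappa)$ be a connected almost symplectic manifold of dimension $2n$. Assume there exists a Riemannian metric $g$ on $M$ with $d\mu(g)=\frac{\kappa^n}{n!}$ such that the field of endomorphisms $R$ of $TM$ determined by $g(X,Y)=\kappa(RX,Y)$ (for all tangent vectors $X,Y$) satisfies $N_R\equiv 0$. Then the orthogonal component $J$ of $R$ in its $g$-polar decomposition is $g$-skew-symmetric and satisfies $N_J\equiv 0$. Moreover, if $d\kappa=0$, then $(M,g,J)$ is a Kähler manifold.
   Context: Everything is smooth. An almost symplectic manifold is a manifold $M$ with a (not necessarily closed) nondegenerate 2-form $\kappa$; $d\mu(g)$ denotes the Riemannian volume form of $g$ (with respect to the orientation given by $\kappa^n$). For a field of endomorphisms $S$ of $TM$, its Nijenhuis tensor is $$N_S(X,Y)=[SX,SY]+S^2[X,Y]-S[SX,Y]-S[X,SY].$$ $g$-polar decomposition: $R=SJ$ with $S$ $g$-symmetric and positive definite and $J$ $g$-orthogonal; $J$ is the orthogonal component. "$J$ is $g$-skew-symmetric" means $g(JX,Y)=-g(X,JY)$. "$(M,g,J)$ is Kähler" means: $J^2=-\mathrm{Id}$, $N_J=0$, $g(J\cdot,\cdot)$ is skew-symmetric (a 2-form), and this 2-form is closed. *)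

theory Defs
  imports "HOL-Analysis.Analysis" "HOL-Library.FuncSet" "HOL-Combinatorics.Permutations"
begin

section \<open>Smooth maps between Euclidean spaces\<close>

text \<open>All functions below are used on open sets only, where \<^const>\<open>frechet_derivative\<close> at a point
  is unambiguous.\<close>

primrec Ck_on :: "nat \<Rightarrow> 'e::euclidean_space set \<Rightarrow> ('e \<Rightarrow> 'f::real_normed_vector) \<Rightarrow> bool" where
  "Ck_on 0 W f \<longleftrightarrow> continuous_on W f"
| "Ck_on (Suc k) W f \<longleftrightarrow> (\<forall>x\<in>W. f differentiable (at x)) \<and>
     (\<forall>v. Ck_on k W (\<lambda>x. frechet_derivative f (at x) v))"

definition smooth_on :: "'e::euclidean_space set \<Rightarrow> ('e \<Rightarrow> 'f::real_normed_vector) \<Rightarrow> bool" where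
  "smooth_on W f \<longleftrightarrow> (\<forall>k. Ck_on k W f)"

section \<open>Smooth manifolds and tangent vectors\<close>

text \<open>The manifold is the whole type \<open>'a\<close>, with its type class topology; a chart is a pair of a
  domain and a coordinate map, and the smooth structure is given by an atlas.\<close>

type_synonym ('a, 'e) chart = "'a set \<times> ('a \<Rightarrow> 'e)"

definition chart_inv :: "('a, 'e) chart \<Rightarrow> 'e \<Rightarrow> 'a" where
  "chart_inv c = inv_into (fst c) (snd c)"

definition transition :: "('a, 'e) chart \<Rightarrow> ('a, 'e) chart \<Rightarrow> 'e \<Rightarrow> 'e" where
  "transition c d = snd d \<circ> chart_inv c"

definition smooth_atlas ::
    "('a::{t2_space,second_countable_topology}, 'e::euclidean_space) chart set \<Rightarrow> bool" where
  "smooth_atlas A \<longleftrightarrow>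
     (\<forall>c\<in>A. open (fst c) \<and> open (snd c ` fst c) \<and>
        homeomorphism (fst c) (snd c ` fst c) (snd c) (chart_inv c)) \<and>
     (\<Union>c\<in>A. fst c) = UNIV \<and>
     (\<forall>c\<in>A. \<forall>d\<in>A. smooth_on (snd c ` (fst c \<inter> fst d)) (transition c d))"

text \<open>A tangent vector at \<open>p\<close> is the family of its components in the charts of the atlas around \<open>p\<close>,
  related by the derivatives of the transition maps; the entries at all other charts are \<open>0\<close>, so
  that equality of families is equality of tangent vectors.\<close>

type_synonym ('a, 'e) tvec = "('a, 'e) chart \<Rightarrow> 'e"

definition tangent_space ::
    "('a, 'e::euclidean_space) chart set \<Rightarrow> 'a \<Rightarrow> ('a, 'e) tvec set" where
  "tangent_space A p = {x.
     (\<forall>c. c \<notin> A \<or> p \<notin> fst c \<longrightarrow> x c = 0) \<and>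
     (\<forall>c\<in>A. \<forall>d\<in>A. p \<in> fst c \<and> p \<in> fst d \<longrightarrow>
        x d = frechet_derivative (transition c d) (at (snd c p)) (x c))}"

definition tzero :: "('a, 'e::euclidean_space) tvec" where
  "tzero = (\<lambda>c. 0)"

definition tcomb :: "real \<Rightarrow> ('a, 'e::euclidean_space) tvec \<Rightarrow> real \<Rightarrow> ('a, 'e) tvec \<Rightarrow> ('a, 'e) tvec" where
  "tcomb a x b y = (\<lambda>c. a *\<^sub>R x c + b *\<^sub>R y c)"

text \<open>The coordinate vector field of the chart \<open>c\<close> with constant component \<open>v\<close> in \<open>c\<close>.\<close>

definition coord_field ::
    "('a, 'e::euclidean_space) chart set \<Rightarrow> ('a, 'e) chart \<Rightarrow> 'e \<Rightarrow> 'a \<Rightarrow> ('a, 'e) tvec" where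
  "coord_field A c v p = (\<lambda>d. if d \<in> A \<and> p \<in> fst d
     then frechet_derivative (transition c d) (at (snd c p)) v else 0)"

section \<open>Vector fields, endomorphism fields and bilinear forms\<close>

definition vector_field_on ::
    "('a::topological_space, 'e::euclidean_space) chart set \<Rightarrow> 'a set \<Rightarrow> ('a \<Rightarrow> ('a, 'e) tvec) \<Rightarrow> bool" where
  "vector_field_on A U X \<longleftrightarrow>
     (\<forall>p\<in>U. X p \<in> tangent_space A p) \<and>
     (\<forall>c\<in>A. smooth_on (snd c ` (fst c \<inter> U)) (\<lambda>y. X (chart_inv c y) c))"

definition tangent_endo ::
    "('a, 'e::euclidean_space) chart set \<Rightarrow> 'a \<Rightarrow> (('a, 'e) tvec \<Rightarrow> ('a, 'e) tvec) \<Rightarrow> bool" where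
  "tangent_endo A p L \<longleftrightarrow>
     L \<in> tangent_space A p \<rightarrow> tangent_space A p \<and>
     (\<forall>x\<in>tangent_space A p. \<forall>y\<in>tangent_space A p. \<forall>a b.
        L (tcomb a x b y) = tcomb a (L x) b (L y))"

definition endo_field ::
    "('a, 'e::euclidean_space) chart set \<Rightarrow> ('a \<Rightarrow> ('a, 'e) tvec \<Rightarrow> ('a, 'e) tvec) \<Rightarrow> bool" where
  "endo_field A S \<longleftrightarrow>
     (\<forall>p. tangent_endo A p (S p)) \<and>
     (\<forall>c\<in>A. \<forall>v. smooth_on (snd c ` fst c)
        (\<lambda>y. S (chart_inv c y) (coord_field A c v (chart_inv c y)) c))"

definition form_comp ::
    "('a, 'e::euclidean_space) chart set \<Rightarrow> ('a \<Rightarrow> ('a, 'e) tvec \<Rightarrow> ('a, 'e) tvec \<Rightarrow> real) \<Rightarrow>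
      ('a, 'e) chart \<Rightarrow> 'e \<Rightarrow> 'e \<Rightarrow> 'e \<Rightarrow> real" where
  "form_comp A B c v w y =
     B (chart_inv c y) (coord_field A c v (chart_inv c y)) (coord_field A c w (chart_inv c y))"

definition bilinear_field ::
    "('a, 'e::euclidean_space) chart set \<Rightarrow> ('a \<Rightarrow> ('a, 'e) tvec \<Rightarrow> ('a, 'e) tvec \<Rightarrow> real) \<Rightarrow> bool" where
  "bilinear_field A B \<longleftrightarrow>
     (\<forall>p. \<forall>x\<in>tangent_space A p. \<forall>y\<in>tangent_space A p. \<forall>z\<in>tangent_space A p. \<forall>a b.
        B p (tcomb a x b y) z = a * B p x z + b * B p y z \<and>
        B p z (tcomb a x b y) = a * B p z x + b * B p z y) \<and>
     (\<forall>c\<in>A. \<forall>v w. smooth_on (snd c ` fst c) (form_comp A B c v w))"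

definition riemannian_metric ::
    "('a, 'e::euclidean_space) chart set \<Rightarrow> ('a \<Rightarrow> ('a, 'e) tvec \<Rightarrow> ('a, 'e) tvec \<Rightarrow> real) \<Rightarrow> bool" where
  "riemannian_metric A g \<longleftrightarrow> bilinear_field A g \<and>
     (\<forall>p. \<forall>x\<in>tangent_space A p. \<forall>y\<in>tangent_space A p. g p x y = g p y x) \<and>
     (\<forall>p. \<forall>x\<in>tangent_space A p. x \<noteq> tzero \<longrightarrow> g p x x > 0)"

definition two_form ::
    "('a, 'e::euclidean_space) chart set \<Rightarrow> ('a \<Rightarrow> ('a, 'e) tvec \<Rightarrow> ('a, 'e) tvec \<Rightarrow> real) \<Rightarrow> bool" where
  "two_form A \<omega> \<longleftrightarrow> bilinear_field A \<omega> \<and>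
     (\<forall>p. \<forall>x\<in>tangent_space A p. \<forall>y\<in>tangent_space A p. \<omega> p x y = - \<omega> p y x)"

definition almost_symplectic ::
    "('a, 'e::euclidean_space) chart set \<Rightarrow> ('a \<Rightarrow> ('a, 'e) tvec \<Rightarrow> ('a, 'e) tvec \<Rightarrow> real) \<Rightarrow> bool" where
  "almost_symplectic A \<kappa> \<longleftrightarrow> two_form A \<kappa> \<and>
     (\<forall>p. \<forall>x\<in>tangent_space A p. (\<forall>y\<in>tangent_space A p. \<kappa> p x y = 0) \<longrightarrow> x = tzero)"

text \<open>The coordinate expression of the exterior derivative of a 2-form: since coordinate fields
  commute, the bracket terms of the invariant formula are absent.\<close>

definition ext_deriv ::
    "('a, 'e::euclidean_space) chart set \<Rightarrow> ('a \<Rightarrow> ('a, 'e) tvec \<Rightarrow> ('a, 'e) tvec \<Rightarrow> real) \<Rightarrow>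
      ('a, 'e) chart \<Rightarrow> 'a \<Rightarrow> 'e \<Rightarrow> 'e \<Rightarrow> 'e \<Rightarrow> real" where
  "ext_deriv A \<omega> c p u v w =
     frechet_derivative (form_comp A \<omega> c v w) (at (snd c p)) u
     - frechet_derivative (form_comp A \<omega> c u w) (at (snd c p)) v
     + frechet_derivative (form_comp A \<omega> c u v) (at (snd c p)) w"

definition closed_form ::
    "('a, 'e::euclidean_space) chart set \<Rightarrow> ('a \<Rightarrow> ('a, 'e) tvec \<Rightarrow> ('a, 'e) tvec \<Rightarrow> real) \<Rightarrow> bool" where
  "closed_form A \<omega> \<longleftrightarrow> (\<forall>c\<in>A. \<forall>p\<in>fst c. \<forall>u v w. ext_deriv A \<omega> c p u v w = 0)"

section \<open>Lie bracket and Nijenhuis tensor\<close>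

definition lie_bracket ::
    "('a, 'e::euclidean_space) chart set \<Rightarrow> ('a \<Rightarrow> ('a, 'e) tvec) \<Rightarrow> ('a \<Rightarrow> ('a, 'e) tvec) \<Rightarrow>
      'a \<Rightarrow> ('a, 'e) tvec" where
  "lie_bracket A X Y p = (\<lambda>c. if c \<in> A \<and> p \<in> fst c then
       frechet_derivative (\<lambda>y. Y (chart_inv c y) c) (at (snd c p)) (X p c)
       - frechet_derivative (\<lambda>y. X (chart_inv c y) c) (at (snd c p)) (Y p c)
     else 0)"

definition nijenhuis ::
    "('a, 'e::euclidean_space) chart set \<Rightarrow> ('a \<Rightarrow> ('a, 'e) tvec \<Rightarrow> ('a, 'e) tvec) \<Rightarrow>
      ('a \<Rightarrow> ('a, 'e) tvec) \<Rightarrow> ('a \<Rightarrow> ('a, 'e) tvec) \<Rightarrow> 'a \<Rightarrow> ('a, 'e) tvec" where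
  "nijenhuis A S X Y p = (let SX = (\<lambda>q. S q (X q)); SY = (\<lambda>q. S q (Y q)) in
     (\<lambda>c. lie_bracket A SX SY p c + S p (S p (lie_bracket A X Y p)) c
        - S p (lie_bracket A SX Y p) c - S p (lie_bracket A X SY p) c))"

text \<open>The vanishing of the Nijenhuis tensor is tested on vector fields over arbitrary open sets, so
  that it is a local condition.\<close>

definition nijenhuis_zero ::
    "('a::topological_space, 'e::euclidean_space) chart set \<Rightarrow>
      ('a \<Rightarrow> ('a, 'e) tvec \<Rightarrow> ('a, 'e) tvec) \<Rightarrow> bool" where
  "nijenhuis_zero A S \<longleftrightarrow>
     (\<forall>U X Y. open U \<and> vector_field_on A U X \<and> vector_field_on A U Y \<longrightarrow>
        (\<forall>p\<in>U. nijenhuis A S X Y p = tzero))"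

section \<open>Volume forms\<close>

text \<open>A \<open>k\<close>-form on a tangent space is a function of a sequence of vectors, of which only the first
  \<open>k\<close> are used.\<close>

definition wedge ::
    "nat \<Rightarrow> nat \<Rightarrow> ((nat \<Rightarrow> 'v) \<Rightarrow> real) \<Rightarrow> ((nat \<Rightarrow> 'v) \<Rightarrow> real) \<Rightarrow> (nat \<Rightarrow> 'v) \<Rightarrow> real" where
  "wedge k l \<alpha> \<beta> v =
     (\<Sum>\<sigma> | \<sigma> permutes {..<k + l}. of_int (sign \<sigma>) * \<alpha> (v \<circ> \<sigma>) * \<beta> (\<lambda>i. v (\<sigma> (k + i))))
       / (fact k * fact l)"

primrec wedge_power :: "('v \<Rightarrow> 'v \<Rightarrow> real) \<Rightarrow> nat \<Rightarrow> (nat \<Rightarrow> 'v) \<Rightarrow> real" where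
  "wedge_power \<omega> 0 = (\<lambda>v. 1)"
| "wedge_power \<omega> (Suc m) = wedge 2 (2 * m) (\<lambda>v. \<omega> (v 0) (v 1)) (wedge_power \<omega> m)"

text \<open>The volume form of the inner product \<open>h\<close> on an \<open>m\<close>-dimensional space for the orientation in
  which a basis is positive iff the nonzero \<open>m\<close>-form \<open>\<theta>\<close> is positive on it: up to this sign, its
  value on a basis is the square root of the Gram determinant.\<close>

definition volume_form ::
    "nat \<Rightarrow> ((nat \<Rightarrow> 'v) \<Rightarrow> real) \<Rightarrow> ('v \<Rightarrow> 'v \<Rightarrow> real) \<Rightarrow> (nat \<Rightarrow> 'v) \<Rightarrow> real" where
  "volume_form m \<theta> h v = sgn (\<theta> v) *
     sqrt (\<Sum>\<sigma> | \<sigma> permutes {..<m}. of_int (sign \<sigma>) * (\<Prod>i<m. h (v i) (v (\<sigma> i))))"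

section \<open>Polar decomposition, Kaehler manifolds\<close>

definition polar_decomposition ::
    "('a, 'e::euclidean_space) chart set \<Rightarrow> ('a \<Rightarrow> ('a, 'e) tvec \<Rightarrow> ('a, 'e) tvec \<Rightarrow> real) \<Rightarrow> 'a \<Rightarrow>
      (('a, 'e) tvec \<Rightarrow> ('a, 'e) tvec) \<Rightarrow> (('a, 'e) tvec \<Rightarrow> ('a, 'e) tvec) \<Rightarrow>
      (('a, 'e) tvec \<Rightarrow> ('a, 'e) tvec) \<Rightarrow> bool" where
  "polar_decomposition A g p L S J \<longleftrightarrow>
     tangent_endo A p S \<and> tangent_endo A p J \<and>
     (\<forall>x\<in>tangent_space A p. L x = S (J x)) \<and>
     (\<forall>x\<in>tangent_space A p. \<forall>y\<in>tangent_space A p. g p (S x) y = g p x (S y)) \<and>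
     (\<forall>x\<in>tangent_space A p. x \<noteq> tzero \<longrightarrow> g p (S x) x > 0) \<and>
     (\<forall>x\<in>tangent_space A p. \<forall>y\<in>tangent_space A p. g p (J x) (J y) = g p x y)"

text \<open>Values off the tangent space are fixed by extensionality, to make \<open>J\<close> unique as a HOL
  function. No regularity in \<open>p\<close> is built in.\<close>

definition orthogonal_component ::
    "('a, 'e::euclidean_space) chart set \<Rightarrow> ('a \<Rightarrow> ('a, 'e) tvec \<Rightarrow> ('a, 'e) tvec \<Rightarrow> real) \<Rightarrow>
      ('a \<Rightarrow> ('a, 'e) tvec \<Rightarrow> ('a, 'e) tvec) \<Rightarrow> 'a \<Rightarrow> ('a, 'e) tvec \<Rightarrow> ('a, 'e) tvec" where
  "orthogonal_component A g R p =
     (THE J. J \<in> extensional (tangent_space A p) \<and> (\<exists>S. polar_decomposition A g p (R p) S J))"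

definition skew_symmetric ::
    "('a, 'e::euclidean_space) chart set \<Rightarrow> ('a \<Rightarrow> ('a, 'e) tvec \<Rightarrow> ('a, 'e) tvec \<Rightarrow> real) \<Rightarrow>
      ('a \<Rightarrow> ('a, 'e) tvec \<Rightarrow> ('a, 'e) tvec) \<Rightarrow> bool" where
  "skew_symmetric A g J \<longleftrightarrow>
     (\<forall>p. \<forall>x\<in>tangent_space A p. \<forall>y\<in>tangent_space A p. g p (J p x) y = - g p x (J p y))"

definition kaehler ::
    "('a::topological_space, 'e::euclidean_space) chart set \<Rightarrow>
      ('a \<Rightarrow> ('a, 'e) tvec \<Rightarrow> ('a, 'e) tvec \<Rightarrow> real) \<Rightarrow>
      ('a \<Rightarrow> ('a, 'e) tvec \<Rightarrow> ('a, 'e) tvec) \<Rightarrow> bool" where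
  "kaehler A g J \<longleftrightarrow> riemannian_metric A g \<and> endo_field A J \<and>
     (\<forall>p. \<forall>x\<in>tangent_space A p. J p (J p x) = (\<lambda>c. - x c)) \<and>
     nijenhuis_zero A J \<and>
     two_form A (\<lambda>p x y. g p (J p x) y) \<and>
     closed_form A (\<lambda>p x y. g p (J p x) y)"

end

theory Submission
  imports Defs "HOL-Computational_Algebra.Fundamental_Theorem_Algebra"
begin

text \<open>Symmetry of \<open>g\<close> and skew-symmetry of \<open>\<kappa>\<close> make \<open>R\<close> skew with respect to \<open>g\<close>. Hence
  \<open>B = - R\<^sup>2\<close> is \<open>g\<close>-symmetric and positive definite, the polar decomposition is \<open>R = S J\<close> with
  \<open>S = B\<^sup>1\<^sup>/\<^sup>2\<close> and \<open>J = B\<^sup>-\<^sup>1\<^sup>/\<^sup>2 R\<close>, and \<open>J\<close> is a skew operator with \<open>J\<^sup>2 = - 1\<close> (locale \<open>skew_operator\<close>,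
  lemma \<open>polar_unique\<close>).

  The key point is that the spectrum of \<open>B\<close> is constant on the manifold. A Nijenhuis operator
  satisfies \<open>(k + 2) d tr R\<^sup>k\<^sup>+\<^sup>1 (R X) = (k + 1) d tr R\<^sup>k\<^sup>+\<^sup>2 (X)\<close> (lemma \<open>nijenhuis_trace_recursion\<close>). A
  skew operator is traceless, so by induction the traces of all powers of \<open>R\<close> are locally constant.
  At one point, \<open>B\<close> is annihilated by a polynomial \<open>f\<close> with simple positive roots. Then
  \<open>tr f(B)\<^sup>2\<close> is locally constant; as \<open>f(B)\<close> is symmetric, this trace is its squared norm. So the set
  where \<open>f(B) = 0\<close> is open and closed, and by connectedness it is everything (lemma
  \<open>constant_spectrum\<close>).

  Interpolating at the roots of \<open>f\<close>, one obtains \<open>J\<close> as a polynomial in \<open>R\<close> with constant real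
  coefficients. In particular \<open>J\<close> is smooth, and \<open>N\<^sub>J = 0\<close> because polynomials in a Nijenhuis operator
  are Nijenhuis operators (lemma \<open>nij_bracket_poly\<close>).

  The spectral projections \<open>P\<^sub>l\<close> of \<open>B\<close> are also constant-coefficient polynomials in \<open>R\<close>, hence
  Nijenhuis, and they are \<open>\<kappa>\<close>-symmetric. If \<open>d\<kappa> = 0\<close>, an identity relating \<open>d\<kappa>\<close>, \<open>d(\<kappa>(P\<cdot>,\<cdot>))\<close> and
  \<open>N\<^sub>P\<close> shows that each form \<open>\<kappa>(P\<^sub>l\<cdot>,\<cdot>)\<close> is closed (lemma \<open>form_ext_projection\<close>). Therefore
  \<open>g(J\<cdot>,\<cdot>) = \<kappa>(R J\<cdot>,\<cdot>) = - \<kappa>(S\<cdot>,\<cdot>)\<close>, the sum of the \<open>- l\<^sup>1\<^sup>/\<^sup>2 \<kappa>(P\<^sub>l\<cdot>,\<cdot>)\<close>, is closed as well.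

  The computations take place in a chart, where tensor fields are families of linear maps on an open
  set of a Euclidean space.\<close>

section \<open>Calculus of smooth maps\<close>

lemma has_derivative_frechet:
  "f differentiable (at x) \<Longrightarrow> (f has_derivative frechet_derivative f (at x)) (at x)"
  by (simp add: frechet_derivative_works)

lemma frechet_derivative_eqI:
  "(f has_derivative f') (at x) \<Longrightarrow> frechet_derivative f (at x) = f'"
  by (metis frechet_derivative_at)

lemma Ck_on_cong:
  assumes "open W" "\<And>x. x \<in> W \<Longrightarrow> f x = g x" "Ck_on k W f"
  shows "Ck_on k W g"
  using assms(2,3)
proof (induction k arbitrary: f g)
  case 0
  then show ?case by (auto cong: continuous_on_cong)
next
  case (Suc k)
  have diff: "f differentiable (at x)" if "x \<in> W" for x
    using Suc.prems(2) that by simp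
  have hd: "(g has_derivative frechet_derivative f (at x)) (at x)" if "x \<in> W" for x
    by (rule has_derivative_transform_within_open[OF has_derivative_frechet[OF diff[OF that]]
          assms(1) that]) (use Suc.prems(1) in auto)
  have eq: "frechet_derivative f (at x) = frechet_derivative g (at x)" if "x \<in> W" for x
    using frechet_derivative_eqI[OF hd[OF that]] by simp
  have "Ck_on k W (\<lambda>x. frechet_derivative g (at x) v)" for v
    by (rule Suc.IH[of "\<lambda>x. frechet_derivative f (at x) v"]) (use Suc.prems(2) eq in auto)
  then show ?case using hd by (auto simp: differentiable_def)
qed

lemma Ck_on_Suc_imp: "Ck_on (Suc k) W f \<Longrightarrow> Ck_on k W f"
proof (induction k arbitrary: f)
  case 0
  then show ?case
    by (simp add: differentiable_imp_continuous_within continuous_at_imp_continuous_on)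
next
  case (Suc k)
  then show ?case by (metis Ck_on.simps(2))
qed

lemma Ck_on_subset: "Ck_on k W f \<Longrightarrow> V \<subseteq> W \<Longrightarrow> Ck_on k V f"
  by (induction k arbitrary: f) (auto intro: continuous_on_subset)

text \<open>Smoothness is tested on the chosen derivative \<^const>\<open>frechet_derivative\<close>; on an open set an
  explicit formula for the derivative can take its place.\<close>

lemma Ck_on_SucI:
  assumes "open W" "\<And>x. x \<in> W \<Longrightarrow> (f has_derivative f' x) (at x)"
    and "\<And>v. Ck_on k W (\<lambda>x. f' x v)"
  shows "Ck_on (Suc k) W f"
proof -
  have "Ck_on k W (\<lambda>x. frechet_derivative f (at x) v)" for v
    by (rule Ck_on_cong[OF assms(1) _ assms(3)[of v]])
      (simp add: frechet_derivative_eqI[OF assms(2)])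
  then show ?thesis using assms(2) by (auto simp: differentiable_def)
qed

lemma Ck_on_const: "Ck_on k W (\<lambda>x. c)"
  by (induction k arbitrary: c) auto

lemma Ck_on_add:
  assumes "open W" "Ck_on k W f" "Ck_on k W g"
  shows "Ck_on k W (\<lambda>x. f x + g x)"
  using assms(2,3)
proof (induction k arbitrary: f g)
  case 0
  then show ?case by (simp add: continuous_on_add)
next
  case (Suc k)
  show ?case
    by (rule Ck_on_SucI[OF assms(1), where f' = "\<lambda>x v. frechet_derivative f (at x) v + frechet_derivative g (at x) v"])
      (use Suc in \<open>auto intro!: has_derivative_add has_derivative_frechet\<close>)
qed

lemma Ck_on_bounded_linear:
  assumes "open W" "bounded_linear L" "Ck_on k W f"
  shows "Ck_on k W (\<lambda>x. L (f x))"
  using assms(3)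
proof (induction k arbitrary: f)
  case 0
  then show ?case by (simp add: bounded_linear.continuous_on[OF assms(2)])
next
  case (Suc k)
  show ?case
    by (rule Ck_on_SucI[OF assms(1), where f' = "\<lambda>x v. L (frechet_derivative f (at x) v)"])
      (use Suc in \<open>auto intro!: bounded_linear.has_derivative[OF assms(2)] has_derivative_frechet\<close>)
qed

lemma Ck_on_bounded_bilinear:
  assumes "open W" "bounded_bilinear prd" "Ck_on k W f" "Ck_on k W g"
  shows "Ck_on k W (\<lambda>x. prd (f x) (g x))"
  using assms(3,4)
proof (induction k arbitrary: f g)
  case 0
  then show ?case by (simp add: bounded_bilinear.continuous_on[OF assms(2)])
next
  case (Suc k)
  have f: "Ck_on k W f" and g: "Ck_on k W g" using Suc.prems Ck_on_Suc_imp by blast+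
  show ?case
    by (rule Ck_on_SucI[OF assms(1), where f' = "\<lambda>x v. prd (f x) (frechet_derivative g (at x) v) +
           prd (frechet_derivative f (at x) v) (g x)"])
      (use Suc f g in \<open>auto intro!: bounded_bilinear.FDERIV[OF assms(2)] has_derivative_frechet Ck_on_add[OF assms(1)]\<close>)
qed

lemma Ck_on_sum:
  assumes "open W" "\<And>i. i \<in> I \<Longrightarrow> Ck_on k W (f i)"
  shows "Ck_on k W (\<lambda>x. \<Sum>i\<in>I. f i x)"
  using assms(2)
  by (induction I rule: infinite_finite_induct) (auto intro: Ck_on_const Ck_on_add[OF assms(1)])

lemma linear_Basis_expand:
  fixes L :: "'e::euclidean_space \<Rightarrow> 'f::real_vector"
  assumes "linear L"
  shows "L v = (\<Sum>b\<in>Basis. (v \<bullet> b) *\<^sub>R L b)"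
proof -
  have "L v = L (\<Sum>b\<in>Basis. (v \<bullet> b) *\<^sub>R b)" by (simp add: euclidean_representation)
  also have "\<dots> = (\<Sum>b\<in>Basis. (v \<bullet> b) *\<^sub>R L b)"
    by (simp add: linear_sum[OF assms] linear_cmul[OF assms])
  finally show ?thesis .
qed

text \<open>The chain rule expresses a directional derivative of \<open>f \<circ> h\<close> through the partial
  derivatives of \<open>f\<close>, which are one class less smooth; this drives the induction.\<close>

lemma Ck_on_compose:
  fixes h :: "'e::euclidean_space \<Rightarrow> 'd::euclidean_space"
  assumes "open W" "open V" "h ` W \<subseteq> V" "Ck_on k V f" "Ck_on k W h"
  shows "Ck_on k W (\<lambda>x. f (h x))"
  using assms(4,5)
proof (induction k arbitrary: f)
  case 0
  then show ?case using assms(3) continuous_on_compose2[of V f W h] by simp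
next
  case (Suc k)
  have hW: "h x \<in> V" if "x \<in> W" for x using assms(3) that by auto
  have h: "Ck_on k W h" using Suc.prems Ck_on_Suc_imp by blast
  show ?case
  proof (rule Ck_on_SucI[OF assms(1), where f' = "\<lambda>x v. \<Sum>b\<in>Basis.
        (frechet_derivative h (at x) v \<bullet> b) *\<^sub>R frechet_derivative f (at (h x)) b"])
    fix x assume x: "x \<in> W"
    have "f differentiable (at (h x))" using Suc.prems hW[OF x] by simp
    then have lin: "linear (frechet_derivative f (at (h x)))" by (rule linear_frechet_derivative)
    have "((\<lambda>x. f (h x)) has_derivative (\<lambda>v. frechet_derivative f (at (h x)) (frechet_derivative h (at x) v))) (at x)"
    proof (rule has_derivative_compose[where f = h and g = f])
      show "(h has_derivative frechet_derivative h (at x)) (at x)"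
        using Suc.prems x by (intro has_derivative_frechet) auto
      show "(f has_derivative frechet_derivative f (at (h x))) (at (h x))"
        by (rule has_derivative_frechet) fact
    qed
    then show "((\<lambda>x. f (h x)) has_derivative (\<lambda>v. \<Sum>b\<in>Basis.
        (frechet_derivative h (at x) v \<bullet> b) *\<^sub>R frechet_derivative f (at (h x)) b)) (at x)"
      by (subst (asm) linear_Basis_expand[OF lin])
  next
    fix v
    show "Ck_on k W (\<lambda>x. \<Sum>b\<in>Basis.
        (frechet_derivative h (at x) v \<bullet> b) *\<^sub>R frechet_derivative f (at (h x)) b)"
    proof (rule Ck_on_sum[OF assms(1)])
      fix b :: 'd
      have "Ck_on k W (\<lambda>x. frechet_derivative h (at x) v \<bullet> b)"
        by (rule Ck_on_bounded_linear[OF assms(1) bounded_linear_inner_left]) (use Suc.prems in simp)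
      moreover have "Ck_on k W (\<lambda>x. frechet_derivative f (at (h x)) b)"
        by (rule Suc.IH[OF _ h]) (use Suc.prems in simp)
      ultimately show "Ck_on k W (\<lambda>x. (frechet_derivative h (at x) v \<bullet> b) *\<^sub>R frechet_derivative f (at (h x)) b)"
        by (rule Ck_on_bounded_bilinear[OF assms(1) bounded_bilinear_scaleR])
    qed
  qed
qed

lemma smooth_on_cong: "open W \<Longrightarrow> (\<And>x. x \<in> W \<Longrightarrow> f x = g x) \<Longrightarrow> smooth_on W f \<Longrightarrow> smooth_on W g"
  unfolding smooth_on_def by (blast intro: Ck_on_cong)

lemma smooth_on_subset: "smooth_on W f \<Longrightarrow> V \<subseteq> W \<Longrightarrow> smooth_on V f"
  unfolding smooth_on_def by (blast intro: Ck_on_subset)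

lemma smooth_on_const: "smooth_on W (\<lambda>x. c)"
  unfolding smooth_on_def by (blast intro: Ck_on_const)

lemma smooth_on_add:
  "open W \<Longrightarrow> smooth_on W f \<Longrightarrow> smooth_on W g \<Longrightarrow> smooth_on W (\<lambda>x. f x + g x)"
  unfolding smooth_on_def by (blast intro: Ck_on_add)

lemma smooth_on_bounded_linear:
  "open W \<Longrightarrow> bounded_linear L \<Longrightarrow> smooth_on W f \<Longrightarrow> smooth_on W (\<lambda>x. L (f x))"
  unfolding smooth_on_def by (blast intro: Ck_on_bounded_linear)

lemma smooth_on_scaleR:
  "open W \<Longrightarrow> smooth_on W f \<Longrightarrow> smooth_on W g \<Longrightarrow> smooth_on W (\<lambda>x. f x *\<^sub>R g x)"
  unfolding smooth_on_def by (blast intro: Ck_on_bounded_bilinear bounded_bilinear_scaleR)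

lemma smooth_on_sum:
  "open W \<Longrightarrow> (\<And>i. i \<in> I \<Longrightarrow> smooth_on W (f i)) \<Longrightarrow> smooth_on W (\<lambda>x. \<Sum>i\<in>I. f i x)"
  unfolding smooth_on_def by (blast intro: Ck_on_sum)

lemma smooth_on_compose:
  "open W \<Longrightarrow> open V \<Longrightarrow> h ` W \<subseteq> V \<Longrightarrow> smooth_on V f \<Longrightarrow> smooth_on W h \<Longrightarrow> smooth_on W (\<lambda>x. f (h x))"
  unfolding smooth_on_def by (blast intro: Ck_on_compose)

lemma smooth_on_SucD: "smooth_on W f \<Longrightarrow> Ck_on (Suc k) W f"
  unfolding smooth_on_def by blast

lemma smooth_on_frechet: "smooth_on W f \<Longrightarrow> smooth_on W (\<lambda>x. frechet_derivative f (at x) v)"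
  using smooth_on_SucD[of W f] by (simp add: smooth_on_def[of W "\<lambda>x. frechet_derivative f (at x) v"])

lemma smooth_on_differentiable: "smooth_on W f \<Longrightarrow> x \<in> W \<Longrightarrow> f differentiable (at x)"
  using smooth_on_SucD[of W f 0] by simp

lemma smooth_on_has_derivative:
  "smooth_on W f \<Longrightarrow> x \<in> W \<Longrightarrow> (f has_derivative frechet_derivative f (at x)) (at x)"
  by (simp add: has_derivative_frechet smooth_on_differentiable)

lemma smooth_on_continuous: "smooth_on W f \<Longrightarrow> continuous_on W f"
  unfolding smooth_on_def by (metis Ck_on.simps(1))

text \<open>Symmetry of second derivatives: the second difference of \<open>f\<close> over a small parallelogram is, by
  two applications of the mean value theorem, a value of either iterated derivative nearby.\<close>

lemma second_difference:
  fixes f :: "'e::euclidean_space \<Rightarrow> real"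
  assumes "smooth_on W f" "0 < h"
    and sub: "\<And>s t. 0 \<le> s \<Longrightarrow> s \<le> h \<Longrightarrow> 0 \<le> t \<Longrightarrow> t \<le> h \<Longrightarrow> x + s *\<^sub>R u + t *\<^sub>R v \<in> W"
  shows "\<exists>s t. 0 < s \<and> s < h \<and> 0 < t \<and> t < h \<and>
    f (x + h *\<^sub>R u + h *\<^sub>R v) - f (x + h *\<^sub>R u) - f (x + h *\<^sub>R v) + f x =
      h * h * frechet_derivative (\<lambda>y. frechet_derivative f (at y) u) (at (x + s *\<^sub>R u + t *\<^sub>R v)) v"
proof -
  let ?Du = "\<lambda>y. frechet_derivative f (at y) u"
  have lin: "linear (frechet_derivative k (at y))" if "smooth_on W k" "y \<in> W" for k :: "'e \<Rightarrow> real" and y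
    using that smooth_on_differentiable linear_frechet_derivative by blast
  have d1: "((\<lambda>s. f (x + s *\<^sub>R u + t *\<^sub>R v)) has_real_derivative ?Du (x + s *\<^sub>R u + t *\<^sub>R v)) (at s)"
    if "0 \<le> s" "s \<le> h" "0 \<le> t" "t \<le> h" for s t
  proof -
    have "((\<lambda>s. f (x + s *\<^sub>R u + t *\<^sub>R v)) has_derivative
        (\<lambda>r. frechet_derivative f (at (x + s *\<^sub>R u + t *\<^sub>R v)) (r *\<^sub>R u))) (at s)"
      by (rule has_derivative_compose[where f = "\<lambda>s. x + s *\<^sub>R u + t *\<^sub>R v" and g = f])
        (auto intro!: derivative_eq_intros smooth_on_has_derivative[OF assms(1)] sub that)
    moreover have "(\<lambda>r. frechet_derivative f (at (x + s *\<^sub>R u + t *\<^sub>R v)) (r *\<^sub>R u)) =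
        (*) (?Du (x + s *\<^sub>R u + t *\<^sub>R v))"
      by (rule ext) (simp add: linear_cmul[OF lin[OF assms(1) sub[OF that]]])
    ultimately show ?thesis unfolding has_field_derivative_def by simp
  qed
  have d2: "((\<lambda>t. ?Du (x + s *\<^sub>R u + t *\<^sub>R v)) has_real_derivative
      frechet_derivative ?Du (at (x + s *\<^sub>R u + t *\<^sub>R v)) v) (at t)"
    if "0 \<le> s" "s \<le> h" "0 \<le> t" "t \<le> h" for s t
  proof -
    have "((\<lambda>t. ?Du (x + s *\<^sub>R u + t *\<^sub>R v)) has_derivative
        (\<lambda>r. frechet_derivative ?Du (at (x + s *\<^sub>R u + t *\<^sub>R v)) (r *\<^sub>R v))) (at t)"
      by (rule has_derivative_compose[where f = "\<lambda>t. x + s *\<^sub>R u + t *\<^sub>R v" and g = ?Du])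
        (auto intro!: derivative_eq_intros smooth_on_has_derivative[OF smooth_on_frechet[OF assms(1)]] sub that)
    moreover have "(\<lambda>r. frechet_derivative ?Du (at (x + s *\<^sub>R u + t *\<^sub>R v)) (r *\<^sub>R v)) =
        (*) (frechet_derivative ?Du (at (x + s *\<^sub>R u + t *\<^sub>R v)) v)"
      by (rule ext) (simp add: linear_cmul[OF lin[OF smooth_on_frechet[OF assms(1)] sub[OF that]]])
    ultimately show ?thesis unfolding has_field_derivative_def by simp
  qed
  let ?F = "\<lambda>s. f (x + s *\<^sub>R u + h *\<^sub>R v) - f (x + s *\<^sub>R u + 0 *\<^sub>R v)"
  have "\<exists>s>0. s < h \<and> ?F h - ?F 0 = (h - 0) * (?Du (x + s *\<^sub>R u + h *\<^sub>R v) - ?Du (x + s *\<^sub>R u + 0 *\<^sub>R v))"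
    by (rule MVT2) (use assms(2) in \<open>auto intro!: DERIV_diff d1 simp del: scale_zero_left\<close>)
  then obtain s where s: "0 < s" "s < h"
    and e1: "?F h - ?F 0 = h * (?Du (x + s *\<^sub>R u + h *\<^sub>R v) - ?Du (x + s *\<^sub>R u + 0 *\<^sub>R v))" by auto
  have "\<exists>t>0. t < h \<and> ?Du (x + s *\<^sub>R u + h *\<^sub>R v) - ?Du (x + s *\<^sub>R u + 0 *\<^sub>R v) =
      (h - 0) * frechet_derivative ?Du (at (x + s *\<^sub>R u + t *\<^sub>R v)) v"
    by (rule MVT2) (use assms(2) s in \<open>auto intro!: d2 simp del: scale_zero_left\<close>)
  then obtain t where t: "0 < t" "t < h"
    and e2: "?Du (x + s *\<^sub>R u + h *\<^sub>R v) - ?Du (x + s *\<^sub>R u + 0 *\<^sub>R v) =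
      h * frechet_derivative ?Du (at (x + s *\<^sub>R u + t *\<^sub>R v)) v" by auto
  have "?F h - ?F 0 = f (x + h *\<^sub>R u + h *\<^sub>R v) - f (x + h *\<^sub>R u) - f (x + h *\<^sub>R v) + f x" by simp
  with s t e1 e2 show ?thesis by (metis mult.assoc)
qed

lemma second_derivative_symmetric_real:
  fixes f :: "'e::euclidean_space \<Rightarrow> real"
  assumes "open W" "smooth_on W f" "x \<in> W"
  shows "frechet_derivative (\<lambda>y. frechet_derivative f (at y) u) (at x) v =
    frechet_derivative (\<lambda>y. frechet_derivative f (at y) v) (at x) u"
proof (rule ccontr)
  let ?P = "\<lambda>y. frechet_derivative (\<lambda>y. frechet_derivative f (at y) u) (at y) v"
  let ?Q = "\<lambda>y. frechet_derivative (\<lambda>y. frechet_derivative f (at y) v) (at y) u"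
  assume ne: "?P x \<noteq> ?Q x"
  define e where "e = \<bar>?P x - ?Q x\<bar> / 2"
  have e: "e > 0" using ne by (simp add: e_def)
  have cP: "continuous_on W ?P" and cQ: "continuous_on W ?Q"
    by (intro smooth_on_continuous smooth_on_frechet assms)+
  obtain dP where dP: "dP > 0" "\<And>y. y \<in> W \<Longrightarrow> dist y x < dP \<Longrightarrow> dist (?P y) (?P x) < e"
    using cP e assms(3) unfolding continuous_on_iff by meson
  obtain dQ where dQ: "dQ > 0" "\<And>y. y \<in> W \<Longrightarrow> dist y x < dQ \<Longrightarrow> dist (?Q y) (?Q x) < e"
    using cQ e assms(3) unfolding continuous_on_iff by meson
  obtain dW where dW: "dW > 0" "ball x dW \<subseteq> W"
    using assms(1,3) open_contains_ball by blast
  define d where "d = min dP (min dQ dW)"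
  have d: "d > 0" using dP dQ dW by (simp add: d_def)
  define h where "h = d / (norm u + norm v + 1)"
  have n1: "norm u + norm v + 1 > 0" by (simp add: add_nonneg_pos)
  have h: "h > 0" using d n1 by (simp add: h_def)
  have close: "dist (x + s *\<^sub>R a + t *\<^sub>R b) x < d"
    if "0 \<le> s" "s \<le> h" "0 \<le> t" "t \<le> h" "norm a + norm b = norm u + norm v" for s t and a b :: 'e
  proof -
    have "dist (x + s *\<^sub>R a + t *\<^sub>R b) x \<le> s * norm a + t * norm b"
      using norm_triangle_ineq[of "s *\<^sub>R a" "t *\<^sub>R b"] that
      by (simp add: dist_norm algebra_simps)
    also have "\<dots> \<le> h * norm a + h * norm b"
      using that by (intro add_mono mult_right_mono) auto
    also have "\<dots> < h * (norm u + norm v + 1)"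
      using h that(5) by (simp add: distrib_left[symmetric])
    also have "\<dots> = d" using n1 by (simp add: h_def)
    finally show ?thesis .
  qed
  have inW: "y \<in> W" if "dist y x < d" for y
    using dW(2) that by (auto simp: d_def dist_commute)
  obtain s t where st: "0 < s" "s < h" "0 < t" "t < h"
    and eP: "f (x + h *\<^sub>R u + h *\<^sub>R v) - f (x + h *\<^sub>R u) - f (x + h *\<^sub>R v) + f x
      = h * h * ?P (x + s *\<^sub>R u + t *\<^sub>R v)"
    using second_difference[OF assms(2) h, of x u v] close[of _ _ u v] inW by blast
  obtain s' t' where st': "0 < s'" "s' < h" "0 < t'" "t' < h"
    and eQ: "f (x + h *\<^sub>R v + h *\<^sub>R u) - f (x + h *\<^sub>R v) - f (x + h *\<^sub>R u) + f x
      = h * h * ?Q (x + s' *\<^sub>R v + t' *\<^sub>R u)"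
    using second_difference[OF assms(2) h, of x v u] close[of _ _ v u] inW by (auto simp: add.commute)
  have "f (x + h *\<^sub>R v + h *\<^sub>R u) = f (x + h *\<^sub>R u + h *\<^sub>R v)" by (simp add: add_ac)
  then have "h * h * ?P (x + s *\<^sub>R u + t *\<^sub>R v) = h * h * ?Q (x + s' *\<^sub>R v + t' *\<^sub>R u)"
    using eP eQ by linarith
  then have eq: "?P (x + s *\<^sub>R u + t *\<^sub>R v) = ?Q (x + s' *\<^sub>R v + t' *\<^sub>R u)" using h by simp
  have c1: "dist (x + s *\<^sub>R u + t *\<^sub>R v) x < d" using close[of s t u v] st by simp
  have c2: "dist (x + s' *\<^sub>R v + t' *\<^sub>R u) x < d" using close[of s' t' v u] st' by simp
  have "dist (?P (x + s *\<^sub>R u + t *\<^sub>R v)) (?P x) < e" using dP(2) inW[OF c1] c1 by (simp add: d_def)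
  moreover have "dist (?Q (x + s' *\<^sub>R v + t' *\<^sub>R u)) (?Q x) < e" using dQ(2) inW[OF c2] c2 by (simp add: d_def)
  ultimately have "\<bar>?P x - ?Q x\<bar> < 2 * e" using eq by (simp add: dist_real_def)
  then show False by (simp add: e_def)
qed

lemma frechet_derivative_inner:
  assumes "f differentiable (at x)"
  shows "frechet_derivative (\<lambda>y. f y \<bullet> c) (at x) v = frechet_derivative f (at x) v \<bullet> c"
  using frechet_derivative_eqI[OF has_derivative_inner_left[OF has_derivative_frechet[OF assms]]]
  by metis

lemma second_derivative_symmetric:
  fixes f :: "'e::euclidean_space \<Rightarrow> 'f::euclidean_space"
  assumes "open W" "smooth_on W f" "x \<in> W"
  shows "frechet_derivative (\<lambda>y. frechet_derivative f (at y) u) (at x) v =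
    frechet_derivative (\<lambda>y. frechet_derivative f (at y) v) (at x) u"
proof (rule euclidean_eqI)
  fix b :: 'f
  have comp: "frechet_derivative (\<lambda>y. frechet_derivative f (at y) u) (at x) v \<bullet> b =
     frechet_derivative (\<lambda>y. frechet_derivative (\<lambda>z. f z \<bullet> b) (at y) u) (at x) v" for u v
  proof -
    have d: "(\<lambda>y. frechet_derivative f (at y) u) differentiable (at x)"
      using smooth_on_frechet[OF assms(2)] smooth_on_differentiable assms(3) by blast
    have "frechet_derivative (\<lambda>y. frechet_derivative f (at y) u \<bullet> b) (at x) =
      frechet_derivative (\<lambda>y. frechet_derivative (\<lambda>z. f z \<bullet> b) (at y) u) (at x)"
      by (rule frechet_derivative_transform_within_open[OF _ assms(1,3)])
        (use d assms in \<open>auto simp: frechet_derivative_inner smooth_on_differentiable\<close>)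
    then show ?thesis using frechet_derivative_inner[OF d] by metis
  qed
  have "smooth_on W (\<lambda>z. f z \<bullet> b)"
    by (rule smooth_on_bounded_linear[OF assms(1) bounded_linear_inner_left assms(2)])
  then show "frechet_derivative (\<lambda>y. frechet_derivative f (at y) u) (at x) v \<bullet> b =
    frechet_derivative (\<lambda>y. frechet_derivative f (at y) v) (at x) u \<bullet> b"
    unfolding comp using second_derivative_symmetric_real assms by blast
qed

section \<open>Polynomials of a linear operator\<close>

definition op_poly :: "real poly \<Rightarrow> ('v::real_vector \<Rightarrow> 'v) \<Rightarrow> 'v \<Rightarrow> 'v" where
  "op_poly p L x = fold_coeffs (\<lambda>a y. a *\<^sub>R x + L y) p 0"

lemma op_poly_0 [simp]: "op_poly 0 L x = 0"
  by (simp add: op_poly_def)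

lemma op_poly_pCons [simp]:
  assumes "linear L"
  shows "op_poly (pCons a p) L x = a *\<^sub>R x + L (op_poly p L x)"
  by (cases "a = 0 \<and> p = 0") (auto simp: op_poly_def linear_0[OF assms])

lemma op_poly_1 [simp]: "linear L \<Longrightarrow> op_poly 1 L x = x"
  by (simp add: one_pCons linear_0)

lemma linear_op_poly:
  assumes "linear L" shows "linear (op_poly p L)"
proof (induction p)
  case 0
  have "op_poly 0 L = (\<lambda>x. 0)" by (rule ext) simp
  then show ?case by (simp add: module_hom_zero)
next
  case (pCons a p)
  have "op_poly (pCons a p) L = (\<lambda>x. a *\<^sub>R x + (L \<circ> op_poly p L) x)"
    by (rule ext) (simp add: assms)
  then show ?case
    using linear_compose_add[OF linear_compose_scale_right[OF linear_ident] linear_compose[OF pCons(2) assms]]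
    by simp
qed

lemma op_poly_add:
  assumes "linear L" shows "op_poly (p + q) L x = op_poly p L x + op_poly q L x"
  by (induction p q rule: poly_induct2) (auto simp: assms linear_add[OF assms] scaleR_add_left)

lemma op_poly_smult:
  assumes "linear L" shows "op_poly (smult c p) L x = c *\<^sub>R op_poly p L x"
  by (induction p) (auto simp: assms linear_cmul[OF assms] scaleR_add_right)

lemma op_poly_diff:
  assumes "linear L" shows "op_poly (p - q) L x = op_poly p L x - op_poly q L x"
  using op_poly_add[OF assms, of "p - q" q x] by simp

lemma op_poly_sum:
  assumes "linear L" shows "op_poly (\<Sum>i\<in>I. p i) L x = (\<Sum>i\<in>I. op_poly (p i) L x)"
  by (induction I rule: infinite_finite_induct) (auto simp: op_poly_add[OF assms])

lemma op_poly_mult: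
  assumes "linear L" shows "op_poly (p * q) L x = op_poly p L (op_poly q L x)"
  by (induction p) (auto simp: assms op_poly_add op_poly_smult)

lemma op_poly_pcompose:
  assumes "linear L" shows "op_poly (pcompose p q) L x = op_poly p (op_poly q L) x"
  by (induction p)
    (auto simp: pcompose_pCons assms op_poly_add op_poly_mult linear_op_poly linear_0)

lemma op_poly_intertwine:
  assumes "linear L" "linear M" "linear C" "\<And>x. C (L x) = M (C x)"
  shows "C (op_poly p L x) = op_poly p M (C x)"
  by (induction p) (auto simp: assms linear_0[OF assms(3)] linear_add[OF assms(3)] linear_cmul[OF assms(3)])

lemma op_poly_commute: "linear L \<Longrightarrow> op_poly p L (op_poly q L x) = op_poly q L (op_poly p L x)"
  by (simp add: op_poly_mult[symmetric] mult.commute)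

lemma op_poly_self_commute: "linear L \<Longrightarrow> op_poly p L (L x) = L (op_poly p L x)"
  by (rule op_poly_intertwine[symmetric]) auto

lemma op_poly_form_symmetric:
  assumes "linear L" "bilinear h" "\<And>x y. h (L x) y = h x (L y)"
  shows "h (op_poly p L x) y = h x (op_poly p L y)"
proof (induction p arbitrary: y)
  case 0
  then show ?case by (simp add: bilinear_lzero[OF assms(2)] bilinear_rzero[OF assms(2)])
next
  case (pCons a p)
  then show ?case
    by (simp add: assms(1,3) bilinear_ladd[OF assms(2)] bilinear_radd[OF assms(2)]
        bilinear_lmul[OF assms(2)] bilinear_rmul[OF assms(2)] op_poly_self_commute)
qed

text \<open>The \<open>DIM + 1\<close> vectors \<open>b, L b, L\<^sup>2 b, \<dots>\<close> are linearly dependent; a repetition among them is the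
  degenerate case, since dependence is a property of sets.\<close>

lemma annihilating_poly_vector:
  fixes L :: "'e::euclidean_space \<Rightarrow> 'e"
  assumes "linear L"
  shows "\<exists>p. p \<noteq> 0 \<and> op_poly p L b = 0"
proof -
  have mon: "op_poly (monom c i) L b = c *\<^sub>R (L ^^ i) b" for c i
    by (induction i) (auto simp: monom_0 monom_Suc assms linear_0[OF assms] linear_cmul[OF assms])
  let ?v = "\<lambda>i. (L ^^ i) b"
  show ?thesis
  proof (cases "inj_on ?v {..DIM('e)}")
    case False
    then obtain i j where ij: "i \<noteq> j" "?v i = ?v j" by (auto simp: inj_on_def)
    have "poly.coeff (monom 1 i - monom 1 j :: real poly) i = 1" using ij(1) by simp
    then have "monom 1 i - monom 1 j \<noteq> (0 :: real poly)" by (metis coeff_0 zero_neq_one)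
    moreover have "op_poly (monom 1 i - monom 1 j) L b = 0"
      by (simp add: op_poly_diff assms mon ij(2))
    ultimately show ?thesis by blast
  next
    case True
    have "dependent (?v ` {..DIM('e)})"
      by (rule dependent_biggerset) (simp add: card_image[OF True])
    then obtain u w where u: "(\<Sum>v\<in>?v ` {..DIM('e)}. u v *\<^sub>R v) = 0"
      and w: "w \<in> ?v ` {..DIM('e)}" "u w \<noteq> 0"
      using dependent_finite[of "?v ` {..DIM('e)}"] by auto
    define p where "p = (\<Sum>i\<le>DIM('e). monom (u (?v i)) i)"
    have "op_poly p L b = (\<Sum>i\<le>DIM('e). u (?v i) *\<^sub>R ?v i)"
      by (simp add: p_def op_poly_sum assms mon)
    also have "\<dots> = 0" using u by (simp add: sum.reindex[OF True])
    finally have z: "op_poly p L b = 0" .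
    obtain k where k: "k \<le> DIM('e)" "w = ?v k" using w by auto
    have "poly.coeff p k = u w"
      using k by (simp add: p_def coeff_sum sum.delta if_distrib cong: if_cong)
    then have "p \<noteq> 0" using w by auto
    then show ?thesis using z by blast
  qed
qed

lemma annihilating_poly:
  fixes L :: "'e::euclidean_space \<Rightarrow> 'e"
  assumes "linear L"
  shows "\<exists>p. p \<noteq> 0 \<and> (\<forall>x. op_poly p L x = 0)"
proof -
  obtain q where q: "\<And>b. q b \<noteq> 0" "\<And>b. op_poly (q b) L b = 0"
    using annihilating_poly_vector[OF assms] by metis
  define p where "p = (\<Prod>b\<in>Basis. q b)"
  have "p \<noteq> 0" using q by (simp add: p_def)
  have "op_poly p L b = 0" if b: "b \<in> Basis" for b
  proof -
    have "p = (\<Prod>b\<in>Basis - {b}. q b) * q b"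
      using b by (simp add: p_def prod.remove mult.commute)
    then show ?thesis using q(2)[of b] by (simp add: op_poly_mult assms linear_0 linear_op_poly)
  qed
  then have "op_poly p L x = 0" for x
    by (subst linear_Basis_expand[OF linear_op_poly[OF assms]]) simp
  with \<open>p \<noteq> 0\<close> show ?thesis by blast
qed

section \<open>Spectral calculus for symmetric operators\<close>

locale inner_form =
  fixes h :: "'v::real_vector \<Rightarrow> 'v \<Rightarrow> real"
  assumes bil: "bilinear h"
    and sym: "h x y = h y x"
    and pos: "x \<noteq> 0 \<Longrightarrow> h x x > 0"
begin

lemmas form_simps = bilinear_ladd[OF bil] bilinear_radd[OF bil] bilinear_lmul[OF bil]
  bilinear_rmul[OF bil] bilinear_lneg[OF bil] bilinear_rneg[OF bil] bilinear_lzero[OF bil]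
  bilinear_rzero[OF bil] bilinear_lsub[OF bil] bilinear_rsub[OF bil]

lemma nonneg: "h x x \<ge> 0"
  using pos[of x] by (cases "x = 0") (auto simp: form_simps)

lemma zeroI: "h x x \<le> 0 \<Longrightarrow> x = 0"
  using pos[of x] by fastforce

lemma eqI: "(\<And>z. h x z = h y z) \<Longrightarrow> x = y"
proof -
  assume "\<And>z. h x z = h y z"
  then have "h (x - y) (x - y) = 0" by (simp add: form_simps)
  then show "x = y" using zeroI[of "x - y"] by simp
qed

end

definition roots_poly :: "real set \<Rightarrow> real poly" where
  "roots_poly \<Lambda> = (\<Prod>l\<in>\<Lambda>. [:- l, 1:])"

text \<open>The remainder of \<open>p\<close> modulo the quadratic has degree at most one and vanishes at the non-real
  number \<open>z\<close>.\<close>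

lemma quadratic_factor_of_complex_root:
  fixes p :: "real poly"
  assumes "poly (map_poly of_real p) z = (0::complex)" "Im z \<noteq> 0"
  shows "[:(Re z)\<^sup>2 + (Im z)\<^sup>2, - 2 * Re z, 1:] dvd p"
proof -
  let ?q = "[:(Re z)\<^sup>2 + (Im z)\<^sup>2, - 2 * Re z, 1:]"
  let ?c = "\<lambda>p. poly (map_poly of_real p) z :: complex"
  have hom: "?c (p * q + r) = ?c p * ?c q + ?c r" for p q r :: "real poly"
  proof -
    have "map_poly complex_of_real (p * q + r) = map_poly of_real p * map_poly of_real q + map_poly of_real r"
      by (intro poly_eqI) (simp add: coeff_map_poly coeff_mult)
    then show ?thesis by simp
  qed
  have q0: "?c ?q = 0"
    by (simp add: map_poly_pCons complex_eq_iff power2_eq_square algebra_simps)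
  define r where "r = p mod ?q"
  have "?c p = ?c ((p div ?q) * ?q + r)" by (simp only: r_def div_mult_mod_eq)
  also have "\<dots> = ?c r" by (simp only: hom q0) simp
  finally have r0: "?c r = 0" using assms(1) by simp
  have "degree r < 2"
    using degree_mod_less'[of ?q p] by (cases "r = 0") (auto simp: r_def)
  then have "r = [:poly.coeff r 0, poly.coeff r 1:]"
    by (intro poly_eqI) (auto simp: coeff_pCons coeff_eq_0 split: nat.splits)
  then obtain a b where ab: "r = [:a, b:]" by blast
  have "Im (?c r) = b * Im z" "Re (?c r) = a + b * Re z"
    by (simp_all add: ab map_poly_pCons)
  then have "b = 0" "a = 0" using r0 assms(2) by auto
  then have "r = 0" using ab by simp
  then show ?thesis unfolding r_def by (simp add: mod_eq_0_iff_dvd)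
qed

text \<open>The spectral theorem in polynomial form. A complex root of an annihilating polynomial that is
  not a positive real can be dropped, since the corresponding real factor, quadratic if the root is not
  real, is an injective operator; a double root can be replaced by a simple one, since \<open>(B - l)\<^sup>2 x = 0\<close> gives
  \<open>h ((B - l) x) ((B - l) x) = 0\<close>.\<close>

lemma (in inner_form) spectral_aux:
  assumes lin: "linear B" and symB: "\<And>x y. h (B x) y = h x (B y)"
    and posB: "\<And>x. x \<noteq> 0 \<Longrightarrow> h (B x) x > 0"
  shows "p \<noteq> 0 \<Longrightarrow> \<exists>\<Lambda>. finite \<Lambda> \<and> \<Lambda> \<subseteq> {0<..} \<and>
    (\<forall>x. op_poly p B x = 0 \<longrightarrow> op_poly (roots_poly \<Lambda>) B x = 0)"
proof (induction "degree p" arbitrary: p rule: less_induct)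
  case less
  show ?case
  proof (cases "degree p = 0")
    case True
    then obtain a where "p = [:a:]" "a \<noteq> 0" using less.prems by (metis degree_eq_zeroE pCons_0_0)
    then show ?thesis by (intro exI[of _ "{}"]) (auto simp: lin linear_0[OF lin] linear_0[OF linear_op_poly[OF lin]])
  next
    case False
    have "\<not> constant (poly (map_poly complex_of_real p))"
      using False by (simp add: constant_degree degree_map_poly)
    then obtain z :: complex where z: "poly (map_poly of_real p) z = 0"
      using fundamental_theorem_of_algebra by blast
    show ?thesis
    proof (cases "Im z = 0")
      case nonreal: False
      let ?q = "[:(Re z)\<^sup>2 + (Im z)\<^sup>2, - 2 * Re z, 1:]"
      obtain m where m: "p = ?q * m"
        using quadratic_factor_of_complex_root[OF z nonreal] by (elim dvdE)
      have "m \<noteq> 0" "degree m < degree p" using less.prems unfolding m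
        by (auto simp: degree_mult_eq simp del: mult_pCons_left)
      then obtain \<Lambda> where L: "finite \<Lambda>" "\<Lambda> \<subseteq> {0<..}"
        "\<And>x. op_poly m B x = 0 \<Longrightarrow> op_poly (roots_poly \<Lambda>) B x = 0"
        using less.hyps by metis
      have "op_poly (roots_poly \<Lambda>) B x = 0" if "op_poly p B x = 0" for x
      proof -
        have "op_poly m B (op_poly ?q B x) = 0"
          using that by (simp add: m op_poly_mult[OF lin, symmetric] mult.commute del: mult_pCons_left mult_pCons_right)
        then have "op_poly (roots_poly \<Lambda>) B (op_poly ?q B x) = 0" by (rule L)
        then have qu: "op_poly ?q B (op_poly (roots_poly \<Lambda>) B x) = 0"
          by (simp only: op_poly_commute[OF lin])
        define u where "u = op_poly (roots_poly \<Lambda>) B x"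
        \<comment> \<open>The quadratic is \<open>(t - Re z)\<^sup>2 + (Im z)\<^sup>2\<close>, hence positive definite at \<open>B\<close>.\<close>
        define w where "w = B u - Re z *\<^sub>R u"
        have "0 = h (op_poly ?q B u) u" using qu by (simp add: u_def form_simps)
        also have "op_poly ?q B u = B (B u) - (2 * Re z) *\<^sub>R B u + ((Re z)\<^sup>2 + (Im z)\<^sup>2) *\<^sub>R u"
          by (simp add: lin linear_0[OF lin] linear_add[OF lin] linear_cmul[OF lin] linear_neg[OF lin] linear_diff[OF lin])
        also have "h \<dots> u = h w w + (Im z)\<^sup>2 * h u u"
          by (simp add: w_def form_simps symB[of "B u" u] sym[of u "B u"] power2_eq_square algebra_simps)
        finally have "(Im z)\<^sup>2 * h u u \<le> 0" using nonneg[of w] by linarith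
        then have "h u u \<le> 0" using nonreal by (simp add: mult_le_0_iff)
        then show ?thesis using zeroI unfolding u_def by blast
      qed
      then show ?thesis using L by blast
    next
      case True
      define l where "l = Re z"
      have zl: "z = of_real l" using True by (simp add: l_def complex_eq_iff)
      have "poly p l = 0"
      proof -
        have "complex_of_real (poly p l) = poly (map_poly of_real p) (of_real l)"
          by (induction p) (auto simp: map_poly_pCons)
        then show ?thesis using z zl by simp
      qed
      then obtain m where m: "p = [:- l, 1:] * m" by (metis poly_eq_0_iff_dvd dvdE)
      have "m \<noteq> 0" "degree m < degree p" using less.prems unfolding m
        by (auto simp: degree_mult_eq simp del: mult_pCons_left)
      then obtain \<Lambda> where L: "finite \<Lambda>" "\<Lambda> \<subseteq> {0<..}"
        "\<And>x. op_poly m B x = 0 \<Longrightarrow> op_poly (roots_poly \<Lambda>) B x = 0"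
        using less.hyps by metis
      have key: "op_poly [:- l, 1:] B (op_poly (roots_poly \<Lambda>) B x) = 0" if "op_poly p B x = 0" for x
      proof -
        have "op_poly m B (op_poly [:- l, 1:] B x) = 0"
          using that by (simp only: m op_poly_mult[OF lin, symmetric] mult.commute)
        then have "op_poly (roots_poly \<Lambda>) B (op_poly [:- l, 1:] B x) = 0" by (rule L)
        then show ?thesis by (simp only: op_poly_commute[OF lin])
      qed
      consider "l \<le> 0" | "l > 0" "l \<notin> \<Lambda>" | "l \<in> \<Lambda>" by linarith
      then show ?thesis
      proof cases
        case 1
        have "op_poly (roots_poly \<Lambda>) B x = 0" if "op_poly p B x = 0" for x
        proof (rule ccontr)
          define u where "u = op_poly (roots_poly \<Lambda>) B x"
          assume "op_poly (roots_poly \<Lambda>) B x \<noteq> 0"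
          then have u: "h (B u) u > 0" "h u u > 0" using posB pos by (auto simp: u_def)
          have "B u = l *\<^sub>R u" using key[OF that] by (simp add: u_def[symmetric] lin linear_0[OF lin])
          then have "h (B u) u = l * h u u" by (simp add: form_simps)
          then show False using u 1 by (metis mult_nonpos_nonneg less_imp_le not_less)
        qed
        then show ?thesis using L by blast
      next
        case 2
        have "roots_poly (insert l \<Lambda>) = [:- l, 1:] * roots_poly \<Lambda>"
          using 2 L by (simp add: roots_poly_def)
        then have "op_poly (roots_poly (insert l \<Lambda>)) B x = 0" if "op_poly p B x = 0" for x
          using key[OF that] by (simp only: op_poly_mult[OF lin])
        then show ?thesis using L 2 by (intro exI[of _ "insert l \<Lambda>"]) auto
      next
        case 3
        let ?m = "roots_poly (\<Lambda> - {l})"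
        have f: "roots_poly \<Lambda> = [:- l, 1:] * ?m"
          using 3 L by (simp add: roots_poly_def prod.remove)
        have "op_poly (roots_poly \<Lambda>) B x = 0" if "op_poly p B x = 0" for x
        proof -
          let ?w = "op_poly ?m B x"
          let ?u = "op_poly [:- l, 1:] B ?w"
          have "op_poly [:- l, 1:] B ?u = 0"
            using key[OF that] by (simp only: f op_poly_mult[OF lin])
          then have "h ?u ?u = 0"
            using op_poly_form_symmetric[OF lin bil symB, of "[:- l, 1:]" ?u ?w] by (metis bilinear_lzero[OF bil])
          then have "?u = 0" using zeroI by simp
          then show ?thesis by (simp only: f op_poly_mult[OF lin])
        qed
        then show ?thesis using L by blast
      qed
    qed
  qed
qed

lemma spectral_annihilator:
  fixes h :: "'e::euclidean_space \<Rightarrow> 'e \<Rightarrow> real"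
  assumes "inner_form h" "linear B" "\<And>x y. h (B x) y = h x (B y)"
    and "\<And>x. x \<noteq> 0 \<Longrightarrow> h (B x) x > 0"
  shows "\<exists>\<Lambda>. finite \<Lambda> \<and> \<Lambda> \<subseteq> {0<..} \<and> (\<forall>x. op_poly (roots_poly \<Lambda>) B x = 0)"
proof -
  obtain p where "p \<noteq> 0" "\<And>x. op_poly p B x = 0" using annihilating_poly[OF assms(2)] by blast
  then show ?thesis using inner_form.spectral_aux[OF assms] by meson
qed

definition lagrange :: "real set \<Rightarrow> (real \<Rightarrow> real) \<Rightarrow> real poly" where
  "lagrange \<Lambda> \<phi> = (\<Sum>l\<in>\<Lambda>. smult (\<phi> l) (\<Prod>m\<in>\<Lambda> - {l}. smult (1 / (l - m)) [:- m, 1:]))"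

lemma poly_lagrange:
  assumes "finite \<Lambda>" "l \<in> \<Lambda>"
  shows "poly (lagrange \<Lambda> \<phi>) l = \<phi> l"
proof -
  have "poly (\<Prod>m\<in>\<Lambda> - {k}. smult (1 / (k - m)) [:- m, 1:]) l = (if k = l then 1 else 0)"
    if "k \<in> \<Lambda>" for k
  proof (cases "k = l")
    case True
    then show ?thesis by (auto simp: poly_prod diff_divide_distrib[symmetric] intro!: prod.neutral)
  next
    case False
    then show ?thesis using assms by (auto simp: poly_prod intro!: prod_zero bexI[of _ l])
  qed
  then have "poly (lagrange \<Lambda> \<phi>) l = (\<Sum>k\<in>\<Lambda>. \<phi> k * (if k = l then 1 else 0))"
    by (simp add: lagrange_def poly_sum)
  also have "\<dots> = \<phi> l" using assms by (simp add: sum.delta if_distrib cong: if_cong)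
  finally show ?thesis .
qed

lemma roots_poly_dvd:
  assumes "finite \<Lambda>" "\<And>l. l \<in> \<Lambda> \<Longrightarrow> poly p l = 0"
  shows "roots_poly \<Lambda> dvd p"
  using assms
proof (induction \<Lambda> arbitrary: p rule: finite_induct)
  case empty
  then show ?case by (simp add: roots_poly_def)
next
  case (insert l \<Lambda>)
  obtain m where m: "p = [:- l, 1:] * m" using insert.prems by (metis insertI1 poly_eq_0_iff_dvd dvdE)
  have "poly m k = 0" if "k \<in> \<Lambda>" for k
    using insert.prems[of k] insert.hyps that by (auto simp: m)
  then have "roots_poly \<Lambda> dvd m" by (rule insert.IH)
  then have "[:- l, 1:] * roots_poly \<Lambda> dvd [:- l, 1:] * m" by (rule mult_dvd_mono[OF dvd_refl])
  then show ?case using insert.hyps by (simp add: m roots_poly_def del: mult_pCons_left)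
qed

text \<open>The annihilating polynomial \<open>roots_poly \<Lambda>\<close> divides \<open>p - q\<close>.\<close>

lemma op_poly_eq_on_spectrum:
  assumes "linear B" "finite \<Lambda>" "\<And>x. op_poly (roots_poly \<Lambda>) B x = 0"
    and "\<And>l. l \<in> \<Lambda> \<Longrightarrow> poly p l = poly q l"
  shows "op_poly p B x = op_poly q B x"
proof -
  have "roots_poly \<Lambda> dvd p - q" using assms by (intro roots_poly_dvd) auto
  then obtain m where "p - q = m * roots_poly \<Lambda>" by (metis dvdE mult.commute)
  then have "op_poly (p - q) B x = 0"
    by (simp add: op_poly_mult assms(1,3) linear_0 linear_op_poly)
  then show ?thesis by (simp add: op_poly_diff assms(1))
qed

section \<open>Traces and inner products\<close>

definition op_trace :: "('e::euclidean_space \<Rightarrow> 'e) \<Rightarrow> real" where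
  "op_trace L = (\<Sum>b\<in>Basis. L b \<bullet> b)"

lemma op_trace_commute:
  fixes L M :: "'e::euclidean_space \<Rightarrow> 'e"
  assumes "linear L" "linear M"
  shows "op_trace (\<lambda>x. L (M x)) = op_trace (\<lambda>x. M (L x))"
proof -
  have expand: "op_trace (\<lambda>x. P (Q x)) = (\<Sum>b\<in>Basis. \<Sum>c\<in>Basis. (Q b \<bullet> c) * (P c \<bullet> b))"
    if "linear P" for P Q :: "'e \<Rightarrow> 'e"
    unfolding op_trace_def
  proof (rule sum.cong[OF refl])
    fix b :: 'e
    show "P (Q b) \<bullet> b = (\<Sum>c\<in>Basis. (Q b \<bullet> c) * (P c \<bullet> b))"
      by (subst linear_Basis_expand[OF that]) (simp add: inner_sum_left)
  qed
  show ?thesis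
    unfolding expand[OF assms(1)] expand[OF assms(2)] by (subst sum.swap) (simp add: mult.commute)
qed

lemma op_trace_add: "op_trace (\<lambda>x. L x + M x) = op_trace L + op_trace M"
  by (simp add: op_trace_def inner_add_left sum.distrib)

lemma op_trace_diff: "op_trace (\<lambda>x. L x - M x) = op_trace L - op_trace M"
  by (simp add: op_trace_def inner_diff_left sum_subtractf)

lemma op_trace_scale: "op_trace (\<lambda>x. c *\<^sub>R L x) = c * op_trace L"
  by (simp add: op_trace_def sum_distrib_left)

text \<open>The Gram-Schmidt step.\<close>

lemma (in inner_form) orthonormal_extend:
  assumes "finite E" "\<And>u v. u \<in> E \<Longrightarrow> v \<in> E \<Longrightarrow> h u v = (if u = v then 1 else 0)" "x \<notin> span E"
  shows "\<exists>e. e \<notin> E \<and> h e e = 1 \<and> (\<forall>u\<in>E. h e u = 0)"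
proof -
  define w where "w = x - (\<Sum>u\<in>E. h x u *\<^sub>R u)"
  have lh: "linear (\<lambda>y. h y u)" for u using bil by (simp add: bilinear_def)
  have hsum: "h (\<Sum>v\<in>E. h x v *\<^sub>R v) u = (\<Sum>v\<in>E. h x v * h v u)" for u
    using linear_sum[OF lh[of u], of "\<lambda>v. h x v *\<^sub>R v" E] by (simp add: form_simps)
  have wu: "h w u = 0" if "u \<in> E" for u
  proof -
    have "(\<Sum>v\<in>E. h x v * h v u) = (\<Sum>v\<in>E. if v = u then h x u else 0)"
      by (rule sum.cong) (use assms(2) that in auto)
    then show ?thesis using assms(1) that by (simp add: w_def form_simps hsum)
  qed
  have "w \<noteq> 0"
  proof
    assume "w = 0"
    then have "x = (\<Sum>u\<in>E. h x u *\<^sub>R u)" by (simp add: w_def)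
    also have "\<dots> \<in> span E" by (intro span_sum span_scale span_base)
    finally show False using assms(3) by blast
  qed
  then have hw: "h w w > 0" by (rule pos)
  define e where "e = (1 / sqrt (h w w)) *\<^sub>R w"
  have "h e e = 1" using hw by (simp add: e_def form_simps)
  moreover have eu: "h e u = 0" if "u \<in> E" for u using wu[OF that] by (simp add: e_def form_simps)
  moreover have "e \<notin> E" using eu \<open>h e e = 1\<close> by fastforce
  ultimately show ?thesis by blast
qed

text \<open>Every inner product on a Euclidean space is the standard one in suitable linear coordinates,
  by Gram-Schmidt. Traces being invariant under a change of coordinates, this reduces statements on
  traces of \<open>h\<close>-symmetric and \<open>h\<close>-skew operators to the standard inner product.\<close>

lemma inner_form_standard:
  fixes h :: "'e::euclidean_space \<Rightarrow> 'e \<Rightarrow> real"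
  assumes "inner_form h"
  shows "\<exists>(C :: 'e \<Rightarrow> 'e) D. linear C \<and> linear D \<and> (\<forall>x. C (D x) = x) \<and> (\<forall>x. D (C x) = x) \<and>
    (\<forall>x y. h (D x) (D y) = x \<bullet> y)"
proof -
  interpret inner_form h by fact
  have "\<exists>E. finite E \<and> card E = k \<and> (\<forall>u\<in>E. \<forall>v\<in>E. h u v = (if u = v then 1 else 0))"
    if "k \<le> DIM('e)" for k
    using that
  proof (induction k)
    case 0
    then show ?case by (intro exI[of _ "{}"]) auto
  next
    case (Suc k)
    then obtain E where E: "finite E" "card E = k" "\<And>u v. u \<in> E \<Longrightarrow> v \<in> E \<Longrightarrow> h u v = (if u = v then 1 else 0)"
      by auto
    have "span E \<noteq> UNIV"
    proof
      assume "span E = UNIV"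
      then have "DIM('e) \<le> card E"
        using dim_le_card[of UNIV E] E(1) by (simp add: dim_UNIV)
      then show False using E(2) Suc.prems by simp
    qed
    then obtain x where "x \<notin> span E" by blast
    then obtain e where e: "e \<notin> E" "h e e = 1" "\<forall>u\<in>E. h e u = 0"
      using orthonormal_extend[OF E(1,3)] by blast
    moreover have "h u e = 0" if "u \<in> E" for u using e(3) sym[of u e] that by simp
    ultimately show ?case using E by (intro exI[of _ "insert e E"]) auto
  qed
  from this[OF order_refl] obtain E where E: "finite E" "card E = DIM('e)"
    and hE: "\<forall>u\<in>E. \<forall>v\<in>E. h u v = (if u = v then 1 else 0)" by (elim exE conjE)
  then obtain f where f: "bij_betw f (Basis :: 'e set) E"
    using finite_same_card_bij[OF finite_Basis E(1)] by metis
  have hf: "h (f b) (f c) = (if b = c then 1 else 0)" if "b \<in> Basis" "c \<in> Basis" for b c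
    using hE f that by (auto simp: bij_betw_def inj_on_def)
  define D where "D = (\<lambda>x::'e. \<Sum>b\<in>Basis. (x \<bullet> b) *\<^sub>R f b)"
  have D: "linear D"
    by (rule linearI) (simp_all add: D_def inner_add_left scaleR_add_left sum.distrib scaleR_sum_right)
  have hD: "h (D x) (D y) = x \<bullet> y" for x y
  proof -
    have l1: "linear (\<lambda>z. h z w)" and l2: "linear (h w)" for w using bil by (auto simp: bilinear_def)
    have e1: "h (D x) w = (\<Sum>b\<in>Basis. (x \<bullet> b) * h (f b) w)" for w
      using linear_sum[OF l1[of w], of "\<lambda>b. (x \<bullet> b) *\<^sub>R f b" Basis] by (simp add: D_def form_simps)
    have e2: "h w (D y) = (\<Sum>c\<in>Basis. (y \<bullet> c) * h w (f c))" for w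
      using linear_sum[OF l2[of w], of "\<lambda>b. (y \<bullet> b) *\<^sub>R f b" Basis] by (simp add: D_def form_simps)
    have "h (D x) (D y) = (\<Sum>b\<in>Basis. \<Sum>c\<in>Basis. (x \<bullet> b) * ((y \<bullet> c) * h (f b) (f c)))"
      unfolding e1 by (simp add: e2 sum_distrib_left)
    also have "\<dots> = (\<Sum>b\<in>Basis. \<Sum>c\<in>Basis. if c = b then (x \<bullet> b) * (y \<bullet> b) else 0)"
      by (intro sum.cong refl) (auto simp: hf)
    also have "\<dots> = (\<Sum>b\<in>Basis. (x \<bullet> b) * (y \<bullet> b))" by (simp add: sum.delta)
    also have "\<dots> = x \<bullet> y" by (rule euclidean_inner[symmetric])
    finally show ?thesis .
  qed
  have "inj D"
  proof (rule injI)
    fix x y assume "D x = D y"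
    then have "D (x - y) = 0" by (simp add: linear_diff[OF D])
    then have "(x - y) \<bullet> (x - y) = 0" using hD[of "x - y" "x - y"] by (simp add: form_simps)
    then show "x = y" by simp
  qed
  then obtain C where "linear C" "\<forall>x. C (D x) = x" "\<forall>x. D (C x) = x"
    using linear_injective_isomorphism[OF D] by blast
  then show ?thesis by (intro exI[of _ C] exI[of _ D] conjI D) (simp_all add: hD)
qed

lemma op_trace_conjugate:
  fixes L C D :: "'e::euclidean_space \<Rightarrow> 'e"
  assumes "linear C" "linear D" "\<And>x. D (C x) = x" "linear L"
  shows "op_trace L = op_trace (\<lambda>x. C (L (D x)))"
  using op_trace_commute[OF assms(1) linear_compose[OF assms(2,4)]] by (simp add: assms(3))

text \<open>In coordinates in which \<open>h\<close> is standard, \<open>L\<close> has a skew matrix, with zeros on the diagonal.\<close>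

lemma op_trace_skew:
  fixes h :: "'e::euclidean_space \<Rightarrow> 'e \<Rightarrow> real"
  assumes "inner_form h" "linear L" "\<And>x y. h (L x) y = - h x (L y)"
  shows "op_trace L = 0"
proof -
  from inner_form_standard[OF assms(1)] obtain C D :: "'e \<Rightarrow> 'e" where CD0: "linear C" "linear D"
    "\<forall>x. C (D x) = x" "\<forall>x. D (C x) = x" "\<forall>x y. h (D x) (D y) = x \<bullet> y"
    by (elim exE conjE)
  note CD = CD0(1,2) CD0(3,4)[rule_format] CD0(5)[rule_format]
  have hC: "C z \<bullet> x = h z (D x)" for z x using CD(5)[of "C z" x] CD(4) by simp
  have "C (L (D b)) \<bullet> b = 0" for b
    using assms(3)[of "D b" "D b"] inner_form.sym[OF assms(1), of "D b" "L (D b)"] by (simp add: hC)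
  then show ?thesis
    by (subst op_trace_conjugate[OF CD(1,2,4) assms(2)]) (simp add: op_trace_def)
qed

text \<open>For symmetric \<open>L\<close>, the trace of \<open>L\<^sup>2\<close> is the sum of the \<open>h (L b) (L b)\<close> over an orthonormal
  basis.\<close>

lemma op_trace_square_symmetric:
  fixes h :: "'e::euclidean_space \<Rightarrow> 'e \<Rightarrow> real"
  assumes "inner_form h" "linear L" "\<And>x y. h (L x) y = h x (L y)"
    and "op_trace (\<lambda>x. L (L x)) = 0"
  shows "L x = 0"
proof -
  interpret inner_form h by fact
  from inner_form_standard[OF assms(1)] obtain C D :: "'e \<Rightarrow> 'e" where CD0: "linear C" "linear D"
    "\<forall>x. C (D x) = x" "\<forall>x. D (C x) = x" "\<forall>x y. h (D x) (D y) = x \<bullet> y"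
    by (elim exE conjE)
  note CD = CD0(1,2) CD0(3,4)[rule_format] CD0(5)[rule_format]
  have hC: "C z \<bullet> x = h z (D x)" for z x using CD(5)[of "C z" x] CD(4) by simp
  have LL: "linear (\<lambda>x. L (L x))" using linear_compose[OF assms(2,2)] by (simp add: comp_def)
  have "(\<Sum>b\<in>Basis. h (L (D b)) (L (D b))) = 0"
    using assms(4) op_trace_conjugate[OF CD(1,2,4) LL] by (simp add: op_trace_def hC assms(3))
  then have "h (L (D b)) (L (D b)) = 0" if "b \<in> Basis" for b
    using that nonneg by (simp add: sum_nonneg_eq_0_iff)
  then have LD: "L (D b) = 0" if "b \<in> Basis" for b using zeroI that by simp
  have "linear (\<lambda>x. L (D x))" using linear_compose[OF CD(2) assms(2)] by (simp add: comp_def)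
  then have "L (D y) = 0" for y using linear_Basis_expand[of "\<lambda>x. L (D x)" y] LD by simp
  then show ?thesis using CD(4)[of x] by metis
qed

section \<open>The polar decomposition of a skew operator\<close>

definition spec_poly :: "real set \<Rightarrow> (real \<Rightarrow> real) \<Rightarrow> real poly" where
  "spec_poly \<Lambda> \<phi> = pcompose (lagrange \<Lambda> \<phi>) [:0, 0, -1:]"

text \<open>The operator \<open>\<phi>(- R\<^sup>2)\<close>, when \<open>\<Lambda>\<close> contains the spectrum of \<open>- R\<^sup>2\<close>. It is written as a
  polynomial in \<open>R\<close> whose coefficients depend on \<open>\<Lambda>\<close> and \<open>\<phi>\<close> only: this makes it
  possible to differentiate it as \<open>R\<close> varies with fixed spectrum.\<close>

definition spec_op :: "real set \<Rightarrow> (real \<Rightarrow> real) \<Rightarrow> ('v::real_vector \<Rightarrow> 'v) \<Rightarrow> 'v \<Rightarrow> 'v" where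
  "spec_op \<Lambda> \<phi> R = op_poly (spec_poly \<Lambda> \<phi>) R"

text \<open>That is, \<open>- R\<^sup>2\<close> is diagonalizable with eigenvalues in \<open>\<Lambda>\<close>. Elements of \<open>\<Lambda>\<close> need not be
  eigenvalues, so that the condition is the vanishing of a single polynomial in \<open>R\<close>, which behaves well
  under changes of coordinates and can be tested by a trace.\<close>

definition has_spectrum :: "real set \<Rightarrow> ('v::real_vector \<Rightarrow> 'v) \<Rightarrow> bool" where
  "has_spectrum \<Lambda> R \<longleftrightarrow> finite \<Lambda> \<and> \<Lambda> \<subseteq> {0<..} \<and>
     (\<forall>x. op_poly (pcompose (roots_poly \<Lambda>) [:0, 0, -1:]) R x = 0)"

lemma op_poly_neg_square: "linear R \<Longrightarrow> op_poly [:0, 0, -1:] R = (\<lambda>x. - R (R x))"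
  by (rule ext) (simp add: linear_0 linear_neg)

lemma linear_neg_square: "linear R \<Longrightarrow> linear (\<lambda>x. - R (R x))"
  using linear_op_poly[of R "[:0, 0, -1:]"] op_poly_neg_square[of R] by simp

lemma spec_op_alt: "linear R \<Longrightarrow> spec_op \<Lambda> \<phi> R x = op_poly (lagrange \<Lambda> \<phi>) (\<lambda>x. - R (R x)) x"
  by (simp add: spec_op_def spec_poly_def op_poly_pcompose op_poly_neg_square)

context
  fixes \<Lambda> :: "real set" and R :: "'v::real_vector \<Rightarrow> 'v"
  assumes lin: "linear R" and spec: "has_spectrum \<Lambda> R"
begin

lemma spec_op_eqI:
  "(\<And>l. l \<in> \<Lambda> \<Longrightarrow> poly p l = poly q l) \<Longrightarrow>
    op_poly p (\<lambda>x. - R (R x)) x = op_poly q (\<lambda>x. - R (R x)) x"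
  using spec unfolding has_spectrum_def
  by (intro op_poly_eq_on_spectrum[of _ \<Lambda>] linear_neg_square lin)
    (auto simp: op_poly_pcompose[OF lin] op_poly_neg_square[OF lin])

lemma spec_op_mult:
  "spec_op \<Lambda> \<phi> R (spec_op \<Lambda> \<psi> R x) = spec_op \<Lambda> (\<lambda>l. \<phi> l * \<psi> l) R x"
  using spec unfolding has_spectrum_def
  by (simp only: spec_op_alt[OF lin] op_poly_mult[OF linear_neg_square[OF lin], symmetric])
    (intro spec_op_eqI, simp add: poly_lagrange)

lemma spec_op_const1: "(\<And>l. l \<in> \<Lambda> \<Longrightarrow> \<phi> l = 1) \<Longrightarrow> spec_op \<Lambda> \<phi> R x = x"
  using spec_op_eqI[of "lagrange \<Lambda> \<phi>" 1] spec unfolding has_spectrum_def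
  by (simp add: spec_op_alt[OF lin] linear_neg_square[OF lin] poly_lagrange)

lemma spec_op_id: "(\<And>l. l \<in> \<Lambda> \<Longrightarrow> \<phi> l = l) \<Longrightarrow> spec_op \<Lambda> \<phi> R x = - R (R x)"
  using spec_op_eqI[of "lagrange \<Lambda> \<phi>" "[:0, 1:]"] spec unfolding has_spectrum_def
  by (simp add: spec_op_alt[OF lin] linear_neg_square[OF lin] poly_lagrange linear_0[OF lin] linear_0[OF linear_neg_square[OF lin]])

lemma spec_op_cong: "(\<And>l. l \<in> \<Lambda> \<Longrightarrow> \<phi> l = \<psi> l) \<Longrightarrow> spec_op \<Lambda> \<phi> R x = spec_op \<Lambda> \<psi> R x"
  using spec unfolding has_spectrum_def
  by (simp only: spec_op_alt[OF lin]) (intro spec_op_eqI, simp add: poly_lagrange)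

text \<open>The spectral decomposition: the operators on the right are the projections to the
  eigenspaces of \<open>- R\<^sup>2\<close>.\<close>

lemma spec_op_sum:
  "spec_op \<Lambda> \<phi> R x = (\<Sum>l\<in>\<Lambda>. \<phi> l *\<^sub>R spec_op \<Lambda> (\<lambda>m. if m = l then 1 else 0) R x)"
proof -
  have fin: "finite \<Lambda>" using spec by (simp add: has_spectrum_def)
  let ?q = "\<Sum>l\<in>\<Lambda>. smult (\<phi> l) (lagrange \<Lambda> (\<lambda>m. if m = l then 1 else 0))"
  have "poly ?q m = \<phi> m" if "m \<in> \<Lambda>" for m
    using fin that by (simp add: poly_sum poly_lagrange if_distrib cong: if_cong)
  then have "op_poly (lagrange \<Lambda> \<phi>) (\<lambda>x. - R (R x)) x = op_poly ?q (\<lambda>x. - R (R x)) x"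
    using fin by (intro spec_op_eqI) (simp add: poly_lagrange)
  then show ?thesis
    by (simp add: spec_op_alt[OF lin] op_poly_sum[OF linear_neg_square[OF lin]] op_poly_smult[OF linear_neg_square[OF lin]])
qed

end

lemma linear_spec_op: "linear R \<Longrightarrow> linear (spec_op \<Lambda> \<phi> R)"
  by (simp add: spec_op_def linear_op_poly)

lemma spec_op_commute: "linear R \<Longrightarrow> spec_op \<Lambda> \<phi> R (R x) = R (spec_op \<Lambda> \<phi> R x)"
  by (simp add: spec_op_def op_poly_self_commute)

text \<open>The orthogonal component \<open>(- R\<^sup>2)\<^sup>-\<^sup>1\<^sup>/\<^sup>2 R\<close>, as a polynomial in \<open>R\<close>.\<close>

definition polar_poly :: "real set \<Rightarrow> real poly" where
  "polar_poly \<Lambda> = spec_poly \<Lambda> (\<lambda>l. 1 / sqrt l) * [:0, 1:]"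

lemma op_poly_polar:
  assumes "linear R"
  shows "op_poly (polar_poly \<Lambda>) R x = spec_op \<Lambda> (\<lambda>l. 1 / sqrt l) R (R x)"
  using assms by (simp add: polar_poly_def op_poly_mult spec_op_def linear_0 del: mult_pCons_right)

locale skew_operator = inner_form h for h :: "'v::real_vector \<Rightarrow> 'v \<Rightarrow> real" +
  fixes R :: "'v \<Rightarrow> 'v" and \<Lambda> :: "real set"
  assumes lin: "linear R"
    and skew: "h (R x) y = - h x (R y)"
    and inj: "R x = 0 \<Longrightarrow> x = 0"
    and spec: "has_spectrum \<Lambda> R"
begin

abbreviation "J \<equiv> op_poly (polar_poly \<Lambda>) R"
abbreviation "S \<equiv> spec_op \<Lambda> sqrt R"

lemma \<Lambda>_pos: "l \<in> \<Lambda> \<Longrightarrow> l > 0"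
  using spec by (auto simp: has_spectrum_def)

lemma spec_op_symmetric: "h (spec_op \<Lambda> \<phi> R x) y = h x (spec_op \<Lambda> \<phi> R y)"
  unfolding spec_op_alt[OF lin]
  by (rule op_poly_form_symmetric[OF linear_neg_square[OF lin] bil]) (simp add: form_simps skew)

lemma S_S: "S (S x) = - R (R x)"
  using \<Lambda>_pos by (simp add: spec_op_mult[OF lin spec] spec_op_id[OF lin spec] less_imp_le)

lemma S_pos: "x \<noteq> 0 \<Longrightarrow> h (S x) x > 0"
proof -
  assume x: "x \<noteq> 0"
  \<comment> \<open>\<open>S\<close> is positive as the square of the symmetric operator \<open>Q\<close>, which is injective since
    \<open>Q\<^sup>4 = - R\<^sup>2\<close> is.\<close>
  let ?Q = "spec_op \<Lambda> (\<lambda>l. sqrt (sqrt l)) R"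
  have Q: "?Q (?Q y) = S y" for y
    unfolding spec_op_mult[OF lin spec] by (rule spec_op_cong[OF lin spec]) (simp add: \<Lambda>_pos less_imp_le)
  have "?Q x \<noteq> 0"
  proof
    assume "?Q x = 0"
    then have "S x = 0" using Q[of x] by (simp add: linear_0[OF linear_spec_op[OF lin]])
    then have "R (R x) = 0" using S_S[of x] by (simp add: linear_0[OF linear_spec_op[OF lin]])
    then show False using inj x by blast
  qed
  then have "h (?Q x) (?Q x) > 0" by (rule pos)
  then show ?thesis by (simp add: Q[symmetric] spec_op_symmetric)
qed

lemma S_inverse: "spec_op \<Lambda> (\<lambda>l. 1 / sqrt l) R (S x) = x" "S (spec_op \<Lambda> (\<lambda>l. 1 / sqrt l) R x) = x"
  unfolding spec_op_mult[OF lin spec]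
  by (rule spec_op_const1[OF lin spec], use \<Lambda>_pos in fastforce)+

lemma R_eq: "R x = S (J x)"
  by (simp add: op_poly_polar[OF lin] S_inverse)

lemma R_J: "R (J x) = - S x"
proof -
  have "R (J x) = spec_op \<Lambda> (\<lambda>l. 1 / sqrt l) R (R (R x))"
    by (simp add: op_poly_polar[OF lin] spec_op_commute[OF lin])
  also have "\<dots> = - spec_op \<Lambda> (\<lambda>l. 1 / sqrt l) R (S (S x))"
    by (simp add: S_S linear_neg[OF linear_spec_op[OF lin]])
  also have "spec_op \<Lambda> (\<lambda>l. 1 / sqrt l) R (S (S x)) = S x"
    by (rule S_inverse)
  finally show ?thesis .
qed

lemma J_J: "J (J x) = - x"
proof -
  have "J (J x) = spec_op \<Lambda> (\<lambda>l. 1 / sqrt l) R (- S x)"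
    by (simp only: op_poly_polar[OF lin, of \<Lambda> "J x"] R_J)
  also have "\<dots> = - x"
    by (simp add: linear_neg[OF linear_spec_op[OF lin]] S_inverse)
  finally show ?thesis .
qed

lemma J_skew: "h (J x) y = - h x (J y)"
  by (simp add: op_poly_polar[OF lin] spec_op_symmetric skew spec_op_commute[OF lin])

lemma J_orthogonal: "h (J x) (J y) = h x y"
  by (simp add: J_skew J_J form_simps)

end

text \<open>If \<open>R = S' J'\<close> is any polar decomposition of the skew operator \<open>R\<close>, then
  \<open>S'\<^sup>2 = R R\<^sup>T = - R\<^sup>2\<close>, so that \<open>S'\<close> commutes with \<open>- R\<^sup>2\<close> and hence with its polynomial \<open>S\<close>; then
  \<open>(S' + S) (S' - S) = 0\<close> with \<open>S' + S\<close> positive definite.\<close>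

lemma polar_unique:
  fixes h :: "'e::euclidean_space \<Rightarrow> 'e \<Rightarrow> real"
  assumes "skew_operator h R \<Lambda>" "linear S'" "linear J'"
    and dec: "\<And>x. R x = S' (J' x)"
    and symS: "\<And>x y. h (S' x) y = h x (S' y)"
    and posS: "\<And>x. x \<noteq> 0 \<Longrightarrow> h (S' x) x > 0"
    and orth: "\<And>x y. h (J' x) (J' y) = h x y"
  shows "J' x = op_poly (polar_poly \<Lambda>) R x"
proof -
  interpret skew_operator h R \<Lambda> by fact
  have "inj J'"
  proof (rule injI)
    fix x y assume "J' x = J' y"
    then have "h (x - y) (x - y) = 0" using orth[of "x - y" "x - y"] by (simp add: linear_diff[OF assms(3)] form_simps)
    then show "x = y" using zeroI[of "x - y"] by simp
  qed
  then have surj: "surj J'" by (rule linear_inj_imp_surj[OF assms(3)])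
  have SJ: "S' y = - J' (R y)" for y
  proof (rule eqI)
    fix z
    obtain x where x: "z = J' x" using surj by (metis surjD)
    have "h (S' y) z = h y (R x)" by (simp add: x symS dec)
    also have "\<dots> = - h (R y) x" by (simp add: skew)
    also have "\<dots> = h (- J' (R y)) z" by (simp add: x orth form_simps)
    finally show "h (S' y) z = h (- J' (R y)) z" .
  qed
  have SS: "S' (S' y) = - R (R y)" for y
    using SJ[of y] dec[of "R y"] by (simp add: linear_neg[OF assms(2)])
  have comm: "S' (S y) = S (S' y)" for y
    unfolding spec_op_alt[OF lin]
    by (rule op_poly_intertwine[OF linear_neg_square[OF lin] linear_neg_square[OF lin] assms(2)])
      (simp add: SS[symmetric])
  have "S' y = S y" for y
  proof -
    let ?z = "S' y - S y"
    have "S' ?z + S ?z = 0"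
      by (simp add: linear_diff[OF assms(2)] linear_diff[OF linear_spec_op[OF lin]] comm SS S_S)
    then have "h (S' ?z) ?z + h (S ?z) ?z = 0" by (metis bilinear_ladd[OF bil] bilinear_lzero[OF bil])
    then have "?z = 0" using posS[of ?z] S_pos[of ?z] by fastforce
    then show ?thesis by simp
  qed
  then have "R x = S (J' x)" using dec by simp
  then have "J x = spec_op \<Lambda> (\<lambda>l. 1 / sqrt l) R (S (J' x))" by (simp only: op_poly_polar[OF lin])
  also have "\<dots> = J' x"
    by (rule S_inverse)
  finally show ?thesis by simp
qed

section \<open>Fields of linear maps on an open set\<close>

text \<open>The codomain is general, so that the notion covers both the matrix of an endomorphism field and
  a bilinear form with one argument fixed.\<close>

definition op_field :: "'e::euclidean_space set \<Rightarrow> ('e \<Rightarrow> 'd::euclidean_space \<Rightarrow> 'f::real_normed_vector) \<Rightarrow> bool" where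
  "op_field W F \<longleftrightarrow> (\<forall>y\<in>W. linear (F y)) \<and> (\<forall>w. smooth_on W (\<lambda>y. F y w))"

text \<open>The argument \<open>v\<close> is the direction of differentiation, and the derivative of the linear map is
  applied to \<open>w\<close>.\<close>

definition op_deriv :: "('e::euclidean_space \<Rightarrow> 'd \<Rightarrow> 'f::real_normed_vector) \<Rightarrow> 'e \<Rightarrow> 'e \<Rightarrow> 'd \<Rightarrow> 'f" where
  "op_deriv F y v w = frechet_derivative (\<lambda>z. F z w) (at y) v"

lemma op_field_linear: "op_field W F \<Longrightarrow> y \<in> W \<Longrightarrow> linear (F y)"
  by (simp add: op_field_def)

lemma op_field_smooth: "op_field W F \<Longrightarrow> smooth_on W (\<lambda>y. F y w)"
  by (simp add: op_field_def)

lemma op_field_subset: "op_field W F \<Longrightarrow> V \<subseteq> W \<Longrightarrow> op_field V F"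
  unfolding op_field_def by (blast intro: smooth_on_subset)

lemma op_field_cong:
  assumes "open W" "op_field W F" "\<And>y x. y \<in> W \<Longrightarrow> F y x = G y x"
  shows "op_field W G"
proof -
  have "linear (G y)" if "y \<in> W" for y
  proof -
    have "F y = G y" using assms(3) that by blast
    then show ?thesis using op_field_linear[OF assms(2) that] by simp
  qed
  moreover have "smooth_on W (\<lambda>y. G y w)" for w
    by (rule smooth_on_cong[OF assms(1) _ op_field_smooth[OF assms(2)]]) (rule assms(3))
  ultimately show ?thesis by (simp add: op_field_def)
qed

lemma op_deriv_cong:
  assumes "open W" "op_field W F" "y \<in> W" "\<And>y x. y \<in> W \<Longrightarrow> F y x = G y x"
  shows "op_deriv F y v w = op_deriv G y v w"
proof -
  have "frechet_derivative (\<lambda>z. F z w) (at y) = frechet_derivative (\<lambda>z. G z w) (at y)"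
    by (rule frechet_derivative_transform_within_open[OF _ assms(1,3)])
      (use smooth_on_differentiable[OF op_field_smooth[OF assms(2)] assms(3)] assms(4) in auto)
  then show ?thesis by (simp add: op_deriv_def)
qed

lemma op_deriv_has_derivative:
  assumes "op_field W F" "y \<in> W"
  shows "((\<lambda>z. F z w) has_derivative (\<lambda>v. op_deriv F y v w)) (at y)"
  using smooth_on_has_derivative[OF op_field_smooth[OF assms(1)] assms(2), of w]
  by (simp add: op_deriv_def)

lemma op_deriv_eqI: "((\<lambda>z. F z w) has_derivative f') (at y) \<Longrightarrow> op_deriv F y v w = f' v"
  by (simp add: op_deriv_def frechet_derivative_eqI)

lemma op_deriv_linear_left:
  assumes "op_field W F" "y \<in> W"
  shows "linear (\<lambda>v. op_deriv F y v w)"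
  using op_deriv_has_derivative[OF assms] has_derivative_linear by blast

lemma op_deriv_linear_right:
  assumes "open W" "op_field W F" "y \<in> W"
  shows "linear (op_deriv F y v)"
proof (rule linearI)
  note d = op_deriv_has_derivative[OF assms(2,3)]
  have "((\<lambda>z. F z (a + b)) has_derivative (\<lambda>v. op_deriv F y v a + op_deriv F y v b)) (at y)" for a b
    by (rule has_derivative_transform_within_open[OF has_derivative_add[OF d d] assms(1,3)])
      (simp add: linear_add[OF op_field_linear[OF assms(2)]])
  then show "op_deriv F y v (a + b) = op_deriv F y v a + op_deriv F y v b" for a b
    by (rule op_deriv_eqI)
  have "((\<lambda>z. F z (c *\<^sub>R a)) has_derivative (\<lambda>v. c *\<^sub>R op_deriv F y v a)) (at y)" for a c
    by (rule has_derivative_transform_within_open[OF has_derivative_scaleR_right[OF d] assms(1,3)])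
      (simp add: linear_cmul[OF op_field_linear[OF assms(2)]])
  then show "op_deriv F y v (c *\<^sub>R a) = c *\<^sub>R op_deriv F y v a" for a c
    by (rule op_deriv_eqI)
qed

lemma smooth_on_apply:
  assumes "open W" "op_field W F" "smooth_on W u"
  shows "smooth_on W (\<lambda>y. F y (u y))"
proof (rule smooth_on_cong[OF assms(1)])
  show "smooth_on W (\<lambda>y. \<Sum>b\<in>Basis. (u y \<bullet> b) *\<^sub>R F y b)"
    by (intro smooth_on_sum smooth_on_scaleR smooth_on_bounded_linear[OF _ bounded_linear_inner_left]
        op_field_smooth[OF assms(2)] assms)
  show "(\<Sum>b\<in>Basis. (u y \<bullet> b) *\<^sub>R F y b) = F y (u y)" if "y \<in> W" for y
    using linear_Basis_expand[OF op_field_linear[OF assms(2) that]] by metis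
qed

text \<open>The product rule, with \<open>F\<close> and \<open>u\<close> expanded in a basis to reduce it to scalar multiples of
  the smooth maps \<open>z \<mapsto> F z b\<close>.\<close>

lemma has_derivative_apply:
  assumes "open W" "op_field W F" "y \<in> W" "(u has_derivative u') (at y)"
  shows "((\<lambda>z. F z (u z)) has_derivative (\<lambda>v. op_deriv F y v (u y) + F y (u' v))) (at y)"
proof -
  have "((\<lambda>z. \<Sum>b\<in>Basis. (u z \<bullet> b) *\<^sub>R F z b) has_derivative
      (\<lambda>v. \<Sum>b\<in>Basis. (u y \<bullet> b) *\<^sub>R op_deriv F y v b + (u' v \<bullet> b) *\<^sub>R F y b)) (at y)"
    by (intro has_derivative_sum has_derivative_scaleR has_derivative_inner_left assms(4)
        op_deriv_has_derivative[OF assms(2,3)])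
  moreover have "(\<lambda>v. \<Sum>b\<in>Basis. (u y \<bullet> b) *\<^sub>R op_deriv F y v b + (u' v \<bullet> b) *\<^sub>R F y b) =
      (\<lambda>v. op_deriv F y v (u y) + F y (u' v))"
  proof
    fix v
    show "(\<Sum>b\<in>Basis. (u y \<bullet> b) *\<^sub>R op_deriv F y v b + (u' v \<bullet> b) *\<^sub>R F y b) =
        op_deriv F y v (u y) + F y (u' v)"
      using linear_Basis_expand[OF op_deriv_linear_right[OF assms(1-3), of v], of "u y"]
        linear_Basis_expand[OF op_field_linear[OF assms(2,3)], of "u' v"]
      by (simp add: sum.distrib)
  qed
  ultimately have "((\<lambda>z. \<Sum>b\<in>Basis. (u z \<bullet> b) *\<^sub>R F z b) has_derivative
      (\<lambda>v. op_deriv F y v (u y) + F y (u' v))) (at y)" by simp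
  then show ?thesis
  proof (rule has_derivative_transform_within_open[OF _ assms(1,3)])
    show "(\<Sum>b\<in>Basis. (u z \<bullet> b) *\<^sub>R F z b) = F z (u z)" if "z \<in> W" for z
      using linear_Basis_expand[OF op_field_linear[OF assms(2) that]] by metis
  qed
qed

lemma op_field_comp:
  assumes "open W" "op_field W F" "op_field W G"
  shows "op_field W (\<lambda>y x. F y (G y x))"
  unfolding op_field_def
proof (intro conjI ballI allI)
  show "linear (\<lambda>x. F y (G y x))" if "y \<in> W" for y
    using linear_compose[OF op_field_linear[OF assms(3) that] op_field_linear[OF assms(2) that]]
    by (simp add: comp_def)
  show "smooth_on W (\<lambda>y. F y (G y w))" for w
    by (rule smooth_on_apply[OF assms(1,2) op_field_smooth[OF assms(3)]])
qed

lemma op_deriv_comp: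
  assumes "open W" "op_field W F" "op_field W G" "y \<in> W"
  shows "op_deriv (\<lambda>y x. F y (G y x)) y v w = op_deriv F y v (G y w) + F y (op_deriv G y v w)"
  by (rule op_deriv_eqI) (rule has_derivative_apply[OF assms(1,2,4) op_deriv_has_derivative[OF assms(3,4)]])

lemma op_field_add:
  assumes "open W" "op_field W F" "op_field W G"
  shows "op_field W (\<lambda>y x. F y x + G y x)"
  using assms by (auto simp: op_field_def intro: linear_compose_add smooth_on_add)

lemma op_deriv_add:
  assumes "op_field W F" "op_field W G" "y \<in> W"
  shows "op_deriv (\<lambda>y x. F y x + G y x) y v w = op_deriv F y v w + op_deriv G y v w"
  by (rule op_deriv_eqI) (rule has_derivative_add[OF assms(1,2)[THEN op_deriv_has_derivative, OF assms(3)]])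

lemma op_field_const: "linear L \<Longrightarrow> op_field W (\<lambda>y. L)"
  by (simp add: op_field_def smooth_on_const)

lemma op_deriv_const [simp]: "op_deriv (\<lambda>y. L) y v w = 0"
  by (simp add: op_deriv_def)

lemma op_field_poly:
  fixes F :: "'e::euclidean_space \<Rightarrow> 'd::euclidean_space \<Rightarrow> 'd"
  assumes "open W" "op_field W F"
  shows "op_field W (\<lambda>y. op_poly p (F y))"
proof (induction p)
  case 0
  have "op_field W (\<lambda>(y::'e) (x::'d). 0 :: 'd)" by (rule op_field_const[OF module_hom_zero])
  then show ?case by (rule op_field_cong[OF assms(1)]) simp
next
  case (pCons a p)
  have "op_field W (\<lambda>y x. a *\<^sub>R x + F y (op_poly p (F y) x))"
    by (rule op_field_add[OF assms(1) op_field_const[OF linear_compose_scale_right[OF linear_ident]]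
          op_field_comp[OF assms pCons(2)]])
  then show ?case
    by (rule op_field_cong[OF assms(1)]) (simp add: op_field_linear[OF assms(2)])
qed

lemma op_deriv_poly_pCons:
  fixes F :: "'e::euclidean_space \<Rightarrow> 'd::euclidean_space \<Rightarrow> 'd"
  assumes "open W" "op_field W F" "y \<in> W"
  shows "op_deriv (\<lambda>y. op_poly (pCons a p) (F y)) y v w = op_deriv (\<lambda>y x. F y (op_poly p (F y) x)) y v w"
proof -
  have 1: "op_field W (\<lambda>y x. F y (op_poly p (F y) x))"
    by (rule op_field_comp[OF assms(1,2) op_field_poly[OF assms(1,2)]])
  have 2: "op_field W (\<lambda>y x. a *\<^sub>R x :: 'd)"
    by (rule op_field_const[OF linear_compose_scale_right[OF linear_ident]])
  have "op_deriv (\<lambda>y. op_poly (pCons a p) (F y)) y v w = op_deriv (\<lambda>y x. a *\<^sub>R x + F y (op_poly p (F y) x)) y v w"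
    by (rule op_deriv_cong[OF assms(1) op_field_poly[OF assms(1,2)] assms(3)])
      (simp add: op_field_linear[OF assms(2)])
  then show ?thesis by (simp add: op_deriv_add[OF 2 1 assms(3)])
qed

section \<open>The Nijenhuis bracket of commuting operator fields\<close>

text \<open>For vector fields \<open>X\<close>, \<open>Y\<close> with constant components and commuting \<open>F\<close>, \<open>G\<close>, this is
  \<open>[F X, G Y] + F G [X, Y] - F [X, G Y] - G [F X, Y]\<close>, which for \<open>F = G\<close> is the Nijenhuis
  tensor.\<close>

definition nij_bracket :: "('e::euclidean_space \<Rightarrow> 'e \<Rightarrow> 'e) \<Rightarrow> ('e \<Rightarrow> 'e \<Rightarrow> 'e) \<Rightarrow> 'e \<Rightarrow> 'e \<Rightarrow> 'e \<Rightarrow> 'e" where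
  "nij_bracket F G y X Y = op_deriv G y (F y X) Y - op_deriv F y (G y Y) X
     - F y (op_deriv G y X Y) + G y (op_deriv F y Y X)"

lemma nij_bracket_swap: "nij_bracket F G y X Y = - nij_bracket G F y Y X"
  by (simp add: nij_bracket_def)

text \<open>The bracket obeys a Leibniz rule in its second operator, so that its vanishing passes to products
  of operators that commute with \<open>F\<close>.\<close>

lemma nij_bracket_comp:
  assumes "open W" "op_field W F" "op_field W G" "op_field W H" "y \<in> W"
    and "\<And>x. F y (G y x) = G y (F y x)"
  shows "nij_bracket F (\<lambda>y x. G y (H y x)) y X Y =
    nij_bracket F G y X (H y Y) + G y (nij_bracket F H y X Y)"
  by (simp add: nij_bracket_def op_deriv_comp[OF assms(1,3,4,5)] assms(6)
      linear_add[OF op_field_linear[OF assms(2,5)]] linear_add[OF op_field_linear[OF assms(3,5)]]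
      linear_diff[OF op_field_linear[OF assms(3,5)]] algebra_simps)

lemma nij_bracket_poly_right:
  assumes "open W" "op_field W F" "op_field W G" "y \<in> W"
    and comm: "\<And>x. F y (G y x) = G y (F y x)"
    and zero: "\<And>X Y. nij_bracket F G y X Y = 0"
  shows "nij_bracket F (\<lambda>y. op_poly p (G y)) y X Y = 0"
proof (induction p arbitrary: X Y)
  case 0
  have F: "linear (F y)" and DF: "linear (\<lambda>v. op_deriv F y v X)"
    using op_field_linear op_deriv_linear_left assms by blast+
  have "op_poly 0 (G y) = (\<lambda>x. 0)" for y by (rule ext) simp
  then show ?case by (simp add: nij_bracket_def linear_0[OF F] linear_0[OF DF])
next
  case (pCons a p)
  note pf = op_field_poly[OF assms(1,3), of p]
  note cf = op_field_comp[OF assms(1,3) pf]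
  have DF: "linear (\<lambda>v. op_deriv F y v X)" using op_deriv_linear_left[OF assms(2,4)] .
  have "nij_bracket F (\<lambda>y. op_poly (pCons a p) (G y)) y X Y = nij_bracket F (\<lambda>y x. G y (op_poly p (G y) x)) y X Y"
    by (simp add: nij_bracket_def op_deriv_poly_pCons[OF assms(1,3,4)] op_field_linear[OF assms(3,4)]
        linear_add[OF DF] linear_cmul[OF DF])
  also have "\<dots> = nij_bracket F G y X (op_poly p (G y) Y) + G y (nij_bracket F (\<lambda>y. op_poly p (G y)) y X Y)"
    by (rule nij_bracket_comp[of W F G "\<lambda>y. op_poly p (G y)" y, OF assms(1-3) pf assms(4) comm])
  also have "\<dots> = 0"
    using linear_0[OF op_field_linear[OF assms(3,4)]] by (simp add: zero pCons)
  finally show ?case .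
qed

text \<open>First \<open>F\<close> commutes in the sense of the bracket with every \<open>p(F)\<close>; then so does \<open>p(F)\<close> with \<open>F\<close>,
  by antisymmetry, and with every \<open>q(F)\<close>.\<close>

lemma nij_bracket_poly:
  assumes "open W" "op_field W F" "y \<in> W" "\<And>X Y. nij_bracket F F y X Y = 0"
  shows "nij_bracket (\<lambda>y. op_poly p (F y)) (\<lambda>y. op_poly q (F y)) y X Y = 0"
proof (rule nij_bracket_poly_right[of W "\<lambda>y. op_poly p (F y)" F y, OF assms(1) op_field_poly[OF assms(1,2)] assms(2,3)])
  show "op_poly p (F y) (F y x) = F y (op_poly p (F y) x)" for x
    by (rule op_poly_self_commute[OF op_field_linear[OF assms(2,3)]])
  have "nij_bracket F (\<lambda>y. op_poly p (F y)) y Y X = 0" for X Y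
    by (rule nij_bracket_poly_right[of W F F y, OF assms(1,2,2,3) refl assms(4)])
  then show "nij_bracket (\<lambda>y. op_poly p (F y)) F y X Y = 0" for X Y
    by (subst nij_bracket_swap) simp
qed

section \<open>Constancy of the spectrum\<close>

lemma op_field_power:
  fixes F :: "'e::euclidean_space \<Rightarrow> 'd::euclidean_space \<Rightarrow> 'd"
  assumes "open W" "op_field W F"
  shows "op_field W (\<lambda>y. F y ^^ k)"
proof (induction k)
  case 0
  have "op_field W (\<lambda>(y::'e) (x::'d). x)" by (rule op_field_const[OF linear_ident])
  then show ?case by (rule op_field_cong[OF assms(1)]) simp
next
  case (Suc k)
  show ?case by (rule op_field_cong[OF assms(1) op_field_comp[OF assms Suc]]) simp
qed

lemma op_trace_has_derivative:
  assumes "op_field W F" "y \<in> W"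
  shows "((\<lambda>z. op_trace (F z)) has_derivative (\<lambda>v. op_trace (op_deriv F y v))) (at y)"
  unfolding op_trace_def
  by (intro has_derivative_sum has_derivative_inner_left op_deriv_has_derivative[OF assms])

text \<open>The derivative of \<open>F\<^sup>k\<^sup>+\<^sup>1\<close> is the sum of the \<open>F\<^sup>i (D F) F\<^sup>k\<^sup>-\<^sup>i\<close>, all of which have the same trace. The
  extra factor \<open>F\<^sup>j\<close> is there for the induction on \<open>k\<close>.\<close>

lemma op_trace_deriv_power:
  assumes "open W" "op_field W F" "y \<in> W"
  shows "op_trace (\<lambda>x. (F y ^^ j) (op_deriv (\<lambda>z. F z ^^ Suc k) y v x)) =
    real (Suc k) * op_trace (\<lambda>x. (F y ^^ (j + k)) (op_deriv F y v x))"
proof (induction k arbitrary: j)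
  case 0
  have "(\<lambda>z. F z ^^ Suc 0) = F" by (simp add: fun_eq_iff)
  then show ?case by simp
next
  case (Suc k)
  note pw = op_field_power[OF assms(1,2)]
  have pl: "linear (F y ^^ i)" for i by (rule op_field_linear[OF pw assms(3)])
  have D: "linear (op_deriv F y v)" by (rule op_deriv_linear_right[OF assms])
  have "op_deriv (\<lambda>z. F z ^^ Suc (Suc k)) y v x =
      op_deriv F y v ((F y ^^ Suc k) x) + F y (op_deriv (\<lambda>z. F z ^^ Suc k) y v x)" for x
    unfolding op_deriv_comp[OF assms(1,2) pw assms(3), symmetric] by (simp add: comp_def)
  then have "op_trace (\<lambda>x. (F y ^^ j) (op_deriv (\<lambda>z. F z ^^ Suc (Suc k)) y v x)) =
      op_trace (\<lambda>x. ((F y ^^ j) \<circ> op_deriv F y v) ((F y ^^ Suc k) x)) +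
      op_trace (\<lambda>x. (F y ^^ Suc j) (op_deriv (\<lambda>z. F z ^^ Suc k) y v x))"
    by (simp add: linear_add[OF pl] op_trace_add funpow_swap1)
  also have "op_trace (\<lambda>x. ((F y ^^ j) \<circ> op_deriv F y v) ((F y ^^ Suc k) x)) =
      op_trace (\<lambda>x. (F y ^^ Suc k) (((F y ^^ j) \<circ> op_deriv F y v) x))"
    by (rule op_trace_commute[OF linear_compose[OF D pl] pl])
  also have "\<dots> = op_trace (\<lambda>x. (F y ^^ (j + Suc k)) (op_deriv F y v x))"
    by (simp only: add.commute[of j] funpow_add comp_apply)
  also have "op_trace (\<lambda>x. (F y ^^ Suc j) (op_deriv (\<lambda>z. F z ^^ Suc k) y v x)) =
      real (Suc k) * op_trace (\<lambda>x. (F y ^^ (j + Suc k)) (op_deriv F y v x))"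
    using Suc[of "Suc j"] by (simp only: add_Suc add_Suc_right)
  finally show ?case by (simp add: algebra_simps del: funpow.simps)
qed

text \<open>The Nijenhuis condition says that \<open>D\<^sub>F\<^sub>v F - F D\<^sub>v F = M F - F M\<close> with \<open>M x = (D\<^sub>x F) v\<close>, and the
  trace of a commutator with \<open>F\<close> against a power of \<open>F\<close> vanishes.\<close>

lemma nijenhuis_trace_recursion:
  assumes "open W" "op_field W F" "y \<in> W" "\<And>X Y. nij_bracket F F y X Y = 0"
  shows "op_trace (\<lambda>x. (F y ^^ k) (op_deriv F y (F y v) x)) = op_trace (\<lambda>x. (F y ^^ Suc k) (op_deriv F y v x))"
proof -
  let ?M = "\<lambda>x. op_deriv F y x v"
  have M: "linear ?M" by (rule op_deriv_linear_left[OF assms(2,3)])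
  have F: "linear (F y)" by (rule op_field_linear[OF assms(2,3)])
  have pl: "linear (F y ^^ k)" by (rule op_field_linear[OF op_field_power[OF assms(1,2)] assms(3)])
  have "op_deriv F y (F y v) x = ?M (F y x) + F y (op_deriv F y v x) - F y (?M x)" for x
    using assms(4)[of v x] by (simp add: nij_bracket_def algebra_simps)
  then have "op_trace (\<lambda>x. (F y ^^ k) (op_deriv F y (F y v) x)) =
      op_trace (\<lambda>x. ((F y ^^ k) \<circ> ?M) (F y x)) + op_trace (\<lambda>x. (F y ^^ Suc k) (op_deriv F y v x))
      - op_trace (\<lambda>x. F y (((F y ^^ k) \<circ> ?M) x))"
    by (simp add: linear_add[OF pl] linear_diff[OF pl] op_trace_add op_trace_diff funpow_swap1)
  then show ?thesis using op_trace_commute[OF linear_compose[OF M pl] F] by simp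
qed

text \<open>With \<open>d\<^sub>k X = tr (F\<^sup>k D\<^sub>X F)\<close>, which is \<open>d tr F\<^sup>k\<^sup>+\<^sup>1 / (k + 1)\<close>, the recursion reads
  \<open>d\<^sub>k\<^sub>+\<^sub>1 X = d\<^sub>k (F X)\<close>. It starts at \<open>d\<^sub>0 = d tr F = 0\<close>.\<close>

lemma nijenhuis_trace_constant:
  assumes "open W" "op_field W F" "\<And>y X Y. y \<in> W \<Longrightarrow> nij_bracket F F y X Y = 0"
    and tr: "\<And>y. y \<in> W \<Longrightarrow> op_trace (F y) = 0"
    and "convex V" "V \<subseteq> W"
  shows "\<exists>c. \<forall>y\<in>V. op_trace (\<lambda>x. (F y ^^ j) (op_poly p (F y) x)) = c"
proof (induction p arbitrary: j)
  case 0
  have "(F y ^^ j) 0 = 0" if "y \<in> V" for y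
    using linear_0[OF op_field_linear[OF op_field_power[OF assms(1,2)]]] that assms(6) by blast
  then show ?case by (intro exI[of _ 0]) (simp add: op_trace_def)
next
  case (pCons a p)
  have z: "op_trace (\<lambda>x. (F y ^^ k) (op_deriv F y v x)) = 0" if y: "y \<in> W" for y k v
  proof (induction k arbitrary: v)
    case 0
    have "((\<lambda>z. op_trace (F z)) has_derivative (\<lambda>v. 0)) (at y)"
      by (rule has_derivative_transform_within_open[OF has_derivative_const assms(1) y]) (simp add: tr)
    then show ?case
      using has_derivative_unique[OF op_trace_has_derivative[OF assms(2) y]] by (simp add: fun_eq_iff)
  next
    case (Suc k)
    then show ?case
      using nijenhuis_trace_recursion[OF assms(1,2) y assms(3)[OF y], of k v] by simp
  qed
  have "\<exists>c. \<forall>y\<in>V. op_trace (F y ^^ j) = c"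
  proof (cases j)
    case 0
    then show ?thesis by auto
  next
    case (Suc k)
    show ?thesis
    proof (rule has_derivative_zero_constant[OF assms(5)])
      fix y assume "y \<in> V"
      then have y: "y \<in> W" using assms(6) by blast
      have "((\<lambda>z. op_trace (F z ^^ j)) has_derivative (\<lambda>v. op_trace (op_deriv (\<lambda>z. F z ^^ j) y v))) (at y)"
        by (rule op_trace_has_derivative[OF op_field_power[OF assms(1,2)] y])
      then show "((\<lambda>z. op_trace (F z ^^ j)) has_derivative (\<lambda>v. 0)) (at y within V)"
        using op_trace_deriv_power[OF assms(1,2) y, of 0 k] z[OF y]
        by (simp add: Suc has_derivative_at_withinI del: funpow.simps(2))
    qed
  qed
  then obtain c where c: "\<And>y. y \<in> V \<Longrightarrow> op_trace (F y ^^ j) = c" by blast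
  obtain d where d: "\<And>y. y \<in> V \<Longrightarrow> op_trace (\<lambda>x. (F y ^^ Suc j) (op_poly p (F y) x)) = d"
    using pCons(2) by blast
  have "op_trace (\<lambda>x. (F y ^^ j) (op_poly (pCons a p) (F y) x)) = a * c + d" if y: "y \<in> V" for y
  proof -
    have yW: "y \<in> W" using y assms(6) by blast
    have pl: "linear (F y ^^ j)" by (rule op_field_linear[OF op_field_power[OF assms(1,2)] yW])
    show ?thesis
      using c[OF y] d[OF y]
      by (simp add: op_field_linear[OF assms(2) yW] linear_add[OF pl] linear_cmul[OF pl] op_trace_add
          op_trace_scale funpow_swap1)
  qed
  then show ?case by blast
qed

section \<open>Closed forms and compatible Nijenhuis projections\<close>

definition form_field :: "'e::euclidean_space set \<Rightarrow> ('e \<Rightarrow> 'e \<Rightarrow> 'e \<Rightarrow> real) \<Rightarrow> bool" where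
  "form_field W K \<longleftrightarrow> (\<forall>y\<in>W. bilinear (K y)) \<and> (\<forall>v w. smooth_on W (\<lambda>y. K y v w))"

definition form_deriv :: "('e::euclidean_space \<Rightarrow> 'e \<Rightarrow> 'e \<Rightarrow> real) \<Rightarrow> 'e \<Rightarrow> 'e \<Rightarrow> 'e \<Rightarrow> 'e \<Rightarrow> real" where
  "form_deriv K y u v w = frechet_derivative (\<lambda>z. K z v w) (at y) u"

text \<open>The exterior derivative, on constant vector fields.\<close>

definition form_ext :: "('e::euclidean_space \<Rightarrow> 'e \<Rightarrow> 'e \<Rightarrow> real) \<Rightarrow> 'e \<Rightarrow> 'e \<Rightarrow> 'e \<Rightarrow> 'e \<Rightarrow> real" where
  "form_ext K y u v w = form_deriv K y u v w - form_deriv K y v u w + form_deriv K y w u v"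

lemma form_field_bilinear: "form_field W K \<Longrightarrow> y \<in> W \<Longrightarrow> bilinear (K y)"
  by (simp add: form_field_def)

lemma form_field_left: "form_field W K \<Longrightarrow> op_field W (\<lambda>y v. K y v w)"
  by (simp add: form_field_def op_field_def bilinear_def)

lemma form_field_right: "form_field W K \<Longrightarrow> op_field W (\<lambda>y w. K y v w)"
  by (simp add: form_field_def op_field_def bilinear_def)

lemma form_fieldI:
  assumes "\<And>v. op_field W (\<lambda>y w. K y v w)" "\<And>w. op_field W (\<lambda>y v. K y v w)"
  shows "form_field W K"
  using assms by (simp add: form_field_def op_field_def bilinear_def)

lemma form_deriv_left: "form_deriv K y u v w = op_deriv (\<lambda>y v. K y v w) y u v"
  by (simp add: form_deriv_def op_deriv_def)

lemma form_deriv_right: "form_deriv K y u v w = op_deriv (\<lambda>y w. K y v w) y u w"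
  by (simp add: form_deriv_def op_deriv_def)

lemma form_field_comp_left:
  assumes "open W" "form_field W K" "op_field W A"
  shows "form_field W (\<lambda>y v w. K y (A y v) w)"
proof (rule form_fieldI)
  show "op_field W (\<lambda>y v. K y (A y v) w)" for w
    by (rule op_field_comp[OF assms(1) form_field_left[OF assms(2)] assms(3)])
  then have sm: "smooth_on W (\<lambda>y. K y (A y v) w)" for v w by (rule op_field_smooth)
  show "op_field W (\<lambda>y w. K y (A y v) w)" for v
    using sm assms(2) by (simp add: op_field_def form_field_def bilinear_def)
qed

lemma form_deriv_comp_left:
  assumes "open W" "form_field W K" "op_field W A" "y \<in> W"
  shows "form_deriv (\<lambda>y v w. K y (A y v) w) y u v w =
    form_deriv K y u (A y v) w + K y (op_deriv A y u v) w"
  unfolding form_deriv_left by (rule op_deriv_comp[OF assms(1) form_field_left[OF assms(2)] assms(3,4)])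

lemma form_deriv_comp_right:
  assumes "open W" "form_field W K" "op_field W A" "y \<in> W"
  shows "form_deriv (\<lambda>y v w. K y v (A y w)) y u v w =
    form_deriv K y u v (A y w) + K y v (op_deriv A y u w)"
  unfolding form_deriv_right by (rule op_deriv_comp[OF assms(1) form_field_right[OF assms(2)] assms(3,4)])

lemma form_deriv_cong:
  assumes "open W" "form_field W K" "y \<in> W" "\<And>y v w. y \<in> W \<Longrightarrow> K y v w = L y v w"
  shows "form_deriv K y u v w = form_deriv L y u v w"
  unfolding form_deriv_left by (rule op_deriv_cong[OF assms(1) form_field_left[OF assms(2)] assms(3,4)])

lemma form_ext_cong:
  assumes "open W" "form_field W K" "y \<in> W" "\<And>y v w. y \<in> W \<Longrightarrow> K y v w = L y v w"
  shows "form_ext K y u v w = form_ext L y u v w"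
  by (simp only: form_ext_def form_deriv_cong[of W K y L, OF assms])

text \<open>The identity of bihamiltonian geometry relating the exterior derivatives of \<open>K\<close>, \<open>K(A\<cdot>,\<cdot>)\<close> and
  \<open>K(A\<^sup>2\<cdot>,\<cdot>)\<close> to the Nijenhuis tensor of a \<open>K\<close>-symmetric field \<open>A\<close>.\<close>

lemma form_ext_nijenhuis:
  assumes "open W" "form_field W K" "op_field W A" "y \<in> W"
    and sym: "\<And>y v w. y \<in> W \<Longrightarrow> K y (A y v) w = K y v (A y w)"
  shows "K y (nij_bracket A A y X Y) Z =
    form_ext (\<lambda>y v w. K y (A y v) w) y (A y X) Y Z + form_ext (\<lambda>y v w. K y (A y v) w) y X (A y Y) Z
    - form_ext K y (A y X) (A y Y) Z - form_ext (\<lambda>y v w. K y (A y (A y v)) w) y X Y Z"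
proof -
  note AA = op_field_comp[OF assms(1,3,3)]
  note d1 = form_deriv_comp_left[OF assms(1-4)]
  note d2 = form_deriv_comp_left[OF assms(1,2) AA assms(4)]
  have "form_deriv (\<lambda>y v w. K y (A y v) w) y u v w = form_deriv (\<lambda>y v w. K y v (A y w)) y u v w" for u v w
    by (rule form_deriv_cong[OF assms(1) form_field_comp_left[OF assms(1-3)] assms(4) sym])
  then have s: "form_deriv K y u (A y v) w + K y (op_deriv A y u v) w =
      form_deriv K y u v (A y w) + K y v (op_deriv A y u w)" for u v w
    by (simp add: d1 form_deriv_comp_right[OF assms(1-4)])
  have B: "bilinear (K y)" by (rule form_field_bilinear[OF assms(2,4)])
  show ?thesis
    \<comment> \<open>All derivatives of \<open>K\<close> cancel; the terms with a derivative of \<open>A\<close> in the direction \<open>Z\<close> cancel by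
      the derivative of the symmetry relation.\<close>
    using s[of Z X Y] sym[OF assms(4), of "op_deriv A y Z X" Y]
    by (simp add: form_ext_def d1 d2 op_deriv_comp[OF assms(1,3,3,4)] nij_bracket_def
        bilinear_ladd[OF B] bilinear_lsub[OF B] sym[OF assms(4), symmetric])
qed

text \<open>For a projection \<open>P\<close>, the preceding identity reads
  \<open>T(X, Y, Z) = T(P X, Y, Z) + T(X, P Y, Z)\<close> for the alternating form \<open>T = d K(P\<cdot>,\<cdot>)\<close>. By symmetry
  \<open>T(X, Y, Z) = 2 T(P X, Y, Z)\<close>, and replacing \<open>X\<close> by \<open>P X\<close> gives \<open>T(P X, Y, Z) = 0\<close>.\<close>

lemma form_ext_projection:
  assumes "open W" "form_field W K" "op_field W P" "y \<in> W"
    and skew: "\<And>y v w. y \<in> W \<Longrightarrow> K y v w = - K y w v"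
    and sym: "\<And>y v w. y \<in> W \<Longrightarrow> K y (P y v) w = K y v (P y w)"
    and idem: "\<And>y x. y \<in> W \<Longrightarrow> P y (P y x) = P y x"
    and nij: "\<And>X Y. nij_bracket P P y X Y = 0"
    and closed: "\<And>u v w. form_ext K y u v w = 0"
  shows "form_ext (\<lambda>y v w. K y (P y v) w) y X Y Z = 0"
proof -
  let ?KP = "\<lambda>y v w. K y (P y v) w"
  let ?T = "form_ext ?KP y"
  note KP = form_field_comp_left[OF assms(1-3)]
  have B: "bilinear (K y)" by (rule form_field_bilinear[OF assms(2,4)])
  have sk: "form_deriv ?KP y u v w = - form_deriv ?KP y u w v" for u v w
  proof -
    have eq: "?KP y v w = - ?KP y w v" if "y \<in> W" for y v w
      using sym[OF that, of v w] skew[OF that, of v "P y w"] by simp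
    have "((\<lambda>z. - ?KP z w v) has_derivative (\<lambda>u. - form_deriv ?KP y u w v)) (at y)"
      unfolding form_deriv_left by (intro has_derivative_minus op_deriv_has_derivative[OF form_field_left[OF KP] assms(4)])
    then have "((\<lambda>z. ?KP z v w) has_derivative (\<lambda>u. - form_deriv ?KP y u w v)) (at y)"
      by (rule has_derivative_transform_within_open[OF _ assms(1,4)]) (simp add: eq[of _ v w])
    then show ?thesis unfolding form_deriv_left[of _ _ _ v] by (rule op_deriv_eqI)
  qed
  have T12: "?T u v w = - ?T v u w" for u v w using sk[of w u v] by (simp add: form_ext_def)
  have T23: "?T u v w = - ?T u w v" for u v w using sk[of u v w] by (simp add: form_ext_def)
  have T: "?T u v w = ?T (P y u) v w + ?T u (P y v) w" for u v w
  proof -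
    have "form_ext (\<lambda>y v w. K y (P y (P y v)) w) y u v w = ?T u v w"
      by (rule form_ext_cong[OF assms(1) form_field_comp_left[OF assms(1,2) op_field_comp[OF assms(1,3,3)]] assms(4)])
        (simp add: idem)
    then show ?thesis
      using form_ext_nijenhuis[of W K P y u v w, OF assms(1-4) sym] by (simp add: nij closed bilinear_lzero[OF B])
  qed
  have T2: "?T u v w = 2 * ?T (P y u) v w" for u v w
  proof -
    have "?T u v w = ?T (P y u) v w + ?T u v (P y w)"
      using T[of u w v] T23[of u v w] T23[of "P y u" v w] T23[of u v "P y w"] by simp
    moreover have "?T u v w = ?T u (P y v) w + ?T u v (P y w)"
      using T[of v w u] T12[of u v w] T23[of v u w] T12[of u "P y v" w] T23[of "P y v" u w]
        T12[of u v "P y w"] T23[of v u "P y w"] by simp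
    ultimately show ?thesis using T[of u v w] by simp
  qed
  have "?T (P y X) Y Z = 0" using T2[of "P y X" Y Z] by (simp add: idem[OF assms(4)])
  then show ?thesis using T2[of X Y Z] by simp
qed

lemma form_ext_sum:
  assumes "y \<in> W" "\<And>i. i \<in> I \<Longrightarrow> form_field W (K i)"
  shows "form_ext (\<lambda>y v w. \<Sum>i\<in>I. c i * K i y v w) y X Y Z = (\<Sum>i\<in>I. c i * form_ext (K i) y X Y Z)"
proof -
  have "form_deriv (\<lambda>y v w. \<Sum>i\<in>I. c i * K i y v w) y u v w = (\<Sum>i\<in>I. c i * form_deriv (K i) y u v w)" for u v w
    unfolding form_deriv_left
    by (rule op_deriv_eqI)
      (intro has_derivative_sum has_derivative_mult_right op_deriv_has_derivative[OF form_field_left[OF assms(2)] assms(1)])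
  then show ?thesis
    by (simp add: form_ext_def sum_subtractf sum.distrib algebra_simps)
qed

section \<open>Tangent vectors and tensor fields in a chart\<close>

lemma linearI_comb:
  fixes f :: "'u::real_vector \<Rightarrow> 'w::real_vector"
  assumes "\<And>a v b w. f (a *\<^sub>R v + b *\<^sub>R w) = a *\<^sub>R f v + b *\<^sub>R f w"
  shows "linear f"
  using assms[of 1 _ 1] assms[of _ _ 0 0] by (intro linearI) auto

locale manifold_atlas =
  fixes A :: "('a::{t2_space,second_countable_topology}, 'e::euclidean_space) chart set"
  assumes smooth_atlas: "smooth_atlas A"
begin

abbreviation chart_image :: "('a, 'e) chart \<Rightarrow> 'e set" where
  "chart_image c \<equiv> snd c ` fst c"

text \<open>The Jacobian of the change from the chart \<open>c\<close> to the chart \<open>d\<close>.\<close>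

abbreviation jac :: "('a, 'e) chart \<Rightarrow> ('a, 'e) chart \<Rightarrow> 'a \<Rightarrow> 'e \<Rightarrow> 'e" where
  "jac c d p \<equiv> frechet_derivative (transition c d) (at (snd c p))"

lemma chart_exists: "\<exists>c\<in>A. p \<in> fst c"
  using smooth_atlas unfolding smooth_atlas_def by blast

lemma chart_open: "c \<in> A \<Longrightarrow> open (fst c)"
  using smooth_atlas unfolding smooth_atlas_def by blast

lemma chart_homeomorphism: "c \<in> A \<Longrightarrow> homeomorphism (fst c) (chart_image c) (snd c) (chart_inv c)"
  using smooth_atlas unfolding smooth_atlas_def by blast

lemma chart_inv_chart [simp]: "c \<in> A \<Longrightarrow> p \<in> fst c \<Longrightarrow> chart_inv c (snd c p) = p"
  using chart_homeomorphism by (auto simp: homeomorphism_def)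

lemma open_chart_image: "c \<in> A \<Longrightarrow> open (chart_image c)"
  using smooth_atlas unfolding smooth_atlas_def by blast

lemma open_chart_image_Int:
  assumes "c \<in> A" "open U"
  shows "open (snd c ` (fst c \<inter> U))"
proof -
  have "snd c ` (fst c \<inter> U) = chart_image c \<inter> chart_inv c -` U"
    using assms(1) by (auto simp: image_iff)
  then show ?thesis
    using continuous_open_preimage[OF homeomorphism_cont2[OF chart_homeomorphism[OF assms(1)]]
        open_chart_image[OF assms(1)] assms(2)] by simp
qed

lemma transition_chart: "c \<in> A \<Longrightarrow> p \<in> fst c \<Longrightarrow> transition c d (snd c p) = snd d p"
  by (simp add: transition_def)

lemma transition_smooth: "c \<in> A \<Longrightarrow> d \<in> A \<Longrightarrow> smooth_on (snd c ` (fst c \<inter> fst d)) (transition c d)"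
  using smooth_atlas unfolding smooth_atlas_def by blast

lemma transition_has_derivative:
  assumes "c \<in> A" "d \<in> A" "p \<in> fst c" "p \<in> fst d"
  shows "(transition c d has_derivative jac c d p) (at (snd c p))"
  by (rule smooth_on_has_derivative[OF transition_smooth]) (use assms in auto)

lemma jac_linear:
  assumes "c \<in> A" "d \<in> A" "p \<in> fst c" "p \<in> fst d"
  shows "linear (jac c d p)"
  using transition_has_derivative[OF assms] by (rule has_derivative_linear)

lemma jac_chain:
  assumes "c \<in> A" "d \<in> A" "e \<in> A" "p \<in> fst c" "p \<in> fst d" "p \<in> fst e"
  shows "jac d e p (jac c d p v) = jac c e p v"
proof -
  have 1: "(transition c d has_derivative jac c d p) (at (snd c p))"
    by (rule transition_has_derivative) (use assms in auto)
  have 2: "(transition d e has_derivative jac d e p) (at (transition c d (snd c p)))"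
    using transition_has_derivative[of d e p] assms by (simp add: transition_chart)
  have "((\<lambda>y. transition d e (transition c d y)) has_derivative (\<lambda>v. jac d e p (jac c d p v))) (at (snd c p))"
    by (rule has_derivative_compose[OF 1 2])
  then have "(transition c e has_derivative (\<lambda>v. jac d e p (jac c d p v))) (at (snd c p))"
    by (rule has_derivative_transform_within_open[of _ _ _ _ "snd c ` (fst c \<inter> fst d)"])
      (use assms in \<open>auto simp: transition_chart open_chart_image_Int chart_open\<close>)
  then show ?thesis by (simp add: frechet_derivative_eqI)
qed

lemma jac_self:
  assumes "c \<in> A" "p \<in> fst c"
  shows "jac c c p v = v"
proof -
  have "(transition c c has_derivative (\<lambda>v. v)) (at (snd c p))"
    by (rule has_derivative_transform_within_open[OF has_derivative_ident open_chart_image[OF assms(1)]])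
      (use assms in \<open>auto simp: transition_chart\<close>)
  then show ?thesis by (simp add: frechet_derivative_eqI)
qed

lemma tangentD:
  assumes "x \<in> tangent_space A p" "c \<in> A" "d \<in> A" "p \<in> fst c" "p \<in> fst d"
  shows "x d = jac c d p (x c)"
  using assms unfolding tangent_space_def by blast

lemma tangent_outside:
  assumes "x \<in> tangent_space A p" "\<not> (c \<in> A \<and> p \<in> fst c)"
  shows "x c = 0"
  using assms unfolding tangent_space_def by blast

lemma tangentI:
  assumes "\<And>c. \<not> (c \<in> A \<and> p \<in> fst c) \<Longrightarrow> x c = 0"
    and "\<And>c d. c \<in> A \<Longrightarrow> d \<in> A \<Longrightarrow> p \<in> fst c \<Longrightarrow> p \<in> fst d \<Longrightarrow> x d = jac c d p (x c)"
  shows "x \<in> tangent_space A p"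
  using assms unfolding tangent_space_def by blast

lemma tangent_eqI:
  assumes "x \<in> tangent_space A p" "y \<in> tangent_space A p" "c \<in> A" "p \<in> fst c" "x c = y c"
  shows "x = y"
proof
  fix d
  show "x d = y d"
  proof (cases "d \<in> A \<and> p \<in> fst d")
    case True
    then show ?thesis using tangentD[OF assms(1) assms(3) _ assms(4)] tangentD[OF assms(2) assms(3) _ assms(4)] assms(5)
      by metis
  next
    case False
    then show ?thesis using tangent_outside assms(1,2) by metis
  qed
qed

lemma tcomb_tangent:
  assumes "x \<in> tangent_space A p" "y \<in> tangent_space A p"
  shows "tcomb a x b y \<in> tangent_space A p"
proof (rule tangentI)
  fix c assume c: "\<not> (c \<in> A \<and> p \<in> fst c)"
  show "tcomb a x b y c = 0"
    using tangent_outside[OF assms(1) c] tangent_outside[OF assms(2) c] by (simp add: tcomb_def)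
next
  fix c d assume cd: "c \<in> A" "d \<in> A" "p \<in> fst c" "p \<in> fst d"
  show "tcomb a x b y d = jac c d p (tcomb a x b y c)"
    using tangentD[OF assms(1) cd] tangentD[OF assms(2) cd] jac_linear[OF cd]
    by (simp add: tcomb_def linear_add linear_cmul)
qed

lemma coord_field_tangent:
  assumes "c \<in> A" "p \<in> fst c"
  shows "coord_field A c v p \<in> tangent_space A p"
proof (rule tangentI)
  fix d e assume "d \<in> A" "e \<in> A" "p \<in> fst d" "p \<in> fst e"
  then show "coord_field A c v p e = jac d e p (coord_field A c v p d)"
    using jac_chain[of c d e p v] assms by (simp add: coord_field_def)
qed (auto simp: coord_field_def)

lemma coord_field_self [simp]:
  assumes "c \<in> A" "p \<in> fst c"
  shows "coord_field A c v p c = v"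
  using assms by (simp add: coord_field_def jac_self)

text \<open>A tangent vector is determined by its component in one chart, so that component maps identify
  each tangent space with the model space.\<close>

lemma coord_field_component:
  assumes "c \<in> A" "p \<in> fst c" "x \<in> tangent_space A p"
  shows "coord_field A c (x c) p = x"
  using tangent_eqI[OF coord_field_tangent[OF assms(1,2)] assms(3,1,2)] assms by simp

lemma coord_field_tcomb:
  assumes "c \<in> A" "p \<in> fst c"
  shows "coord_field A c (a *\<^sub>R v + b *\<^sub>R w) p = tcomb a (coord_field A c v p) b (coord_field A c w p)"
  by (rule tangent_eqI[OF coord_field_tangent[OF assms] tcomb_tangent assms])
    (use assms coord_field_tangent in \<open>auto simp: tcomb_def\<close>)

text \<open>The matrix of an endomorphism field in a chart, as an operator on components.\<close>

definition rep :: "('a \<Rightarrow> ('a, 'e) tvec \<Rightarrow> ('a, 'e) tvec) \<Rightarrow> ('a, 'e) chart \<Rightarrow> 'e \<Rightarrow> 'e \<Rightarrow> 'e" where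
  "rep S c y v = S (chart_inv c y) (coord_field A c v (chart_inv c y)) c"

lemma tangent_endoD:
  assumes "tangent_endo A p L"
  shows "x \<in> tangent_space A p \<Longrightarrow> L x \<in> tangent_space A p"
    and "x \<in> tangent_space A p \<Longrightarrow> y \<in> tangent_space A p \<Longrightarrow> L (tcomb a x b y) = tcomb a (L x) b (L y)"
  using assms unfolding tangent_endo_def by blast+

lemma linear_component:
  assumes "tangent_endo A p L" "c \<in> A" "p \<in> fst c"
  shows "linear (\<lambda>v. L (coord_field A c v p) c)"
proof (rule linearI_comb)
  fix a b :: real and v w :: 'e
  show "L (coord_field A c (a *\<^sub>R v + b *\<^sub>R w) p) c =
      a *\<^sub>R L (coord_field A c v p) c + b *\<^sub>R L (coord_field A c w p) c"
    by (simp add: coord_field_tcomb[OF assms(2,3)] tangent_endoD(2)[OF assms(1)]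
        coord_field_tangent[OF assms(2,3)]) (simp add: tcomb_def)
qed

lemma rep_op_field:
  assumes "endo_field A S" "c \<in> A"
  shows "op_field (chart_image c) (rep S c)"
  unfolding op_field_def
proof (intro conjI ballI allI)
  fix y assume "y \<in> chart_image c"
  then obtain p where p: "p \<in> fst c" "y = snd c p" by blast
  have "tangent_endo A p (S p)" using assms(1) unfolding endo_field_def by blast
  from linear_component[OF this assms(2) p(1)] show "linear (rep S c y)"
    using p assms(2) by (simp add: rep_def[abs_def])
next
  fix v
  show "smooth_on (chart_image c) (\<lambda>y. rep S c y v)"
    using assms unfolding endo_field_def rep_def by blast
qed

lemma rep_component:
  assumes "c \<in> A" "p \<in> fst c" "x \<in> tangent_space A p"
  shows "S p x c = rep S c (snd c p) (x c)"
  using assms by (simp add: rep_def coord_field_component)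

lemma form_comp_component:
  assumes "c \<in> A" "p \<in> fst c" "x \<in> tangent_space A p" "y \<in> tangent_space A p"
  shows "B p x y = form_comp A B c (x c) (y c) (snd c p)"
  using assms by (simp add: form_comp_def coord_field_component)

lemma form_comp_form_field:
  assumes "bilinear_field A B" "c \<in> A"
  shows "form_field (chart_image c) (\<lambda>y v w. form_comp A B c v w y)"
  unfolding form_field_def
proof (intro conjI ballI allI)
  fix y assume "y \<in> chart_image c"
  then obtain p where p: "p \<in> fst c" "y = snd c p" by blast
  have B: "B p (tcomb a x b y) z = a * B p x z + b * B p y z"
    "B p z (tcomb a x b y) = a * B p z x + b * B p z y"
    if "x \<in> tangent_space A p" "y \<in> tangent_space A p" "z \<in> tangent_space A p" for x y z a b
    using assms(1) that unfolding bilinear_field_def by blast+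
  note T = coord_field_tangent[OF assms(2) p(1)]
  show "bilinear (\<lambda>v w. form_comp A B c v w y)"
    unfolding bilinear_def form_comp_def
    using assms(2) p(1)
    by (auto intro!: linearI_comb simp: p(2) coord_field_tcomb[OF assms(2) p(1)] B T)
next
  fix v w
  show "smooth_on (chart_image c) (\<lambda>y. form_comp A B c v w y)"
    using assms unfolding bilinear_field_def by simp
qed

section \<open>Lie brackets and Nijenhuis tensors in a chart\<close>

lemma vector_field_tangent: "vector_field_on A U X \<Longrightarrow> p \<in> U \<Longrightarrow> X p \<in> tangent_space A p"
  unfolding vector_field_on_def by blast

lemma vector_field_smooth:
  "vector_field_on A U X \<Longrightarrow> c \<in> A \<Longrightarrow> smooth_on (snd c ` (fst c \<inter> U)) (\<lambda>y. X (chart_inv c y) c)"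
  unfolding vector_field_on_def by blast

abbreviation vf_deriv :: "('a \<Rightarrow> ('a, 'e) tvec) \<Rightarrow> ('a, 'e) chart \<Rightarrow> 'a \<Rightarrow> 'e \<Rightarrow> 'e" where
  "vf_deriv X c p \<equiv> frechet_derivative (\<lambda>y. X (chart_inv c y) c) (at (snd c p))"

lemma vf_has_derivative:
  assumes "vector_field_on A U X" "c \<in> A" "p \<in> fst c" "p \<in> U"
  shows "((\<lambda>y. X (chart_inv c y) c) has_derivative vf_deriv X c p) (at (snd c p))"
  by (rule smooth_on_has_derivative[OF vector_field_smooth[OF assms(1,2)]]) (use assms in auto)

lemma lie_bracket_component:
  "c \<in> A \<Longrightarrow> p \<in> fst c \<Longrightarrow> lie_bracket A X Y p c = vf_deriv Y c p (X p c) - vf_deriv X c p (Y p c)"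
  by (simp add: lie_bracket_def)

text \<open>Differentiating the transformation law of the components of \<open>X\<close> produces a second derivative of
  the transition map, which is symmetric and therefore cancels in the bracket.\<close>

lemma vf_deriv_transition:
  assumes "open U" "vector_field_on A U X" "c \<in> A" "d \<in> A" "p \<in> fst c" "p \<in> fst d" "p \<in> U"
  shows "vf_deriv X d p (jac c d p v) =
    op_deriv (\<lambda>y. frechet_derivative (transition c d) (at y)) (snd c p) v (X p c) + jac c d p (vf_deriv X c p v)"
proof -
  let ?W = "snd c ` (fst c \<inter> (fst d \<inter> U))"
  let ?\<Phi> = "\<lambda>y. frechet_derivative (transition c d) (at y)"
  have W: "open ?W" by (intro open_chart_image_Int open_Int chart_open assms)
  have pW: "snd c p \<in> ?W" using assms by blast
  have \<Phi>: "op_field ?W ?\<Phi>"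
    unfolding op_field_def
  proof (intro conjI ballI allI)
    show "linear (?\<Phi> y)" if "y \<in> ?W" for y
      using that jac_linear[OF assms(3,4)] by auto
    show "smooth_on ?W (\<lambda>y. ?\<Phi> y w)" for w
      by (rule smooth_on_subset[OF smooth_on_frechet[OF transition_smooth[OF assms(3,4)]]]) auto
  qed
  have "((\<lambda>y. ?\<Phi> y (X (chart_inv c y) c)) has_derivative
      (\<lambda>v. op_deriv ?\<Phi> (snd c p) v (X (chart_inv c (snd c p)) c) + ?\<Phi> (snd c p) (vf_deriv X c p v))) (at (snd c p))"
    by (rule has_derivative_apply[OF W \<Phi> pW vf_has_derivative[OF assms(2,3,5,7)]])
  then have 1: "((\<lambda>y. X (chart_inv d (transition c d y)) d) has_derivative
      (\<lambda>v. op_deriv ?\<Phi> (snd c p) v (X p c) + ?\<Phi> (snd c p) (vf_deriv X c p v))) (at (snd c p))"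
    unfolding chart_inv_chart[OF assms(3,5)]
  proof (rule has_derivative_transform_within_open[OF _ W pW])
    fix y assume "y \<in> ?W"
    then obtain q where q: "q \<in> fst c" "q \<in> fst d" "q \<in> U" "y = snd c q" by blast
    show "?\<Phi> y (X (chart_inv c y) c) = X (chart_inv d (transition c d y)) d"
      using tangentD[OF vector_field_tangent[OF assms(2) q(3)] assms(3,4) q(1,2)] q assms(3,4)
      by (simp add: transition_chart)
  qed
  have td: "(transition c d has_derivative jac c d p) (at (snd c p))"
    by (rule transition_has_derivative) fact+
  have "((\<lambda>y. X (chart_inv d y) d) has_derivative vf_deriv X d p) (at (transition c d (snd c p)))"
    using vf_has_derivative[OF assms(2,4,6,7)] by (simp add: transition_chart[OF assms(3,5)])
  from has_derivative_unique[OF has_derivative_compose[OF td this] 1]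
  show ?thesis by (simp add: fun_eq_iff)
qed

text \<open>An endomorphism of a tangent space is known on tangent vectors only, so that the Nijenhuis tensor
  can be computed in a chart only once the brackets in it are tangent vectors.\<close>

lemma lie_bracket_tangent:
  assumes "open U" "vector_field_on A U X" "vector_field_on A U Y" "p \<in> U"
  shows "lie_bracket A X Y p \<in> tangent_space A p"
proof (rule tangentI)
  fix c assume "\<not> (c \<in> A \<and> p \<in> fst c)"
  then show "lie_bracket A X Y p c = 0" by (auto simp: lie_bracket_def)
next
  fix c d assume cd: "c \<in> A" "d \<in> A" "p \<in> fst c" "p \<in> fst d"
  let ?\<Phi> = "\<lambda>y. frechet_derivative (transition c d) (at y)"
  have sym: "op_deriv ?\<Phi> (snd c p) v w = op_deriv ?\<Phi> (snd c p) w v" for v w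
    unfolding op_deriv_def
    by (rule second_derivative_symmetric[OF open_chart_image_Int[OF cd(1) chart_open[OF cd(2)]]
          transition_smooth[OF cd(1,2)]]) (use cd in auto)
  note tX = tangentD[OF vector_field_tangent[OF assms(2,4)] cd]
  note tY = tangentD[OF vector_field_tangent[OF assms(3,4)] cd]
  show "lie_bracket A X Y p d = jac c d p (lie_bracket A X Y p c)"
    using sym[of "X p c" "Y p c"]
    by (simp add: lie_bracket_component cd tX tY vf_deriv_transition[OF assms(1,2) cd assms(4)]
        vf_deriv_transition[OF assms(1,3) cd assms(4)] linear_diff[OF jac_linear[OF cd]])
qed

lemma endo_field_tangent_endo: "endo_field A S \<Longrightarrow> tangent_endo A p (S p)"
  unfolding endo_field_def by blast

lemma vector_field_endo:
  assumes "open U" "vector_field_on A U X" "endo_field A S"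
  shows "vector_field_on A U (\<lambda>q. S q (X q))"
  unfolding vector_field_on_def
proof (intro conjI ballI)
  show "S p (X p) \<in> tangent_space A p" if "p \<in> U" for p
    by (rule tangent_endoD(1)[OF endo_field_tangent_endo[OF assms(3)] vector_field_tangent[OF assms(2) that]])
  fix c assume c: "c \<in> A"
  have W: "open (snd c ` (fst c \<inter> U))" by (rule open_chart_image_Int[OF c assms(1)])
  have F: "op_field (snd c ` (fst c \<inter> U)) (rep S c)"
    by (rule op_field_subset[OF rep_op_field[OF assms(3) c]]) auto
  show "smooth_on (snd c ` (fst c \<inter> U)) (\<lambda>y. S (chart_inv c y) (X (chart_inv c y)) c)"
  proof (rule smooth_on_cong[OF W _ smooth_on_apply[OF W F vector_field_smooth[OF assms(2) c]]])
    fix y assume "y \<in> snd c ` (fst c \<inter> U)"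
    then obtain q where q: "q \<in> fst c" "q \<in> U" "y = snd c q" by blast
    show "rep S c y (X (chart_inv c y) c) = S (chart_inv c y) (X (chart_inv c y)) c"
      using rep_component[OF c q(1) vector_field_tangent[OF assms(2) q(2)], of S] q c by simp
  qed
qed

text \<open>The coordinate fields are the test fields that recover, from the vanishing of the Nijenhuis
  tensor, the identity for matrices in the chart.\<close>

lemma coord_field_vector_field:
  assumes "c \<in> A"
  shows "vector_field_on A (fst c) (coord_field A c v)"
  unfolding vector_field_on_def
proof (intro conjI ballI)
  show "coord_field A c v p \<in> tangent_space A p" if "p \<in> fst c" for p
    by (rule coord_field_tangent[OF assms that])
  fix d assume d: "d \<in> A"
  have W: "open (snd d ` (fst d \<inter> fst c))" and V: "open (snd c ` (fst c \<inter> fst d))"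
    by (intro open_chart_image_Int chart_open d assms)+
  have sub: "transition d c ` (snd d ` (fst d \<inter> fst c)) \<subseteq> snd c ` (fst c \<inter> fst d)"
    using d by (auto simp: transition_chart)
  show "smooth_on (snd d ` (fst d \<inter> fst c)) (\<lambda>y. coord_field A c v (chart_inv d y) d)"
  proof (rule smooth_on_cong[OF W _ smooth_on_compose[OF W V sub
          smooth_on_frechet[OF transition_smooth[OF assms d]] transition_smooth[OF d assms]]])
    fix y assume "y \<in> snd d ` (fst d \<inter> fst c)"
    then show "frechet_derivative (transition c d) (at (transition d c y)) v = coord_field A c v (chart_inv d y) d"
      using d by (auto simp: coord_field_def transition_chart)
  qed
qed

text \<open>The Nijenhuis tensor is tensorial: the derivatives of the components of \<open>X\<close> and \<open>Y\<close> cancel.\<close>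

lemma nijenhuis_component:
  assumes "open U" "vector_field_on A U X" "vector_field_on A U Y" "endo_field A S"
    and "p \<in> U" "c \<in> A" "p \<in> fst c"
  shows "nijenhuis A S X Y p c = nij_bracket (rep S c) (rep S c) (snd c p) (X p c) (Y p c)"
proof -
  let ?F = "rep S c"
  let ?y = "snd c p"
  let ?SX = "\<lambda>q. S q (X q)" and ?SY = "\<lambda>q. S q (Y q)"
  note SX = vector_field_endo[OF assms(1,2,4)] and SY = vector_field_endo[OF assms(1,3,4)]
  have y: "?y \<in> chart_image c" using assms by blast
  note F = rep_op_field[OF assms(4,6)]
  have lin: "linear (?F ?y)" by (rule op_field_linear[OF F y])
  have comp: "S p x c = ?F ?y (x c)" if "x \<in> tangent_space A p" for x
    by (rule rep_component[OF assms(6,7) that])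
  have deriv: "vf_deriv (\<lambda>q. S q (Z q)) c p v = op_deriv ?F ?y v (Z p c) + ?F ?y (vf_deriv Z c p v)"
    if Z: "vector_field_on A U Z" for Z v
  proof -
    have "((\<lambda>z. ?F z (Z (chart_inv c z) c)) has_derivative
        (\<lambda>v. op_deriv ?F ?y v (Z (chart_inv c ?y) c) + ?F ?y (vf_deriv Z c p v))) (at ?y)"
      by (rule has_derivative_apply[OF open_chart_image[OF assms(6)] F y vf_has_derivative[OF Z assms(6,7,5)]])
    then have "((\<lambda>z. S (chart_inv c z) (Z (chart_inv c z)) c) has_derivative
        (\<lambda>v. op_deriv ?F ?y v (Z (chart_inv c ?y) c) + ?F ?y (vf_deriv Z c p v))) (at ?y)"
    proof (rule has_derivative_transform_within_open[OF _ open_chart_image_Int[OF assms(6,1)]])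
      show "?y \<in> snd c ` (fst c \<inter> U)" using assms by blast
      fix z assume "z \<in> snd c ` (fst c \<inter> U)"
      then obtain q where q: "q \<in> fst c" "q \<in> U" "z = snd c q" by blast
      show "?F z (Z (chart_inv c z) c) = S (chart_inv c z) (Z (chart_inv c z)) c"
        using rep_component[OF assms(6) q(1) vector_field_tangent[OF Z q(2)], of S] q assms(6) by simp
    qed
    then show ?thesis using assms(6,7) by (simp add: frechet_derivative_eqI)
  qed
  have T: "X p \<in> tangent_space A p" "Y p \<in> tangent_space A p"
    using vector_field_tangent assms by blast+
  note B = lie_bracket_tangent[OF assms(1) _ _ assms(5)]
  have SB: "S p (lie_bracket A X Y p) \<in> tangent_space A p"
    by (rule tangent_endoD(1)[OF endo_field_tangent_endo[OF assms(4)] B[OF assms(2,3)]])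
  show ?thesis
    unfolding nijenhuis_def Let_def nij_bracket_def
    by (simp add: comp[OF SB] comp[OF B[OF assms(2,3)]] comp[OF B[OF SX assms(3)]] comp[OF B[OF assms(2) SY]]
        comp[OF T(1)] comp[OF T(2)] lie_bracket_component[OF assms(6,7)] deriv[OF assms(2)] deriv[OF assms(3)]
        linear_diff[OF lin] linear_add[OF lin])
qed

lemma nijenhuis_zero_iff:
  assumes "endo_field A S"
  shows "nijenhuis_zero A S \<longleftrightarrow>
    (\<forall>c\<in>A. \<forall>y\<in>chart_image c. \<forall>v w. nij_bracket (rep S c) (rep S c) y v w = 0)"
proof (intro iffI ballI allI)
  fix c y v w assume nz: "nijenhuis_zero A S" and c: "c \<in> A" and "y \<in> chart_image c"
  then obtain p where p: "p \<in> fst c" "y = snd c p" by blast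
  note vf = coord_field_vector_field[OF c]
  have "nijenhuis A S (coord_field A c v) (coord_field A c w) p = tzero"
    using nz vf chart_open[OF c] p(1) unfolding nijenhuis_zero_def by blast
  then show "nij_bracket (rep S c) (rep S c) y v w = 0"
    using nijenhuis_component[OF chart_open[OF c] vf vf assms p(1) c p(1), of v w] c p
    by (simp add: tzero_def)
next
  assume loc: "\<forall>c\<in>A. \<forall>y\<in>chart_image c. \<forall>v w. nij_bracket (rep S c) (rep S c) y v w = 0"
  show "nijenhuis_zero A S"
    unfolding nijenhuis_zero_def
  proof (intro allI impI ballI, elim conjE)
    fix U X Y p
    assume U: "open U" and X: "vector_field_on A U X" and Y: "vector_field_on A U Y" and p: "p \<in> U"
    note SX = vector_field_endo[OF U X assms] and SY = vector_field_endo[OF U Y assms]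
    note B = lie_bracket_tangent[OF U _ _ p]
    note E = tangent_endoD(1)[OF endo_field_tangent_endo[OF assms]]
    show "nijenhuis A S X Y p = tzero"
    proof
      fix c
      show "nijenhuis A S X Y p c = tzero c"
      proof (cases "c \<in> A \<and> p \<in> fst c")
        case True
        then show ?thesis
          using nijenhuis_component[OF U X Y assms p] loc by (simp add: tzero_def)
      next
        case False
        have "x c = 0" if "x \<in> tangent_space A p" for x using tangent_outside that False by blast
        from this[OF B[OF SX SY]] this[OF E[OF E[OF B[OF X Y]]]] this[OF E[OF B[OF SX Y]]] this[OF E[OF B[OF X SY]]]
        show ?thesis by (simp add: nijenhuis_def Let_def tzero_def)
      qed
    qed
  qed
qed

end

section \<open>The skew operator of a metric and an almost symplectic form\<close>

locale nijenhuis_metric = manifold_atlas A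
  for A :: "('a::{t2_space,second_countable_topology}, 'e::euclidean_space) chart set" +
  fixes \<kappa> g :: "'a \<Rightarrow> ('a, 'e) tvec \<Rightarrow> ('a, 'e) tvec \<Rightarrow> real"
    and R :: "'a \<Rightarrow> ('a, 'e) tvec \<Rightarrow> ('a, 'e) tvec"
  assumes \<kappa>: "two_form A \<kappa>" and g: "riemannian_metric A g" and R: "endo_field A R"
    and g_eq: "x \<in> tangent_space A p \<Longrightarrow> y \<in> tangent_space A p \<Longrightarrow> g p x y = \<kappa> p (R p x) y"
    and nijenhuis_R: "nijenhuis_zero A R"
begin

abbreviation G :: "('a, 'e) chart \<Rightarrow> 'e \<Rightarrow> 'e \<Rightarrow> 'e \<Rightarrow> real" where
  "G c y v w \<equiv> form_comp A g c v w y"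

abbreviation K :: "('a, 'e) chart \<Rightarrow> 'e \<Rightarrow> 'e \<Rightarrow> 'e \<Rightarrow> real" where
  "K c y v w \<equiv> form_comp A \<kappa> c v w y"

lemma G_field: "c \<in> A \<Longrightarrow> form_field (chart_image c) (G c)"
  using g form_comp_form_field unfolding riemannian_metric_def by blast

lemma K_field: "c \<in> A \<Longrightarrow> form_field (chart_image c) (K c)"
  using \<kappa> form_comp_form_field unfolding two_form_def by blast

lemmas R_field = rep_op_field[OF R]

lemma \<kappa>_skew: "x \<in> tangent_space A p \<Longrightarrow> y \<in> tangent_space A p \<Longrightarrow> \<kappa> p x y = - \<kappa> p y x"
  using \<kappa> unfolding two_form_def by blast

lemma g_sym: "x \<in> tangent_space A p \<Longrightarrow> y \<in> tangent_space A p \<Longrightarrow> g p x y = g p y x"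
  using g unfolding riemannian_metric_def by blast

lemma g_pos: "x \<in> tangent_space A p \<Longrightarrow> x \<noteq> tzero \<Longrightarrow> g p x x > 0"
  using g unfolding riemannian_metric_def by blast

lemma K_skew:
  assumes "c \<in> A" "y \<in> chart_image c"
  shows "K c y v w = - K c y w v"
proof -
  obtain p where p: "p \<in> fst c" "y = snd c p" using assms(2) by blast
  note T = coord_field_tangent[OF assms(1) p(1)]
  show ?thesis
    using \<kappa>_skew[OF T[of v] T[of w]] p assms(1) by (simp add: form_comp_def)
qed

lemma G_inner_form:
  assumes "c \<in> A" "y \<in> chart_image c"
  shows "inner_form (G c y)"
proof
  obtain p where p: "p \<in> fst c" "y = snd c p" using assms(2) by blast
  note T = coord_field_tangent[OF assms(1) p(1)]
  show "bilinear (G c y)" by (rule form_field_bilinear[OF G_field[OF assms(1)] assms(2)])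
  show "G c y v w = G c y w v" for v w
    using g_sym[OF T[of v] T[of w]] p assms(1) by (simp add: form_comp_def)
  show "G c y v v > 0" if "v \<noteq> 0" for v
  proof -
    have "coord_field A c v p \<noteq> tzero"
      using coord_field_self[OF assms(1) p(1), of v] that by (auto simp: tzero_def)
    from g_pos[OF T this] show ?thesis using p assms(1) by (simp add: form_comp_def)
  qed
qed

lemma G_eq:
  assumes "c \<in> A" "y \<in> chart_image c"
  shows "G c y v w = K c y (rep R c y v) w"
proof -
  obtain p where p: "p \<in> fst c" "y = snd c p" using assms(2) by blast
  note T = coord_field_tangent[OF assms(1) p(1)]
  have RT: "R p (coord_field A c v p) \<in> tangent_space A p"
    by (rule tangent_endoD(1)[OF endo_field_tangent_endo[OF R] T])
  show ?thesis
    using g_eq[OF T T, of v w] coord_field_component[OF assms(1) p(1) RT] p assms(1)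
    by (simp add: form_comp_def rep_def)
qed

lemma R_K_skew:
  assumes "c \<in> A" "y \<in> chart_image c"
  shows "K c y (rep R c y v) w = - K c y v (rep R c y w)"
  using inner_form.sym[OF G_inner_form[OF assms], of v w] G_eq[OF assms] K_skew[OF assms, of v] by simp

text \<open>Both forms see \<open>R\<close> as a skew operator: \<open>\<kappa>\<close> by the symmetry of \<open>g\<close>, and then \<open>g\<close> because
  \<open>g(R\<cdot>,\<cdot>) = \<kappa>(R\<^sup>2\<cdot>,\<cdot>)\<close>.\<close>

lemma R_G_skew:
  assumes "c \<in> A" "y \<in> chart_image c"
  shows "G c y (rep R c y v) w = - G c y v (rep R c y w)"
  by (simp add: G_eq[OF assms] R_K_skew[OF assms, of "rep R c y v"])

lemma R_linear: "c \<in> A \<Longrightarrow> y \<in> chart_image c \<Longrightarrow> linear (rep R c y)"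
  by (rule op_field_linear[OF R_field])

lemma R_inj:
  assumes "c \<in> A" "y \<in> chart_image c" "rep R c y v = 0"
  shows "v = 0"
proof -
  interpret inner_form "G c y" by (rule G_inner_form[OF assms(1,2)])
  have bK: "bilinear (K c y)" by (rule form_field_bilinear[OF K_field[OF assms(1)] assms(2)])
  have "G c y v v = 0" by (simp add: G_eq[OF assms(1,2)] assms(3) bilinear_lzero[OF bK])
  then show ?thesis using zeroI by simp
qed

lemma R_nijenhuis:
  assumes "c \<in> A" "y \<in> chart_image c"
  shows "nij_bracket (rep R c) (rep R c) y v w = 0"
  using nijenhuis_R assms unfolding nijenhuis_zero_iff[OF R] by blast

lemma exists_spectrum:
  assumes "c \<in> A" "y \<in> chart_image c"
  shows "\<exists>\<Lambda>. has_spectrum \<Lambda> (rep R c y)"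
proof -
  interpret inner_form "G c y" by (rule G_inner_form[OF assms])
  let ?B = "\<lambda>x. - rep R c y (rep R c y x)"
  note lin = R_linear[OF assms]
  have "\<exists>\<Lambda>. finite \<Lambda> \<and> \<Lambda> \<subseteq> {0<..} \<and> (\<forall>x. op_poly (roots_poly \<Lambda>) ?B x = 0)"
  proof (rule spectral_annihilator[OF G_inner_form[OF assms] linear_neg_square[OF lin]])
    show "G c y (?B x) z = G c y x (?B z)" for x z
      by (simp add: form_simps R_G_skew[OF assms])
    show "G c y (?B x) x > 0" if "x \<noteq> 0" for x
    proof -
      have "rep R c y x \<noteq> 0" using R_inj[OF assms] that by blast
      then show ?thesis using pos by (simp add: form_simps R_G_skew[OF assms, of "rep R c y x"])
    qed
  qed
  then show ?thesis
    by (auto simp: has_spectrum_def op_poly_pcompose[OF lin] op_poly_neg_square[OF lin])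
qed

text \<open>The matrices of \<open>R\<close> in two charts are conjugate by the Jacobian.\<close>

lemma has_spectrum_chart_independent:
  assumes "c \<in> A" "d \<in> A" "p \<in> fst c" "p \<in> fst d" "has_spectrum \<Lambda> (rep R c (snd c p))"
  shows "has_spectrum \<Lambda> (rep R d (snd d p))"
proof -
  have lc: "linear (rep R c (snd c p))" and ld: "linear (rep R d (snd d p))"
    using R_linear assms by blast+
  have int: "jac c d p (rep R c (snd c p) v) = rep R d (snd d p) (jac c d p v)" for v
  proof -
    let ?x = "coord_field A c v p"
    note T = coord_field_tangent[OF assms(1,3)]
    have RT: "R p ?x \<in> tangent_space A p"
      by (rule tangent_endoD(1)[OF endo_field_tangent_endo[OF R] T])
    show ?thesis
      using rep_component[OF assms(1,3) T[of v], of R] rep_component[OF assms(2,4) T[of v], of R]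
        tangentD[OF RT assms(1-4)] tangentD[OF T[of v] assms(1-4)] assms(1,3)
      by simp
  qed
  have "op_poly q (rep R d (snd d p)) x = 0" if "\<And>v. op_poly q (rep R c (snd c p)) v = 0" for q x
  proof -
    have "op_poly q (rep R d (snd d p)) (jac c d p (jac d c p x)) =
        jac c d p (op_poly q (rep R c (snd c p)) (jac d c p x))"
      by (rule op_poly_intertwine[of "rep R c (snd c p)" "rep R d (snd d p)" "jac c d p", OF lc ld jac_linear[OF assms(1-4)] int, symmetric])
    then show ?thesis
      using linear_0[OF jac_linear[OF assms(1-4)]] that
        jac_chain[of d c d p x] jac_self[OF assms(2,4)] assms by simp
  qed
  then show ?thesis using assms(5) unfolding has_spectrum_def by blast
qed

text \<open>With \<open>f\<close> the squarefree polynomial with roots \<open>\<Lambda>\<close>, the operator \<open>L = f(- R\<^sup>2)\<close> is symmetric and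
  \<open>tr L\<^sup>2\<close> is locally constant. As \<open>tr L\<^sup>2\<close> is the squared norm of \<open>L\<close>, the condition \<open>L = 0\<close> is
  open and closed.\<close>

lemma has_spectrum_locally_constant:
  assumes "c \<in> A" "p \<in> fst c"
  shows "\<exists>V. open V \<and> p \<in> V \<and> V \<subseteq> fst c \<and>
    (\<forall>q\<in>V. has_spectrum \<Lambda> (rep R c (snd c q)) \<longleftrightarrow> has_spectrum \<Lambda> (rep R c (snd c p)))"
proof -
  let ?W = "chart_image c"
  let ?F = "rep R c"
  let ?f = "pcompose (roots_poly \<Lambda>) [:0, 0, -1:]"
  let ?t = "\<lambda>y. op_trace (\<lambda>x. op_poly ?f (?F y) (op_poly ?f (?F y) x))"
  have zero: "(\<forall>x. op_poly ?f (?F y) x = 0) \<longleftrightarrow> ?t y = 0" if y: "y \<in> ?W" for y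
  proof
    assume "\<forall>x. op_poly ?f (?F y) x = 0"
    then show "?t y = 0" by (simp add: op_trace_def)
  next
    assume t: "?t y = 0"
    interpret inner_form "G c y" by (rule G_inner_form[OF assms(1) y])
    note lin = R_linear[OF assms(1) y]
    have "G c y (op_poly ?f (?F y) u) v = G c y u (op_poly ?f (?F y) v)" for u v
      unfolding op_poly_pcompose[OF lin] op_poly_neg_square[OF lin]
      by (rule op_poly_form_symmetric[OF linear_neg_square[OF lin] bil])
        (simp add: form_simps R_G_skew[OF assms(1) y])
    then show "\<forall>x. op_poly ?f (?F y) x = 0"
      using op_trace_square_symmetric[of "G c y" "op_poly ?f (?F y)", OF G_inner_form[OF assms(1) y] linear_op_poly[OF lin] _ t] by blast
  qed
  have "snd c p \<in> ?W" using assms by blast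
  then obtain r where r: "r > 0" "ball (snd c p) r \<subseteq> ?W"
    using open_chart_image[OF assms(1)] open_contains_ball by blast
  have "\<exists>k. \<forall>y\<in>ball (snd c p) r. op_trace (\<lambda>x. (?F y ^^ 0) (op_poly (?f * ?f) (?F y) x)) = k"
  proof (rule nijenhuis_trace_constant[OF open_chart_image[OF assms(1)] R_field[OF assms(1)] R_nijenhuis[OF assms(1)] _ convex_ball r(2)])
    show "op_trace (?F y) = 0" if "y \<in> ?W" for y
      by (rule op_trace_skew[of "G c y" "rep R c y", OF G_inner_form[OF assms(1) that] R_linear[OF assms(1) that] R_G_skew[OF assms(1) that]])
  qed auto
  then obtain k where k: "\<And>y. y \<in> ball (snd c p) r \<Longrightarrow> op_trace (\<lambda>x. op_poly (?f * ?f) (?F y) x) = k" by auto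
  have t_eq: "?t y = k" if "y \<in> ball (snd c p) r" for y
    using k[OF that] op_poly_mult[OF R_linear[OF assms(1), of y]] that r(2) by (metis (no_types, lifting) ext subsetD)
  define V where "V = fst c \<inter> snd c -` ball (snd c p) r"
  have "open V"
    unfolding V_def
    by (rule continuous_open_preimage[OF homeomorphism_cont1[OF chart_homeomorphism[OF assms(1)]]
          chart_open[OF assms(1)] open_ball])
  moreover have "p \<in> V" "V \<subseteq> fst c" using assms(2) r(1) by (auto simp: V_def)
  moreover have "has_spectrum \<Lambda> (?F (snd c q)) \<longleftrightarrow> has_spectrum \<Lambda> (?F (snd c p))" if q: "q \<in> V" for q
  proof -
    have b: "snd c q \<in> ball (snd c p) r" "snd c p \<in> ball (snd c p) r" using q r(1) by (auto simp: V_def)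
    then have "snd c q \<in> ?W" "snd c p \<in> ?W" using r(2) by blast+
    then show ?thesis unfolding has_spectrum_def zero t_eq[OF b(1)] t_eq[OF b(2)]
      by (simp add: zero t_eq[OF b(1)] t_eq[OF b(2)])
  qed
  ultimately show ?thesis by blast
qed

text \<open>A set \<open>\<Lambda>\<close> that works at one point works on an open and closed set of points, hence everywhere on a
  connected manifold.\<close>

lemma constant_spectrum:
  assumes "connected (UNIV :: 'a set)"
  shows "\<exists>\<Lambda>. \<forall>c\<in>A. \<forall>y\<in>chart_image c. has_spectrum \<Lambda> (rep R c y)"
proof -
  obtain p\<^sub>0 :: 'a where True by blast
  obtain c\<^sub>0 where c0: "c\<^sub>0 \<in> A" "p\<^sub>0 \<in> fst c\<^sub>0" using chart_exists by blast
  obtain \<Lambda> where L: "has_spectrum \<Lambda> (rep R c\<^sub>0 (snd c\<^sub>0 p\<^sub>0))"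
    using exists_spectrum[OF c0(1), of "snd c\<^sub>0 p\<^sub>0"] c0(2) by blast
  define Z where "Z = {p. \<exists>c\<in>A. p \<in> fst c \<and> has_spectrum \<Lambda> (rep R c (snd c p))}"
  have Z: "p \<in> Z \<longleftrightarrow> has_spectrum \<Lambda> (rep R c (snd c p))" if "c \<in> A" "p \<in> fst c" for p c
    using that has_spectrum_chart_independent unfolding Z_def by blast
  have nbhd: "\<exists>V. open V \<and> p \<in> V \<and> (\<forall>q\<in>V. q \<in> Z \<longleftrightarrow> p \<in> Z)" for p
  proof -
    obtain c where c: "c \<in> A" "p \<in> fst c" using chart_exists by blast
    obtain V where V: "open V" "p \<in> V" "V \<subseteq> fst c"
      "\<forall>q\<in>V. has_spectrum \<Lambda> (rep R c (snd c q)) \<longleftrightarrow> has_spectrum \<Lambda> (rep R c (snd c p))"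
      using has_spectrum_locally_constant[OF c] by blast
    have "q \<in> Z \<longleftrightarrow> p \<in> Z" if "q \<in> V" for q
      using V(3,4) that Z[OF c(1), of q] Z[OF c] by blast
    then show ?thesis using V(1,2) by blast
  qed
  have op: "open B" if "\<And>p V. \<forall>q\<in>V. q \<in> Z \<longleftrightarrow> p \<in> Z \<Longrightarrow> p \<in> B \<Longrightarrow> V \<subseteq> B" for B
  proof (subst open_subopen, intro ballI)
    fix p assume p: "p \<in> B"
    obtain V where V: "open V" "p \<in> V" "\<forall>q\<in>V. q \<in> Z \<longleftrightarrow> p \<in> Z" using nbhd by blast
    from V(1,2) that[OF V(3) p] show "\<exists>T. open T \<and> p \<in> T \<and> T \<subseteq> B" by blast
  qed
  have "open Z" by (rule op) auto
  moreover have "open (- Z)" by (rule op) auto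
  moreover have "p\<^sub>0 \<in> Z" using Z[OF c0] L by blast
  ultimately have "Z = UNIV"
    using assms by (auto simp: connected_clopen closed_def dest: spec[of _ Z])
  then have "has_spectrum \<Lambda> (rep R c (snd c p))" if "c \<in> A" "p \<in> fst c" for c p
    using Z[OF that] by blast
  then show ?thesis by blast
qed

end

section \<open>The orthogonal component\<close>

locale constant_spectrum_metric = nijenhuis_metric A \<kappa> g R
  for A :: "('a::{t2_space,second_countable_topology}, 'e::euclidean_space) chart set" and \<kappa> g R +
  fixes \<Lambda> :: "real set"
  assumes spectrum: "c \<in> A \<Longrightarrow> y \<in> snd c ` fst c \<Longrightarrow> has_spectrum \<Lambda> (rep R c y)"
begin

abbreviation "J \<equiv> orthogonal_component A g R"

abbreviation Jop :: "('a, 'e) chart \<Rightarrow> 'e \<Rightarrow> 'e \<Rightarrow> 'e" where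
  "Jop c y \<equiv> op_poly (polar_poly \<Lambda>) (rep R c y)"

lemma skew_op:
  assumes "c \<in> A" "y \<in> chart_image c"
  shows "skew_operator (G c y) (rep R c y) \<Lambda>"
proof -
  interpret inner_form "G c y" by (rule G_inner_form[OF assms])
  show ?thesis
    by unfold_locales
      (rule linear_add[OF R_linear[OF assms]] linear_cmul[OF R_linear[OF assms]] R_G_skew[OF assms]
        spectrum[OF assms] | erule R_inj[OF assms])+
qed

text \<open>The operator on the tangent space with matrix \<open>L\<close>. Values off the tangent space are chosen as in
  \<^const>\<open>orthogonal_component\<close>.\<close>

definition transport :: "('a, 'e) chart \<Rightarrow> 'a \<Rightarrow> ('e \<Rightarrow> 'e) \<Rightarrow> ('a, 'e) tvec \<Rightarrow> ('a, 'e) tvec" where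
  "transport c p L = restrict (\<lambda>x. coord_field A c (L (x c)) p) (tangent_space A p)"

lemma transport_endo:
  assumes "c \<in> A" "p \<in> fst c" "linear L"
  shows "tangent_endo A p (transport c p L)"
  unfolding tangent_endo_def
proof (intro conjI ballI allI)
  show "transport c p L \<in> tangent_space A p \<rightarrow> tangent_space A p"
    using coord_field_tangent[OF assms(1,2)] by (auto simp: transport_def)
  fix x y a b assume xy: "x \<in> tangent_space A p" "y \<in> tangent_space A p"
  show "transport c p L (tcomb a x b y) = tcomb a (transport c p L x) b (transport c p L y)"
    using xy tcomb_tangent[OF xy, of a b] assms
    by (simp add: transport_def coord_field_tcomb[symmetric])
      (simp add: tcomb_def linear_add linear_cmul)
qed

lemma transport_component:
  "c \<in> A \<Longrightarrow> p \<in> fst c \<Longrightarrow> x \<in> tangent_space A p \<Longrightarrow> transport c p L x c = L (x c)"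
  by (simp add: transport_def)

text \<open>Both existence and uniqueness of the polar decomposition are read off in the chart \<open>c\<close>, which may
  be any chart around \<open>p\<close>. So the matrix of \<open>J\<close> is the same polynomial of the matrix of \<open>R\<close> in all
  charts.\<close>

lemma orthogonal_component_eq:
  assumes c: "c \<in> A" and p: "p \<in> fst c"
  shows "J p = transport c p (Jop c (snd c p))"
proof -
  let ?y = "snd c p"
  let ?T = "tangent_space A p"
  have y: "?y \<in> chart_image c" using p by blast
  interpret sk: skew_operator "G c ?y" "rep R c ?y" \<Lambda> by (rule skew_op[OF c y])
  note comp = form_comp_component[OF c p]
  note tr = transport_component[OF c p]
  let ?S = "transport c p (spec_op \<Lambda> sqrt (rep R c ?y))"
  let ?J = "transport c p (Jop c ?y)"
  have eS: "tangent_endo A p ?S" by (rule transport_endo[OF c p linear_spec_op[OF sk.lin]])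
  have eJ: "tangent_endo A p ?J" by (rule transport_endo[OF c p linear_op_poly[OF sk.lin]])
  note S = tangent_endoD(1)[OF eS] and J = tangent_endoD(1)[OF eJ]
  have polar: "polar_decomposition A g p (R p) ?S ?J"
    unfolding polar_decomposition_def
  proof (intro conjI ballI impI eS eJ)
    fix x assume x: "x \<in> ?T"
    have Rx: "R p x \<in> ?T" by (rule tangent_endoD(1)[OF endo_field_tangent_endo[OF R] x])
    show "R p x = ?S (?J x)"
      by (rule tangent_eqI[OF Rx S[OF J[OF x]] c p])
        (simp add: tr[OF J[OF x]] tr[OF x] rep_component[OF c p x] sk.R_eq[symmetric])
    show "g p (?S x) x > 0" if "x \<noteq> tzero"
    proof -
      have "x c \<noteq> 0"
      proof
        assume "x c = 0"
        have tz: "tzero \<in> tangent_space A p"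
          using tcomb_tangent[OF x x, of 0 0] by (simp add: tcomb_def tzero_def)
        have "x = tzero"
          by (rule tangent_eqI[OF x tz c p]) (simp add: \<open>x c = 0\<close> tzero_def)
        then show False using that by simp
      qed
      then show ?thesis using sk.S_pos by (simp add: comp[OF S[OF x] x] tr[OF x])
    qed
    fix z assume z: "z \<in> ?T"
    show "g p (?S x) z = g p x (?S z)"
      by (simp add: comp[OF S[OF x] z] comp[OF x S[OF z]] tr[OF x] tr[OF z] sk.spec_op_symmetric)
    show "g p (?J x) (?J z) = g p x z"
      by (simp add: comp[OF J[OF x] J[OF z]] comp[OF x z] tr[OF x] tr[OF z] sk.J_orthogonal)
  qed
  have ext: "?J \<in> extensional ?T" by (simp add: transport_def)
  show ?thesis
    unfolding orthogonal_component_def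
  proof (rule the_equality)
    show "?J \<in> extensional ?T \<and> (\<exists>S. polar_decomposition A g p (R p) S ?J)"
      using ext polar by blast
    fix J' assume J': "J' \<in> extensional ?T \<and> (\<exists>S. polar_decomposition A g p (R p) S J')"
    then obtain S' where pd: "polar_decomposition A g p (R p) S' J'" by blast
    have eS': "tangent_endo A p S'" and eJ': "tangent_endo A p J'"
      using pd unfolding polar_decomposition_def by blast+
    note T = coord_field_tangent[OF c p]
    note S' = tangent_endoD(1)[OF eS'] and J'T = tangent_endoD(1)[OF eJ']
    let ?s = "\<lambda>v. S' (coord_field A c v p) c" and ?j = "\<lambda>v. J' (coord_field A c v p) c"
    have j: "?j v = Jop c ?y v" for v
    proof (rule polar_unique[of "G c ?y" "rep R c ?y" \<Lambda> ?s ?j, OF skew_op[OF c y] linear_component[OF eS' c p] linear_component[OF eJ' c p]])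
      show "rep R c ?y v = ?s (?j v)" for v
        using pd T c p unfolding polar_decomposition_def
        by (simp add: rep_def coord_field_component[OF c p J'T[OF T]])
      show "G c ?y (?s v) w = G c ?y v (?s w)" for v w
      proof -
        have "g p (S' (coord_field A c v p)) (coord_field A c w p) = g p (coord_field A c v p) (S' (coord_field A c w p))"
          using pd T unfolding polar_decomposition_def by blast
        then show ?thesis by (simp add: comp[OF S'[OF T] T] comp[OF T S'[OF T]] c p)
      qed
      show "G c ?y (?s v) v > 0" if "v \<noteq> 0" for v
      proof -
        have "coord_field A c v p \<noteq> tzero"
          using coord_field_self[OF c p, of v] that by (auto simp: tzero_def)
        then have "g p (S' (coord_field A c v p)) (coord_field A c v p) > 0"
          using pd T unfolding polar_decomposition_def by blast
        then show ?thesis by (simp add: comp[OF S'[OF T] T] c p)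
      qed
      show "G c ?y (?j v) (?j w) = G c ?y v w" for v w
      proof -
        have "g p (J' (coord_field A c v p)) (J' (coord_field A c w p)) = g p (coord_field A c v p) (coord_field A c w p)"
          using pd T unfolding polar_decomposition_def by blast
        then show ?thesis by (simp add: comp[OF J'T[OF T] J'T[OF T]] comp[OF T T] c p)
      qed
    qed
    show "J' = ?J"
    proof (rule extensionalityI[of _ ?T])
      fix x assume x: "x \<in> ?T"
      show "J' x = ?J x"
        by (rule tangent_eqI[OF J'T[OF x] J[OF x] c p])
          (use j[of "x c"] in \<open>simp add: tr[OF x] coord_field_component[OF c p x]\<close>)
    qed (use J' ext in blast)+
  qed
qed

lemma J_endo: "tangent_endo A p (J p)"
proof -
  obtain c where c: "c \<in> A" "p \<in> fst c" using chart_exists by blast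
  show ?thesis
    unfolding orthogonal_component_eq[OF c]
    by (rule transport_endo[OF c linear_op_poly[OF R_linear[OF c(1)]]]) (use c in blast)
qed

lemma J_component: "c \<in> A \<Longrightarrow> p \<in> fst c \<Longrightarrow> x \<in> tangent_space A p \<Longrightarrow> J p x c = Jop c (snd c p) (x c)"
  by (simp add: orthogonal_component_eq transport_component)

lemma rep_J:
  assumes "c \<in> A" "y \<in> chart_image c"
  shows "rep J c y v = Jop c y v"
proof -
  obtain p where p: "p \<in> fst c" "y = snd c p" using assms(2) by blast
  show ?thesis
    using J_component[OF assms(1) p(1) coord_field_tangent[OF assms(1) p(1)], of v] p assms(1)
    by (simp add: rep_def)
qed

lemma Jop_field: "c \<in> A \<Longrightarrow> op_field (chart_image c) (Jop c)"
  by (rule op_field_poly[OF open_chart_image R_field])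

lemma J_endo_field: "endo_field A J"
  unfolding endo_field_def
proof (intro conjI allI ballI J_endo)
  fix c v assume c: "c \<in> A"
  have "smooth_on (chart_image c) (\<lambda>y. rep J c y v)"
    by (rule smooth_on_cong[OF open_chart_image[OF c] _ op_field_smooth[OF Jop_field[OF c]]])
      (simp add: rep_J[OF c])
  then show "smooth_on (chart_image c) (\<lambda>y. J (chart_inv c y) (coord_field A c v (chart_inv c y)) c)"
    by (simp add: rep_def)
qed

lemma J_skew_symmetric: "skew_symmetric A g J"
  unfolding skew_symmetric_def
proof (intro allI ballI)
  fix p x y assume x: "x \<in> tangent_space A p" and y: "y \<in> tangent_space A p"
  obtain c where c: "c \<in> A" "p \<in> fst c" using chart_exists by blast
  interpret sk: skew_operator "G c (snd c p)" "rep R c (snd c p)" \<Lambda>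
    by (rule skew_op[OF c(1)]) (use c in blast)
  note J = tangent_endoD(1)[OF J_endo]
  show "g p (J p x) y = - g p x (J p y)"
    by (simp add: form_comp_component[OF c J[OF x] y] form_comp_component[OF c x J[OF y]]
        J_component[OF c x] J_component[OF c y] sk.J_skew)
qed

lemma J_nijenhuis_zero: "nijenhuis_zero A J"
  unfolding nijenhuis_zero_iff[OF J_endo_field]
proof (intro ballI allI)
  fix c y v w assume c: "c \<in> A" and y: "y \<in> chart_image c"
  have d: "op_deriv (rep J c) y u x = op_deriv (Jop c) y u x" for u x
    by (rule op_deriv_cong[OF open_chart_image[OF c] rep_op_field[OF J_endo_field c] y])
      (rule rep_J[OF c])
  have "nij_bracket (rep J c) (rep J c) y v w = nij_bracket (Jop c) (Jop c) y v w"
    by (simp add: nij_bracket_def d rep_J[OF c y])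
  also have "\<dots> = 0"
    by (rule nij_bracket_poly[OF open_chart_image[OF c] R_field[OF c] y R_nijenhuis[OF c y]])
  finally show "nij_bracket (rep J c) (rep J c) y v w = 0" .
qed

lemma J_squared:
  assumes "x \<in> tangent_space A p"
  shows "J p (J p x) = (\<lambda>c. - x c)"
proof
  fix c
  note J = tangent_endoD(1)[OF J_endo]
  show "J p (J p x) c = - x c"
  proof (cases "c \<in> A \<and> p \<in> fst c")
    case True
    then have c: "c \<in> A" "p \<in> fst c" by auto
    interpret sk: skew_operator "G c (snd c p)" "rep R c (snd c p)" \<Lambda>
      by (rule skew_op[OF c(1)]) (use c in blast)
    show ?thesis by (simp add: J_component[OF c] J assms sk.J_J)
  next
    case False
    then show ?thesis using tangent_outside[OF J[OF J[OF assms]]] tangent_outside[OF assms] by simp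
  qed
qed

abbreviation \<omega> :: "'a \<Rightarrow> ('a, 'e) tvec \<Rightarrow> ('a, 'e) tvec \<Rightarrow> real" where
  "\<omega> \<equiv> \<lambda>p x y. g p (J p x) y"

lemma \<omega>_component:
  assumes "c \<in> A" "y \<in> chart_image c"
  shows "form_comp A \<omega> c v w y = G c y (Jop c y v) w"
proof -
  obtain p where p: "p \<in> fst c" "y = snd c p" using assms(2) by blast
  note T = coord_field_tangent[OF assms(1) p(1)]
  have "g p (J p (coord_field A c v p)) (coord_field A c w p) = G c y (Jop c y v) w"
    using form_comp_component[OF assms(1) p(1) tangent_endoD(1)[OF J_endo T] T] J_component[OF assms(1) p(1) T] p assms(1)
    by simp
  then show ?thesis using p assms(1) by (simp add: form_comp_def)
qed

lemma \<omega>_two_form: "two_form A \<omega>"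
  unfolding two_form_def bilinear_field_def
proof (intro conjI allI ballI)
  fix p x y z and a b :: real
  assume x: "x \<in> tangent_space A p" and y: "y \<in> tangent_space A p" and z: "z \<in> tangent_space A p"
  note J = tangent_endoD[OF J_endo]
  have B: "g p (tcomb a x b y) z = a * g p x z + b * g p y z"
    "g p z (tcomb a x b y) = a * g p z x + b * g p z y"
    if "x \<in> tangent_space A p" "y \<in> tangent_space A p" "z \<in> tangent_space A p" for x y z
    using g that unfolding riemannian_metric_def bilinear_field_def by blast+
  show "\<omega> p (tcomb a x b y) z = a * \<omega> p x z + b * \<omega> p y z"
    by (simp add: J(2)[OF x y] B J(1) x y z)
  show "\<omega> p z (tcomb a x b y) = a * \<omega> p z x + b * \<omega> p z y"
    by (simp add: B J(1) x y z)
next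
  fix c v w assume c: "c \<in> A"
  have "form_field (chart_image c) (\<lambda>y v w. G c y (Jop c y v) w)"
    by (rule form_field_comp_left[OF open_chart_image[OF c] G_field[OF c] Jop_field[OF c]])
  then have "smooth_on (chart_image c) (\<lambda>y. G c y (Jop c y v) w)" by (simp add: form_field_def)
  then show "smooth_on (chart_image c) (form_comp A \<omega> c v w)"
    by (rule smooth_on_cong[OF open_chart_image[OF c], rotated]) (simp add: \<omega>_component[OF c])
next
  fix p x y assume x: "x \<in> tangent_space A p" and y: "y \<in> tangent_space A p"
  have "g p x (J p y) = g p (J p y) x"
    by (rule g_sym[OF x tangent_endoD(1)[OF J_endo y]])
  then show "\<omega> p x y = - \<omega> p y x"
    using J_skew_symmetric x y unfolding skew_symmetric_def by simp
qed

text \<open>In a chart, \<open>\<omega> = \<kappa>(R J\<cdot>,\<cdot>) = - \<kappa>(S\<cdot>,\<cdot>)\<close> is a combination with constant coefficients of the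
  forms \<open>\<kappa>(P\<^sub>l\<cdot>,\<cdot>)\<close>, where \<open>P\<^sub>l\<close> is the spectral projection of \<open>- R\<^sup>2\<close> to the eigenvalue \<open>l\<close>.\<close>

lemma \<omega>_closed:
  assumes "closed_form A \<kappa>"
  shows "closed_form A \<omega>"
  unfolding closed_form_def
proof (intro ballI allI)
  fix c p u v w assume c: "c \<in> A" and p: "p \<in> fst c"
  let ?W = "chart_image c"
  let ?y = "snd c p"
  let ?P = "\<lambda>l y. spec_op \<Lambda> (\<lambda>m. if m = l then 1 else 0) (rep R c y)"
  have y: "?y \<in> ?W" using p by blast
  note W = open_chart_image[OF c]
  have P: "op_field ?W (?P l)" for l
    unfolding spec_op_def by (rule op_field_poly[OF W R_field[OF c]])
  note KP = form_field_comp_left[OF W K_field[OF c] P]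
  have PK: "form_ext (\<lambda>y v w. K c y (?P l y v) w) ?y u v w = 0" for l
  proof (rule form_ext_projection[OF W K_field[OF c] P y])
    fix z a b assume z: "z \<in> ?W"
    note lin = R_linear[OF c z]
    have bil: "bilinear (K c z)" by (rule form_field_bilinear[OF K_field[OF c] z])
    show "K c z a b = - K c z b a" by (rule K_skew[OF c z])
    show "K c z (?P l z a) b = K c z a (?P l z b)"
      unfolding spec_op_alt[OF lin]
      by (rule op_poly_form_symmetric[OF linear_neg_square[OF lin] bil])
        (simp add: bilinear_lneg[OF bil] bilinear_rneg[OF bil] R_K_skew[OF c z])
    show "?P l z (?P l z a) = ?P l z a"
      unfolding spec_op_mult[OF lin spectrum[OF c z]]
      by (rule spec_op_cong[OF lin spectrum[OF c z]]) simp
  next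
    show "nij_bracket (?P l) (?P l) ?y a b = 0" for a b
      unfolding spec_op_def by (rule nij_bracket_poly[OF W R_field[OF c] y R_nijenhuis[OF c y]])
    show "form_ext (K c) ?y a b d = 0" for a b d
      using assms c p unfolding closed_form_def ext_deriv_def form_ext_def form_deriv_def by blast
  qed
  have eq: "form_comp A \<omega> c a b z = (\<Sum>l\<in>\<Lambda>. - sqrt l * K c z (?P l z a) b)" if z: "z \<in> ?W" for z a b
  proof -
    interpret sk: skew_operator "G c z" "rep R c z" \<Lambda> by (rule skew_op[OF c z])
    have bK: "bilinear (K c z)" by (rule form_field_bilinear[OF K_field[OF c] z])
    have lK: "linear (\<lambda>x. K c z x b)" using bK by (simp add: bilinear_def)
    have "form_comp A \<omega> c a b z = - K c z (spec_op \<Lambda> sqrt (rep R c z) a) b"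
      by (simp add: \<omega>_component[OF c z] G_eq[OF c z] sk.R_J bilinear_lneg[OF bK])
    also have "\<dots> = - K c z (\<Sum>l\<in>\<Lambda>. sqrt l *\<^sub>R ?P l z a) b"
      by (simp add: spec_op_sum[OF sk.lin sk.spec, of sqrt])
    also have "\<dots> = (\<Sum>l\<in>\<Lambda>. - sqrt l * K c z (?P l z a) b)"
      using linear_sum[OF lK, of "\<lambda>l. sqrt l *\<^sub>R ?P l z a" \<Lambda>]
      by (simp add: bilinear_lmul[OF bK] sum_negf)
    finally show ?thesis .
  qed
  have \<omega>F: "form_field ?W (\<lambda>y v w. form_comp A \<omega> c v w y)"
    using form_comp_form_field[OF _ c] \<omega>_two_form unfolding two_form_def by blast
  have "ext_deriv A \<omega> c p u v w = form_ext (\<lambda>y v w. form_comp A \<omega> c v w y) ?y u v w"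
    by (simp add: ext_deriv_def form_ext_def form_deriv_def)
  also have "\<dots> = form_ext (\<lambda>y v w. \<Sum>l\<in>\<Lambda>. - sqrt l * K c y (?P l y v) w) ?y u v w"
    by (rule form_ext_cong[OF W \<omega>F y eq])
  also have "\<dots> = (\<Sum>l\<in>\<Lambda>. - sqrt l * form_ext (\<lambda>y v w. K c y (?P l y v) w) ?y u v w)"
    by (rule form_ext_sum[OF y KP])
  also have "\<dots> = 0" by (simp add: PK)
  finally show "ext_deriv A \<omega> c p u v w = 0" .
qed

lemma J_kaehler: "closed_form A \<kappa> \<Longrightarrow> kaehler A g J"
  unfolding kaehler_def
  using g J_endo_field J_squared J_nijenhuis_zero \<omega>_two_form \<omega>_closed by blast

end

theorem theorem5p1:
  fixes A :: "('a::{t2_space,second_countable_topology}, 'e::euclidean_space) chart set"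
    and \<kappa> g :: "'a \<Rightarrow> ('a, 'e) tvec \<Rightarrow> ('a, 'e) tvec \<Rightarrow> real"
    and R :: "'a \<Rightarrow> ('a, 'e) tvec \<Rightarrow> ('a, 'e) tvec"
    and n :: nat
  assumes "smooth_atlas A" and "connected (UNIV :: 'a set)" and "DIM('e) = 2 * n"
    and "almost_symplectic A \<kappa>"
    and "riemannian_metric A g"
    and "\<And>p v. (\<And>i. i < 2 * n \<Longrightarrow> v i \<in> tangent_space A p) \<Longrightarrow>
           volume_form (2 * n) (wedge_power (\<kappa> p) n) (g p) v = wedge_power (\<kappa> p) n v / fact n"
    and "endo_field A R"
    and "\<And>p x y. x \<in> tangent_space A p \<Longrightarrow> y \<in> tangent_space A p \<Longrightarrow> g p x y = \<kappa> p (R p x) y"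
    and "nijenhuis_zero A R"
  shows "endo_field A (orthogonal_component A g R) \<and>
         skew_symmetric A g (orthogonal_component A g R) \<and>
         nijenhuis_zero A (orthogonal_component A g R) \<and>
         (closed_form A \<kappa> \<longrightarrow> kaehler A g (orthogonal_component A g R))"
proof -
  have two: "two_form A \<kappa>" using assms(4) by (simp add: almost_symplectic_def)
  interpret nijenhuis_metric A \<kappa> g R
    by unfold_locales (use assms two in blast)+
  obtain \<Lambda> where "\<And>c y. c \<in> A \<Longrightarrow> y \<in> snd c ` fst c \<Longrightarrow> has_spectrum \<Lambda> (rep R c y)"
    using constant_spectrum[OF assms(2)] by blast
  then interpret constant_spectrum_metric A \<kappa> g R \<Lambda>
    by unfold_locales blast
  show ?thesis
    using J_endo_field J_skew_symmetric J_nijenhuis_zero J_kaehler by blast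
qed

end
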